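(* For any q-tame persistence modules $U$ and $V$ indexed by $\mathbb{R}$, $$d_I(U,V)=d_B(\mathrm{dgm}(U),\mathrm{dgm}(V)).$$
   Context: Fix a field $F$; all vector spaces are over $F$. A persistence module $V$ indexed by $\mathbb{R}$ is a functor from the poset $\mathbb{R}$ to vector spaces, with spaces $V_t$ and structure maps $V_{s\le t}$; morphisms are natural transformations; direct sums are pointwise. $V$ is q-tame if $V_{s\le t}$ has finite rank whenever $s<t$. For a nonempty interval $L\subseteq\mathbb{R}$, the interval module $\mathbb{I}(L)$ is $F$ at $t\in L$ and $0$ elsewhere, with identity structure maps inside $L$ and zero maps otherwise. By a theorem of Crawley-Boevey, every pointwise finite-dimensional module indexed by $\mathbb{R}$ is isomorphic to a direct sum of interval modules, and the multiset of intervals is unique. Interleaving distance: $V_{\_+\varepsilon}$ is the module with $t$ component $V_{t+\varepsilon}$ and structure maps $V_{s+\varepsilon\le t+\varepsilon}$. For $\varepsilon\ge0$, an $\varepsilon$-interleaving between $U$ and $V$ is a pair of morphisms $\varphi\colon U\to V_{\_+\varepsilon}$, $\psi\colon V\to U_{\_+\varepsilon}$ with $\psi_{t+\varepsilon}\circ\varphi_t=U_{t\le t+2\varepsilon}$ and $\varphi_{t+\varepsilon}\circ\psi_t=V_{t\le t+2\varepsilon}$ for all $t$. $d_I(U,V)=\inf\{\varepsilon>0\mid$ there exists an $\varepsilon$-interleaving between $U$ and $V\}$. Persistence diagram of a q-tame module $V$: for $\varepsilon>0$, the $\varepsilon$-smoothing $V^\varepsilon$ is given by $V^\varepsilon_t=\operatorname{im}(V_{t-\varepsilon\le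 t+\varepsilon})$ with structure maps the restrictions of those of $V$; it is pointwise finite dimensional, so $V^\varepsilon\cong\bigoplus_{i\in I}\mathbb{I}(L_i)$. Let $\overline{b_i},\overline{d_i}\in\mathbb{R}\cup\{\pm\infty\}$ be the infimum and supremum of $L_i$. Define the multiset $\mathrm{dgm}^\varepsilon(V^\varepsilon)=\{(\overline{b_i}-\varepsilon,\overline{d_i}+\varepsilon)\mid i\in I,\ \overline{b_i}<\overline{d_i}\}$. These satisfy $\mathrm{dgm}^{\varepsilon_2}(V^{\varepsilon_2})\subseteq\mathrm{dgm}^{\varepsilon_1}(V^{\varepsilon_1})$ for $\varepsilon_2>\varepsilon_1>0$. Then $\mathrm{dgm}(V)=\bigcup_{\varepsilon>0}\mathrm{dgm}^\varepsilon(V^\varepsilon)$, where the multiplicity of a point in the union is its maximum multiplicity over all $\varepsilon>0$. Bottleneck distance: a matching of two diagrams (indexed multisets of points of $\{(x,y)\in(\mathbb{R}\cup\{\pm\infty\})^2\mid x<y\}$) is a subset $M$ of the product of their index sets in which each index of either occurs at most once. It is an $\varepsilon$-matching if (1) every point $(\overline b,\overline d)$ in either diagram with $\overline d-\overline b>2\varepsilon$ is matched, and (2) if $(\overline b_1,\overline d_1)$ and $(\overline b_2,\overline d_2)$ are matched then $|\overline b_1-\overline b_2|\le\varepsilon$ and $|\overline d_1-\overline d_2|\le\varepsilon$ (equal infinite values have difference $0$; otherwise a difference involving an infinite value is infinite). $d_B$ of two diagrams is $\inf\{\varepsilon>0\mid$ there exists an $\varepsilon$-matching between them$\}$. The infimum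 of the empty set is $\infty$. *)

theory Defs
  imports
    "HOL-Analysis.Analysis"
    "HOL-Library.Poly_Mapping"
    "HOL-Library.Extended_Nat"
    "HOL-Library.Extended_Real"
begin

section \<open>Persistence modules indexed by the reals\<close>

text \<open>
  The vector spaces of a persistence module over the field \<open>'f\<close> are given as linear subspaces
  \<open>vspace V t\<close> of one ambient vector space \<open>'v\<close> with scalar multiplication \<open>vscale V\<close>. This is no
  loss of generality, as an arbitrary family of vector spaces embeds into its direct sum; the
  position of the subspaces relative to each other plays no role. The map \<open>vmap V s t\<close> is only
  meaningful for \<open>s \<le> t\<close> and on \<open>vspace V s\<close>; in the same way a morphism \<open>\<phi>\<close> is only meaningful
  at parameter \<open>t\<close> on the space at \<open>t\<close>.
\<close>

record ('f, 'v) pmodule =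
  vscale :: "'f \<Rightarrow> 'v \<Rightarrow> 'v"
  vspace :: "real \<Rightarrow> 'v set"
  vmap   :: "real \<Rightarrow> real \<Rightarrow> 'v \<Rightarrow> 'v"

definition linear_between ::
  "('f::field \<Rightarrow> 'u::ab_group_add \<Rightarrow> 'u) \<Rightarrow> 'u set \<Rightarrow>
   ('f \<Rightarrow> 'v::ab_group_add \<Rightarrow> 'v) \<Rightarrow> 'v set \<Rightarrow> ('u \<Rightarrow> 'v) \<Rightarrow> bool"
where
  "linear_between sc S sc' T f \<longleftrightarrow>
     f ` S \<subseteq> T \<and>
     (\<forall>x\<in>S. \<forall>y\<in>S. f (x + y) = f x + f y) \<and>
     (\<forall>c. \<forall>x\<in>S. f (sc c x) = sc' c (f x))"

definition persistence_module :: "('f::field, 'v::ab_group_add) pmodule \<Rightarrow> bool" where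
  "persistence_module V \<longleftrightarrow>
     vector_space (vscale V) \<and>
     (\<forall>t. module.subspace (vscale V) (vspace V t)) \<and>
     (\<forall>s t. s \<le> t \<longrightarrow>
        linear_between (vscale V) (vspace V s) (vscale V) (vspace V t) (vmap V s t)) \<and>
     (\<forall>t. \<forall>x\<in>vspace V t. vmap V t t x = x) \<and>
     (\<forall>r s t. r \<le> s \<longrightarrow> s \<le> t \<longrightarrow>
        (\<forall>x\<in>vspace V r. vmap V s t (vmap V r s x) = vmap V r t x))"

definition q_tame :: "('f::field, 'v::ab_group_add) pmodule \<Rightarrow> bool" where
  "q_tame V \<longleftrightarrow>
     (\<forall>s t. s < t \<longrightarrow>
        (\<exists>B. finite B \<and> vmap V s t ` vspace V s = module.span (vscale V) B))"

definition morphism ::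
  "('f::field, 'u::ab_group_add) pmodule \<Rightarrow> ('f, 'v::ab_group_add) pmodule \<Rightarrow>
   (real \<Rightarrow> 'u \<Rightarrow> 'v) \<Rightarrow> bool"
where
  "morphism U V \<phi> \<longleftrightarrow>
     (\<forall>t. linear_between (vscale U) (vspace U t) (vscale V) (vspace V t) (\<phi> t)) \<and>
     (\<forall>s t. s \<le> t \<longrightarrow>
        (\<forall>x\<in>vspace U s. \<phi> t (vmap U s t x) = vmap V s t (\<phi> s x)))"

definition isomorphic ::
  "('f::field, 'u::ab_group_add) pmodule \<Rightarrow> ('f, 'v::ab_group_add) pmodule \<Rightarrow> bool"
where
  "isomorphic U V \<longleftrightarrow>
     (\<exists>\<phi> \<psi>. morphism U V \<phi> \<and> morphism V U \<psi> \<and>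
        (\<forall>t. \<forall>x\<in>vspace U t. \<psi> t (\<phi> t x) = x) \<and>
        (\<forall>t. \<forall>y\<in>vspace V t. \<phi> t (\<psi> t y) = y))"


section \<open>Interleaving distance\<close>

definition shift :: "real \<Rightarrow> ('f, 'v) pmodule \<Rightarrow> ('f, 'v) pmodule" where
  "shift \<epsilon> V = \<lparr>vscale = vscale V,
                vspace = (\<lambda>t. vspace V (t + \<epsilon>)),
                vmap = (\<lambda>s t. vmap V (s + \<epsilon>) (t + \<epsilon>))\<rparr>"

definition interleaving ::
  "real \<Rightarrow> ('f::field, 'u::ab_group_add) pmodule \<Rightarrow> ('f, 'v::ab_group_add) pmodule \<Rightarrow>
   (real \<Rightarrow> 'u \<Rightarrow> 'v) \<Rightarrow> (real \<Rightarrow> 'v \<Rightarrow> 'u) \<Rightarrow> bool"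
where
  "interleaving \<epsilon> U V \<phi> \<psi> \<longleftrightarrow>
     morphism U (shift \<epsilon> V) \<phi> \<and> morphism V (shift \<epsilon> U) \<psi> \<and>
     (\<forall>t. \<forall>x\<in>vspace U t. \<psi> (t + \<epsilon>) (\<phi> t x) = vmap U t (t + 2 * \<epsilon>) x) \<and>
     (\<forall>t. \<forall>y\<in>vspace V t. \<phi> (t + \<epsilon>) (\<psi> t y) = vmap V t (t + 2 * \<epsilon>) y)"

definition d_I ::
  "('f::field, 'u::ab_group_add) pmodule \<Rightarrow> ('f, 'v::ab_group_add) pmodule \<Rightarrow> ereal"
where
  "d_I U V = Inf {ereal \<epsilon> |\<epsilon>. \<epsilon> > 0 \<and> (\<exists>\<phi> \<psi>. interleaving \<epsilon> U V \<phi> \<psi>)}"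


section \<open>Interval modules, direct sums and barcodes\<close>

definition interval_module :: "real set \<Rightarrow> ('f::field, 'f) pmodule" where
  "interval_module L = \<lparr>vscale = (*),
                        vspace = (\<lambda>t. if t \<in> L then UNIV else {0}),
                        vmap = (\<lambda>s t x. if s \<in> L \<and> t \<in> L then x else 0)\<rparr>"

text \<open>
  Elements of a direct sum are finitely supported functions; \<open>Poly_Mapping.mapp\<close> applies a family
  of maps componentwise.
\<close>

definition direct_sum ::
  "'i set \<Rightarrow> ('i \<Rightarrow> ('f::field, 'w::ab_group_add) pmodule) \<Rightarrow> ('f, 'i \<Rightarrow>\<^sub>0 'w) pmodule"
where
  "direct_sum I W =
     \<lparr>vscale = (\<lambda>c. Poly_Mapping.mapp (\<lambda>i. vscale (W i) c)),
      vspace = (\<lambda>t. {p. Poly_Mapping.keys p \<subseteq> I \<and>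
                        (\<forall>i\<in>I. Poly_Mapping.lookup p i \<in> vspace (W i) t)}),
      vmap = (\<lambda>s t. Poly_Mapping.mapp (\<lambda>i. vmap (W i) s t))\<rparr>"

text \<open>
  A multiset on \<open>'a\<close>, given by its multiplicities, is indexed by the pairs of an element \<open>a\<close> and a
  number \<open>k\<close> smaller than the multiplicity of \<open>a\<close>. Library multisets are not applicable, since
  barcodes and persistence diagrams may be infinite.
\<close>

definition copies :: "('a \<Rightarrow> enat) \<Rightarrow> ('a \<times> nat) set" where
  "copies m = {(a, k). enat k < m a}"

definition is_barcode :: "('f::field, 'v::ab_group_add) pmodule \<Rightarrow> (real set \<Rightarrow> enat) \<Rightarrow> bool" where
  "is_barcode V m \<longleftrightarrow>
     (\<forall>L. m L \<noteq> 0 \<longrightarrow> is_interval L \<and> L \<noteq> {}) \<and>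
     isomorphic V
       (direct_sum (copies m) (\<lambda>i. interval_module (fst i) :: ('f, 'f) pmodule))"

text \<open>
  For pointwise finite-dimensional \<open>V\<close> a barcode exists (Crawley-Boevey), is unique, and has
  finite multiplicities.
\<close>

definition barcode :: "('f::field, 'v::ab_group_add) pmodule \<Rightarrow> real set \<Rightarrow> enat" where
  "barcode V = (SOME m. is_barcode V m)"


section \<open>Persistence diagrams\<close>

definition smoothing :: "real \<Rightarrow> ('f, 'v) pmodule \<Rightarrow> ('f, 'v) pmodule" where
  "smoothing \<epsilon> V = \<lparr>vscale = vscale V,
                    vspace = (\<lambda>t. vmap V (t - \<epsilon>) (t + \<epsilon>) ` vspace V (t - \<epsilon>)),
                    vmap = (\<lambda>s t. vmap V (s + \<epsilon>) (t + \<epsilon>))\<rparr>"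

text \<open>
  A diagram is a multiset of points, given by its multiplicities. In the following definition
  \<open>W\<close> is to be instantiated with \<open>smoothing \<epsilon> V\<close>. The set whose cardinality is taken is then finite:
  intervals with the same infimum and supremum share an interior point, where \<open>W\<close> is
  finite-dimensional.
\<close>

definition dgm_eps ::
  "real \<Rightarrow> ('f::field, 'v::ab_group_add) pmodule \<Rightarrow> ereal \<times> ereal \<Rightarrow> enat"
where
  "dgm_eps \<epsilon> W p =
     enat (card {i \<in> copies (barcode W).
       let b = Inf (ereal ` fst i); d = Sup (ereal ` fst i)
       in b < d \<and> p = (b - ereal \<epsilon>, d + ereal \<epsilon>)})"

text \<open>For q-tame \<open>V\<close> the supremum is attained: the multiplicities are bounded by a rank.\<close>

definition dgm :: "('f::field, 'v::ab_group_add) pmodule \<Rightarrow> ereal \<times> ereal \<Rightarrow> enat" where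
  "dgm V p = (SUP \<epsilon>\<in>{0<..}. dgm_eps \<epsilon> (smoothing \<epsilon> V) p)"


section \<open>Bottleneck distance\<close>

text \<open>The case distinction is needed because \<open>\<bar>\<infinity> - \<infinity>\<bar> = \<infinity>\<close> on \<^typ>\<open>ereal\<close>.\<close>

definition ediff :: "ereal \<Rightarrow> ereal \<Rightarrow> ereal" where
  "ediff x y = (if x = y then 0 else \<bar>x - y\<bar>)"

definition matching ::
  "(ereal \<times> ereal \<Rightarrow> enat) \<Rightarrow> (ereal \<times> ereal \<Rightarrow> enat) \<Rightarrow>
   (((ereal \<times> ereal) \<times> nat) \<times> ((ereal \<times> ereal) \<times> nat)) set \<Rightarrow> bool"
where
  "matching D E M \<longleftrightarrow>
     M \<subseteq> copies D \<times> copies E \<and>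
     (\<forall>i j j'. (i, j) \<in> M \<longrightarrow> (i, j') \<in> M \<longrightarrow> j = j') \<and>
     (\<forall>i i' j. (i, j) \<in> M \<longrightarrow> (i', j) \<in> M \<longrightarrow> i = i')"

definition eps_matching ::
  "real \<Rightarrow> (ereal \<times> ereal \<Rightarrow> enat) \<Rightarrow> (ereal \<times> ereal \<Rightarrow> enat) \<Rightarrow>
   (((ereal \<times> ereal) \<times> nat) \<times> ((ereal \<times> ereal) \<times> nat)) set \<Rightarrow> bool"
where
  "eps_matching \<epsilon> D E M \<longleftrightarrow>
     matching D E M \<and>
     (\<forall>((b, d), k) \<in> copies D. d - b > ereal (2 * \<epsilon>) \<longrightarrow> ((b, d), k) \<in> Domain M) \<and>
     (\<forall>((b, d), k) \<in> copies E. d - b > ereal (2 * \<epsilon>) \<longrightarrow> ((b, d), k) \<in> Range M) \<and>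
     (\<forall>(((b1, d1), k1), ((b2, d2), k2)) \<in> M.
        ediff b1 b2 \<le> ereal \<epsilon> \<and> ediff d1 d2 \<le> ereal \<epsilon>)"

definition d_B :: "(ereal \<times> ereal \<Rightarrow> enat) \<Rightarrow> (ereal \<times> ereal \<Rightarrow> enat) \<Rightarrow> ereal" where
  "d_B D E = Inf {ereal \<epsilon> |\<epsilon>. \<epsilon> > 0 \<and> (\<exists>M. eps_matching \<epsilon> D E M)}"

end

theory Submission
  imports Defs
begin

text \<open>
  Vectors at \<open>t\<close> are filtered by the images of earlier and the kernels of later structure maps;
  lifting bases of the subquotients of these two chains, along the whole interval on which they are
  constant, decomposes a pointwise finite-dimensional module into interval modules. This applies to
  the smoothings \<open>smoothing \<delta> U\<close> and \<open>smoothing \<delta> V\<close>, which are within \<open>\<delta>\<close> of \<open>U\<close> and \<open>V\<close>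
  and whose barcodes carry all diagram points of persistence more than \<open>2\<delta>\<close>.

  An \<open>\<epsilon>\<close>-interleaving of decomposed modules is given by two matrices. If bars are ordered by the sum of
  their endpoints, a factorisation \<open>i \<rightarrow> j \<rightarrow> i'\<close> with \<open>i \<le> i'\<close> is nonzero only if \<open>j\<close> is
  \<open>\<epsilon>\<close>-close to \<open>i\<close> or \<open>i'\<close> (Bjerkevik). Restricted to bars longer than \<open>2\<epsilon>\<close>, the product of the
  matrices is therefore triangular even when only such \<open>j\<close> are kept, and a rank count gives Hall's
  condition for the relation of being \<open>\<epsilon>\<close>-close. Conversely, matched bars are interleaved one by one.
\<close>

section \<open>Linear algebra and persistence modules\<close>

text \<open>The detour through smoothings is forced: a q-tame module need not be a direct sum of
  interval modules. Smoothing \<open>U\<close> and \<open>V\<close> alike preserves an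
  \<epsilon>-interleaving, and both diagrams undo the same shift of endpoints by \<delta>; in this
  direction \<delta> only raises the persistence above which points must be matched. In the other
  direction each passage between a module and its smoothing costs \<delta>, and a third \<delta>
  pays for the fact that close bars need not agree on whether they contain their endpoints. These
  losses disappear in the infima.

  \<open>barcode\<close> is chosen for every smoothing separately, so diagrams at different \<delta>
  can be compared only through uniqueness of barcodes, up to the type of the endpoints. Stability is
  proved first, for arbitrary decompositions, and yields this uniqueness.

  There may be infinitely many bars. The linear algebra stays finite because only finitely many are
  alive at any one parameter, so that a bar longer than 2\<epsilon> has finitely many close bars;
  Hall's theorem is then needed for infinite families of finite sets.\<close>

lemma linear_between_zero:
  assumes "linear_between sc S sc' T f" "0 \<in> S"
  shows "f 0 = 0"
proof -
  have "f (0 + 0) = f 0 + f 0"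
    using assms unfolding linear_between_def by blast
  then show ?thesis by simp
qed

lemma linear_between_sum:
  assumes f: "linear_between sc S sc' T f" and sc: "vector_space sc" and S: "module.subspace sc S"
    and g: "\<And>i. i \<in> A \<Longrightarrow> g i \<in> S"
  shows "f (\<Sum>i\<in>A. sc (a i) (g i)) = (\<Sum>i\<in>A. sc' (a i) (f (g i)))"
proof -
  interpret vector_space sc by fact
  have z: "f 0 = 0"
    using linear_between_zero[OF f] subspace_0[OF S] by simp
  show ?thesis
    using g
  proof (induction A rule: infinite_finite_induct)
    case (insert i A)
    have "f (sc (a i) (g i) + (\<Sum>i\<in>A. sc (a i) (g i)))
        = f (sc (a i) (g i)) + f (\<Sum>i\<in>A. sc (a i) (g i))"
      using f insert S unfolding linear_between_def
      by (metis (no_types, lifting) insertCI subspace_scale subspace_sum)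
    moreover have "f (sc (a i) (g i)) = sc' (a i) (f (g i))"
      using f insert unfolding linear_between_def by blast
    ultimately show ?case using insert by simp
  qed (auto simp: z)
qed

lemma linear_between_comp:
  "linear_between sc S sc' S' f \<Longrightarrow> linear_between sc' S' sc'' S'' g \<Longrightarrow>
    linear_between sc S sc'' S'' (\<lambda>x. g (f x))"
  unfolding linear_between_def image_subset_iff by auto

section \<open>Dimension, relative bases and independent families\<close>

lemma (in vector_space) dim_psubset:
  assumes S: "subspace S" and "S \<subset> T" "T \<subseteq> span B" "finite B"
  shows "dim S < dim T"
proof -
  obtain A where A: "A \<subseteq> S" "independent A" "S \<subseteq> span A" "card A = dim S"
    by (rule basis_exists)
  obtain C where C: "C \<subseteq> T" "independent C" "T \<subseteq> span C" "card C = dim T"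
    by (rule basis_exists)
  obtain x where x: "x \<in> T" "x \<notin> S" using assms by blast
  have x': "x \<notin> span A" using span_minimal[OF A(1) S] x by blast
  have "finite C"
    using independent_span_bound[OF assms(4) C(2)] C(1) assms(3) by blast
  moreover have "independent (insert x A)"
    using independent_insertI[OF x' A(2)] .
  moreover have "insert x A \<subseteq> span C" using A C x assms by blast
  ultimately have le: "finite (insert x A) \<and> card (insert x A) \<le> card C"
    by (intro independent_span_bound)
  have "x \<notin> A" using x' span_base by blast
  then have "card (insert x A) = Suc (card A)" using le by simp
  then show ?thesis using le A(4) C(4) by linarith
qed

lemma (in vector_space) dim_mono_finite:
  assumes "S \<subseteq> T" "T \<subseteq> span B" "finite B"
  shows "dim S \<le> dim T"
proof -
  obtain A where A: "A \<subseteq> S" "independent A" "S \<subseteq> span A" "card A = dim S"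
    by (rule basis_exists)
  obtain C where C: "C \<subseteq> T" "independent C" "T \<subseteq> span C" "card C = dim T"
    by (rule basis_exists)
  have "finite C"
    using independent_span_bound[OF assms(3) C(2)] C(1) assms(2) by blast
  then show ?thesis
    using independent_span_bound[of C A] A C assms by auto
qed

text \<open>Finite dimension supplies the descending chain condition: a member of least dimension
  cannot properly contain another one. It makes the images arriving at a parameter stabilise as
  their source moves down a bar.\<close>

lemma (in vector_space) chain_least_subspace:
  assumes ne: "\<F> \<noteq> {}" and sub: "\<And>S. S \<in> \<F> \<Longrightarrow> subspace S \<and> S \<subseteq> span B" and B: "finite B"
    and chain: "\<And>S T. S \<in> \<F> \<Longrightarrow> T \<in> \<F> \<Longrightarrow> S \<subseteq> T \<or> T \<subseteq> S"
  shows "\<exists>S\<in>\<F>. \<forall>T\<in>\<F>. S \<subseteq> T"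
proof -
  obtain S where S: "S \<in> \<F>" "\<And>T. T \<in> \<F> \<Longrightarrow> dim S \<le> dim T"
    using ne ex_has_least_nat[of "\<lambda>S. S \<in> \<F>" _ dim] by blast
  have "S \<subseteq> T" if T: "T \<in> \<F>" for T
  proof (rule ccontr)
    assume "\<not> S \<subseteq> T"
    then have "T \<subset> S" using chain[OF S(1) T] by blast
    then have "dim T < dim S" using dim_psubset sub[OF T] sub[OF S(1)] B by blast
    then show False using S(2)[OF T] by simp
  qed
  then show ?thesis using S by blast
qed

text \<open>A basis of \<open>S\<close> is extended to one of \<open>T\<close> and the new vectors
  are kept. Quotient spaces are avoided because the representatives themselves will be moved along
  structure maps.\<close>

lemma (in vector_space) relative_basis_exists:
  assumes S: "subspace S" and "S \<subseteq> T" and T: "subspace T" "T \<subseteq> span D" "finite D"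
  shows "\<exists>B. finite B \<and> B \<subseteq> T \<and>
    (\<forall>x\<in>T. \<exists>a. x - (\<Sum>b\<in>B. scale (a b) b) \<in> S) \<and>
    (\<forall>a. (\<Sum>b\<in>B. scale (a b) b) \<in> S \<longrightarrow> (\<forall>b\<in>B. a b = 0))"
proof -
  obtain A where A: "A \<subseteq> S" "independent A" "S \<subseteq> span A"
    by (rule basis_exists)
  obtain C where C: "A \<subseteq> C" "C \<subseteq> T" "independent C" "T \<subseteq> span C"
    using A(1) assms(2) by (blast intro: maximal_independent_subset_extend[OF _ A(2), of T])
  have finC: "finite C"
    using independent_span_bound[OF T(3) C(3)] C(2) T(2) by blast
  then have fin: "finite A" "finite (C - A)" using C finite_subset by auto
  have split: "(\<Sum>b\<in>C. scale (a b) b) = (\<Sum>b\<in>A. scale (a b) b) + (\<Sum>b\<in>C-A. scale (a b) b)" for a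
    using sum.subset_diff[OF C(1) finC, of "\<lambda>b. scale (a b) b"] by (simp add: add.commute)
  show ?thesis
  proof (intro exI[of _ "C - A"] conjI ballI allI impI)
    fix x assume "x \<in> T"
    then obtain a where a: "x = (\<Sum>b\<in>C. scale (a b) b)"
      using C(4) span_finite[OF finC] by blast
    have "(\<Sum>b\<in>A. scale (a b) b) \<in> S"
      using A(1) S by (intro subspace_sum subspace_scale) auto
    then show "\<exists>a. x - (\<Sum>b\<in>C-A. scale (a b) b) \<in> S"
      using a split[of a] by (intro exI[of _ a]) simp
  next
    fix a assume "(\<Sum>b\<in>C-A. scale (a b) b) \<in> S"
    then obtain c where c: "(\<Sum>b\<in>C-A. scale (a b) b) = (\<Sum>b\<in>A. scale (c b) b)"
      using A(3) span_finite[OF fin(1)] by blast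
    \<comment> \<open>The coefficients of the difference of the two expressions, read as one
      relation in the basis \<open>C\<close>.\<close>
    define h where "h b = (if b \<in> A then - c b else a b)" for b
    have "(\<Sum>b\<in>A. scale (h b) b) = - (\<Sum>b\<in>A. scale (c b) b)"
      by (simp add: h_def sum_negf cong: sum.cong)
    moreover have "(\<Sum>b\<in>C-A. scale (h b) b) = (\<Sum>b\<in>C-A. scale (a b) b)"
      by (intro sum.cong) (auto simp: h_def)
    ultimately have "(\<Sum>b\<in>C. scale (h b) b) = 0"
      using split[of h] c by simp
    then have "\<forall>b\<in>C. h b = 0"
      using C(3) finC unfolding independent_explicit_finite_subsets by blast
    moreover fix b assume "b \<in> C - A"
    ultimately show "a b = 0" by (auto simp: h_def)
  qed (use fin C in auto)
qed

text \<open>\<open>independent\<close> is a property of sets; a family without nontrivial relations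
  has no repetitions, so passing to its image loses nothing.\<close>

lemma (in vector_space) family_independent:
  assumes "finite A" and z: "\<And>a. (\<Sum>i\<in>A. scale (a i) (f i)) = 0 \<Longrightarrow> \<forall>i\<in>A. a i = 0"
  shows "inj_on f A" and "independent (f ` A)"
proof -
  show inj: "inj_on f A"
  proof (rule inj_onI, rule ccontr)
    fix i j assume ij: "i \<in> A" "j \<in> A" "f i = f j" "i \<noteq> j"
    define a :: "'c \<Rightarrow> 'a" where "a k = (if k = i then 1 else if k = j then -1 else 0)" for k
    have "(\<Sum>k\<in>A. scale (a k) (f k)) = (\<Sum>k\<in>{i,j}. scale (a k) (f k))"
      using ij assms(1) by (intro sum.mono_neutral_right) (auto simp: a_def)
    also have "\<dots> = 0" using ij by (simp add: a_def)
    finally have "a i = 0" using z ij by blast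
    then show False by (simp add: a_def)
  qed
  show "independent (f ` A)"
  proof (rule independent_if_scalars_zero)
    fix g x assume g: "(\<Sum>x\<in>f ` A. scale (g x) x) = 0" and x: "x \<in> f ` A"
    then have "(\<Sum>i\<in>A. scale (g (f i)) (f i)) = 0"
      by (simp add: sum.reindex[OF inj])
    then show "g x = 0" using z[of "\<lambda>i. g (f i)"] x by blast
  qed (use assms in simp)
qed

lemma (in vector_space) span_image_sum:
  assumes "finite A" "x \<in> span (f ` A)"
  shows "\<exists>a. x = (\<Sum>i\<in>A. scale (a i) (f i))"
  using assms(2)
proof (induction rule: span_induct_alt)
  case base
  then show ?case by (intro exI[of _ "\<lambda>_. 0"]) simp
next
  case (step c x y)
  then obtain i a where i: "i \<in> A" "x = f i" and a: "y = (\<Sum>i\<in>A. scale (a i) (f i))" by blast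
  have "(\<Sum>k\<in>A. scale ((a(i := a i + c)) k) (f k)) = scale c (f i) + (\<Sum>k\<in>A. scale (a k) (f k))"
    using i(1) assms(1) by (simp add: sum.remove scale_left_distrib)
  then show ?case using i a by metis
qed

section \<open>Structure maps and their images\<close>

locale pmod =
  fixes V :: "('f::field, 'v::ab_group_add) pmodule"
  assumes pm: "persistence_module V"

sublocale pmod \<subseteq> vector_space "vscale V"
  using pm by (simp add: persistence_module_def)

context pmod
begin

lemma subspace_vspace: "subspace (vspace V t)"
  using pm by (simp add: persistence_module_def)

lemma vmap_linear: "s \<le> t \<Longrightarrow> linear_between (vscale V) (vspace V s) (vscale V) (vspace V t) (vmap V s t)"
  using pm by (simp add: persistence_module_def)

lemma vmap_in: "s \<le> t \<Longrightarrow> x \<in> vspace V s \<Longrightarrow> vmap V s t x \<in> vspace V t"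
  using vmap_linear unfolding linear_between_def by blast

lemma vmap_add: "s \<le> t \<Longrightarrow> x \<in> vspace V s \<Longrightarrow> y \<in> vspace V s \<Longrightarrow>
    vmap V s t (x + y) = vmap V s t x + vmap V s t y"
  using vmap_linear unfolding linear_between_def by blast

lemma vmap_scale: "s \<le> t \<Longrightarrow> x \<in> vspace V s \<Longrightarrow> vmap V s t (vscale V c x) = vscale V c (vmap V s t x)"
  using vmap_linear unfolding linear_between_def by blast

lemma vmap_0: "s \<le> t \<Longrightarrow> vmap V s t 0 = 0"
  using linear_between_zero[OF vmap_linear subspace_0[OF subspace_vspace]] .

lemma vmap_sum: "s \<le> t \<Longrightarrow> (\<And>i. i \<in> A \<Longrightarrow> g i \<in> vspace V s) \<Longrightarrow>
    vmap V s t (\<Sum>i\<in>A. vscale V (a i) (g i)) = (\<Sum>i\<in>A. vscale V (a i) (vmap V s t (g i)))"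
  using linear_between_sum[OF vmap_linear vector_space_axioms subspace_vspace] .

lemma vmap_diff: "s \<le> t \<Longrightarrow> x \<in> vspace V s \<Longrightarrow> y \<in> vspace V s \<Longrightarrow>
    vmap V s t (x - y) = vmap V s t x - vmap V s t y"
  using vmap_add[of s t "x - y" y] subspace_diff[OF subspace_vspace] by simp

lemma vmap_id: "x \<in> vspace V t \<Longrightarrow> vmap V t t x = x"
  using pm by (simp add: persistence_module_def)

lemma vmap_comp: "r \<le> s \<Longrightarrow> s \<le> t \<Longrightarrow> x \<in> vspace V r \<Longrightarrow> vmap V s t (vmap V r s x) = vmap V r t x"
  using pm unfolding persistence_module_def by blast

lemmas vspace_closed =
  subspace_0[OF subspace_vspace] subspace_add[OF subspace_vspace] subspace_diff[OF subspace_vspace]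
  subspace_scale[OF subspace_vspace]

lemma vspace_sum: "(\<And>i. i \<in> A \<Longrightarrow> g i \<in> vspace V t) \<Longrightarrow> (\<Sum>i\<in>A. vscale V (a i) (g i)) \<in> vspace V t"
  by (rule subspace_sum[OF subspace_vspace]) (simp add: vspace_closed)

definition im :: "real \<Rightarrow> real \<Rightarrow> 'v set" where
  "im s t = vmap V s t ` vspace V s"

lemma im_iff: "x \<in> im s t \<longleftrightarrow> (\<exists>y\<in>vspace V s. x = vmap V s t y)"
  by (auto simp: im_def)

lemma im_subset: "s \<le> t \<Longrightarrow> im s t \<subseteq> vspace V t"
  by (auto simp: im_def vmap_in)

lemma subspace_im:
  assumes "s \<le> t" shows "subspace (im s t)"
proof (rule subspaceI)
  show "0 \<in> im s t" using vmap_0[OF assms] vspace_closed(1) im_iff by metis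
next
  fix x y assume "x \<in> im s t" "y \<in> im s t"
  then obtain x' y' where "x' \<in> vspace V s" "y' \<in> vspace V s" "x = vmap V s t x'" "y = vmap V s t y'"
    unfolding im_iff by blast
  then show "x + y \<in> im s t"
    using vmap_add[OF assms] vspace_closed(2) unfolding im_iff by metis
next
  fix c x assume "x \<in> im s t"
  then show "vscale V c x \<in> im s t"
    using vmap_scale[OF assms] vspace_closed(4) unfolding im_iff by metis
qed

lemma im_mono:
  assumes "r \<le> s" "s \<le> t" shows "im r t \<subseteq> im s t"
proof
  fix x assume "x \<in> im r t"
  then obtain y where "y \<in> vspace V r" "x = vmap V r t y" unfolding im_iff by blast
  then show "x \<in> im s t"
    using vmap_comp[OF assms] vmap_in[OF assms(1)] unfolding im_iff by metis
qed

lemma im_map: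
  assumes "r \<le> s" "s \<le> t" "x \<in> im r s" shows "vmap V s t x \<in> im r t"
proof -
  obtain y where "y \<in> vspace V r" "x = vmap V r s y" using assms(3) unfolding im_iff by blast
  then show ?thesis using vmap_comp[OF assms(1,2)] unfolding im_iff by metis
qed

end

section \<open>Interval decomposition\<close>

context pmod
begin

text \<open>Crawley-Boevey's filtrations: if \<open>L\<close> is bounded below by the cut \<open>l\<close> and above by the cut \<open>u\<close>,
  and \<open>t \<in> L\<close>, then the following six subspaces of \<open>vspace V t\<close> are, in his notation,
  \<open>Im\<^sup>+\<close> and \<open>Im\<^sup>-\<close> at \<open>l\<close>, \<open>Ker\<^sup>+\<close> and \<open>Ker\<^sup>-\<close> at \<open>u\<close>, and \<open>V\<^sup>+\<close> and \<open>V\<^sup>-\<close> of \<open>L\<close>.\<close>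

definition im_sup :: "real set \<Rightarrow> real \<Rightarrow> 'v set" where
  "im_sup L t = {x \<in> vspace V t. \<forall>s\<in>L. s \<le> t \<longrightarrow> x \<in> im s t}"

definition im_sub :: "real set \<Rightarrow> real \<Rightarrow> 'v set" where
  "im_sub L t = {x \<in> vspace V t. x = 0 \<or> (\<exists>s\<le>t. s \<notin> L \<and> x \<in> im s t)}"

definition ker_sup :: "real set \<Rightarrow> real \<Rightarrow> 'v set" where
  "ker_sup L t = {x \<in> vspace V t. \<forall>r\<ge>t. r \<notin> L \<longrightarrow> vmap V t r x = 0}"

definition ker_sub :: "real set \<Rightarrow> real \<Rightarrow> 'v set" where
  "ker_sub L t = {x \<in> vspace V t. \<exists>r\<ge>t. r \<in> L \<and> vmap V t r x = 0}"

definition upper :: "real set \<Rightarrow> real \<Rightarrow> 'v set" where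
  "upper L t = im_sup L t \<inter> ker_sup L t"

definition lower :: "real set \<Rightarrow> real \<Rightarrow> 'v set" where
  "lower L t = {u + w |u w. u \<in> im_sub L t \<inter> ker_sup L t \<and> w \<in> im_sup L t \<inter> ker_sub L t}"

lemma subspace_im_sup: "subspace (im_sup L t)"
proof (rule subspaceI)
  show "0 \<in> im_sup L t"
    using subspace_0[OF subspace_im] vspace_closed(1) by (auto simp: im_sup_def)
next
  fix x y assume "x \<in> im_sup L t" "y \<in> im_sup L t"
  then show "x + y \<in> im_sup L t"
    using subspace_add[OF subspace_im] vspace_closed(2) by (auto simp: im_sup_def)
next
  fix c x assume "x \<in> im_sup L t"
  then show "vscale V c x \<in> im_sup L t"
    using subspace_scale[OF subspace_im] vspace_closed(4) by (auto simp: im_sup_def)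
qed

lemma subspace_im_sub: "subspace (im_sub L t)"
proof (rule subspaceI)
  show "0 \<in> im_sub L t" using vspace_closed(1) by (simp add: im_sub_def)
next
  fix x y assume x: "x \<in> im_sub L t" and y: "y \<in> im_sub L t"
  show "x + y \<in> im_sub L t"
  proof (cases "x = 0 \<or> y = 0")
    case False
    then obtain s s' where s: "s \<le> t" "s \<notin> L" "x \<in> im s t" and s': "s' \<le> t" "s' \<notin> L" "y \<in> im s' t"
      using x y by (auto simp: im_sub_def)
    have "x \<in> im (max s s') t" "y \<in> im (max s s') t"
      using s s' im_mono[of s "max s s'" t] im_mono[of s' "max s s'" t] by auto
    then have "x + y \<in> im (max s s') t"
      using subspace_add[OF subspace_im] s s' by simp
    moreover have "max s s' \<le> t" "max s s' \<notin> L" using s s' by (auto simp: max_def)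
    ultimately show ?thesis using im_subset unfolding im_sub_def by blast
  qed (use x y in auto)
next
  fix c x assume "x \<in> im_sub L t"
  then show "vscale V c x \<in> im_sub L t"
    using subspace_scale[OF subspace_im] vspace_closed(4) unfolding im_sub_def by auto
qed

lemma subspace_ker_sup: "subspace (ker_sup L t)"
  by (rule subspaceI) (auto simp: ker_sup_def vmap_0 vmap_add vmap_scale vspace_closed)

lemma subspace_ker_sub:
  assumes "t \<in> L"
  shows "subspace (ker_sub L t)"
proof (rule subspaceI)
  show "0 \<in> ker_sub L t"
    using vspace_closed(1) vmap_id assms by (auto simp: ker_sub_def)
next
  fix x y assume xy: "x \<in> ker_sub L t" "y \<in> ker_sub L t"
  then obtain r r' where r: "r \<ge> t" "r \<in> L" "vmap V t r x = 0" "r' \<ge> t" "r' \<in> L" "vmap V t r' y = 0"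
    by (auto simp: ker_sub_def)
  have m: "vmap V t (max r r') z = 0" if "z \<in> vspace V t" "vmap V t p z = 0" "p = r \<or> p = r'" for z p
  proof -
    have "vmap V p (max r r') (vmap V t p z) = vmap V t (max r r') z"
      by (rule vmap_comp) (use that r in auto)
    then show ?thesis using that vmap_0[of p "max r r'"] by auto
  qed
  have "vmap V t (max r r') (x + y) = vmap V t (max r r') x + vmap V t (max r r') y"
    using xy r by (intro vmap_add) (auto simp: ker_sub_def)
  also have "\<dots> = 0" using m[of x r] m[of y r'] xy r by (simp add: ker_sub_def)
  finally have "vmap V t (max r r') (x + y) = 0" .
  moreover have "max r r' \<in> L" "max r r' \<ge> t" using r by (auto simp: max_def)
  ultimately show "x + y \<in> ker_sub L t"
    using xy vspace_closed(2) by (auto simp: ker_sub_def)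
next
  fix c x assume "x \<in> ker_sub L t"
  then show "vscale V c x \<in> ker_sub L t"
    using vspace_closed(4) vmap_scale by (auto simp: ker_sub_def)
qed

lemma subspace_upper: "subspace (upper L t)"
  unfolding upper_def by (intro subspace_inter subspace_im_sup subspace_ker_sup)

lemma subspace_lower: "t \<in> L \<Longrightarrow> subspace (lower L t)"
  unfolding lower_def
  using subspace_sums[of "im_sub L t \<inter> ker_sup L t" "im_sup L t \<inter> ker_sub L t"]
  by (simp add: subspace_inter subspace_im_sup subspace_ker_sup subspace_im_sub subspace_ker_sub)

lemma upper_subset: "upper L t \<subseteq> vspace V t"
  by (auto simp: upper_def im_sup_def)

context
  fixes L :: "real set" assumes L: "is_interval L"
begin

lemma between: "a \<in> L \<Longrightarrow> b \<in> L \<Longrightarrow> a \<le> c \<Longrightarrow> c \<le> b \<Longrightarrow> c \<in> L"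
  using L mem_is_interval_1_I by blast

text \<open>A parameter below \<open>t\<close> and outside the interval \<open>L\<close> lies below
  all of \<open>L\<close>, so an image from there is contained in every image from
  \<open>L\<close>.\<close>

lemma im_sub_subset_sup:
  assumes "t \<in> L"
  shows "im_sub L t \<subseteq> im_sup L t"
proof
  fix x assume x: "x \<in> im_sub L t"
  show "x \<in> im_sup L t"
  proof (cases "x = 0")
    case True
    then show ?thesis using subspace_0[OF subspace_im_sup] by simp
  next
    case False
    then obtain s where s: "s \<le> t" "s \<notin> L" "x \<in> im s t" using x by (auto simp: im_sub_def)
    have "x \<in> im s0 t" if "s0 \<in> L" "s0 \<le> t" for s0
    proof -
      have "s \<le> s0" using between[OF that(1) assms, of s] s by force
      then show ?thesis using im_mono[of s s0 t] that s by blast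
    qed
    then show ?thesis using x by (auto simp: im_sup_def im_sub_def)
  qed
qed

lemma ker_sub_subset_sup:
  assumes "t \<in> L"
  shows "ker_sub L t \<subseteq> ker_sup L t"
proof
  fix x assume x: "x \<in> ker_sub L t"
  then obtain r where r: "r \<ge> t" "r \<in> L" "vmap V t r x = 0" "x \<in> vspace V t"
    by (auto simp: ker_sub_def)
  have "vmap V t r' x = 0" if "r' \<ge> t" "r' \<notin> L" for r'
  proof -
    have "r \<le> r'" using between[OF assms r(2), of r'] that by force
    then show ?thesis using vmap_comp[of t r r' x] vmap_0[of r r'] r by simp
  qed
  then show "x \<in> ker_sup L t" using r by (auto simp: ker_sup_def)
qed

lemma lower_subset_upper: "t \<in> L \<Longrightarrow> lower L t \<subseteq> upper L t"
  using im_sub_subset_sup ker_sub_subset_sup subspace_add[OF subspace_im_sup] subspace_add[OF subspace_ker_sup]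
  unfolding lower_def upper_def by (auto simp: subset_iff)

context
  fixes s t assumes st: "s \<le> t" and sL: "s \<in> L" and tL: "t \<in> L"
begin

text \<open>A parameter above \<open>s\<close> and outside \<open>L\<close> is already above
  \<open>t\<close>, since everything between \<open>s\<close> and \<open>t\<close> belongs to
  \<open>L\<close>. Both sides therefore test the same composites.\<close>

lemma ker_sup_vmap_iff:
  assumes "x \<in> vspace V s"
  shows "vmap V s t x \<in> ker_sup L t \<longleftrightarrow> x \<in> ker_sup L s"
proof -
  have "r \<ge> t" if "r \<ge> s" "r \<notin> L" for r using between[OF sL tL, of r] that by force
  then show ?thesis
    using assms st vmap_comp[OF st, of _ x] vmap_in[OF st] by (auto simp: ker_sup_def)
qed

lemma im_sup_vmap: "x \<in> im_sup L s \<Longrightarrow> vmap V s t x \<in> im_sup L t"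
proof -
  assume x: "x \<in> im_sup L s"
  have "vmap V s t x \<in> im p t" if p: "p \<in> L" "p \<le> t" for p
  proof (cases "p \<le> s")
    case True
    then show ?thesis using x p st im_map[of p s t x] by (auto simp: im_sup_def)
  next
    case False
    then have "s \<le> p" by simp
    moreover have "vmap V s t x \<in> im s t" using x by (auto simp: im_iff im_sup_def)
    ultimately show ?thesis using im_mono[of s p t] p by blast
  qed
  then show ?thesis using x vmap_in[OF st] by (auto simp: im_sup_def)
qed

lemma upper_vmap: "x \<in> upper L s \<Longrightarrow> vmap V s t x \<in> upper L t"
  using im_sup_vmap ker_sup_vmap_iff upper_subset unfolding upper_def by (auto simp: im_sup_def)

lemma ker_sub_vmap: "x \<in> ker_sub L s \<Longrightarrow> vmap V s t x \<in> ker_sub L t"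
proof -
  assume "x \<in> ker_sub L s"
  then obtain r where r: "r \<ge> s" "r \<in> L" "vmap V s r x = 0" and x: "x \<in> vspace V s"
    by (auto simp: ker_sub_def)
  have "vmap V s (max r t) x = 0"
    using vmap_comp[of s r "max r t" x] vmap_0[of r "max r t"] r x by simp
  then have "vmap V t (max r t) (vmap V s t x) = 0"
    using vmap_comp[of s t "max r t" x] st x by simp
  moreover have "max r t \<in> L" using r tL by (auto simp: max_def)
  ultimately show ?thesis
    using vmap_in[OF st x] unfolding ker_sub_def by (auto intro!: exI[of _ "max r t"])
qed

lemma ker_sub_reflect:
  assumes "x \<in> vspace V s" "vmap V s t x \<in> ker_sub L t"
  shows "x \<in> ker_sub L s"
proof -
  obtain r where r: "r \<ge> t" "r \<in> L" "vmap V t r (vmap V s t x) = 0"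
    using assms by (auto simp: ker_sub_def)
  then have "vmap V s r x = 0" using vmap_comp[of s t r x] st assms by simp
  moreover have "s \<le> r" using st r by simp
  ultimately show ?thesis using assms r by (auto simp: ker_sub_def)
qed

lemma im_sub_vmap: "x \<in> im_sub L s \<Longrightarrow> vmap V s t x \<in> im_sub L t"
proof -
  assume x: "x \<in> im_sub L s"
  show ?thesis
  proof (cases "x = 0")
    case True
    then show ?thesis using vmap_0[OF st] subspace_0[OF subspace_im_sub] by simp
  next
    case False
    then obtain p where p: "p \<le> s" "p \<notin> L" "x \<in> im p s" using x by (auto simp: im_sub_def)
    then have "vmap V s t x \<in> im p t" "p \<le> t" using im_map[of p s t x] st by auto
    then show ?thesis using p im_subset[of p t] by (auto simp: im_sub_def)
  qed
qed

text \<open>An image from below \<open>L\<close> passes through \<open>s\<close> on its way to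
  \<open>t\<close>; its value there is the lift.\<close>

lemma im_sub_lift:
  assumes "y \<in> im_sub L t"
  shows "\<exists>x\<in>im_sub L s. vmap V s t x = y"
proof (cases "y = 0")
  case True
  then show ?thesis using vmap_0[OF st] subspace_0[OF subspace_im_sub] by blast
next
  case False
  then obtain p where p: "p \<le> t" "p \<notin> L" "y \<in> im p t" using assms by (auto simp: im_sub_def)
  then obtain z where z: "z \<in> vspace V p" "y = vmap V p t z" by (auto simp: im_iff)
  have ps: "p \<le> s" using between[OF sL tL, of p] p by force
  have "vmap V p s z \<in> im_sub L s"
    using z ps p vmap_in unfolding im_sub_def im_iff by blast
  moreover have "vmap V s t (vmap V p s z) = y" using vmap_comp[OF ps st z(1)] z by simp
  ultimately show ?thesis by blast
qed

lemma lower_vmap: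
  assumes "x \<in> lower L s"
  shows "vmap V s t x \<in> lower L t"
proof -
  obtain u w where uw: "x = u + w" "u \<in> im_sub L s" "u \<in> ker_sup L s" "w \<in> im_sup L s" "w \<in> ker_sub L s"
    using assms by (auto simp: lower_def)
  then have in_s: "u \<in> vspace V s" "w \<in> vspace V s" by (auto simp: ker_sup_def ker_sub_def)
  then have "vmap V s t x = vmap V s t u + vmap V s t w" using uw vmap_add[OF st] by simp
  moreover have "vmap V s t u \<in> im_sub L t \<inter> ker_sup L t"
    using uw in_s im_sub_vmap ker_sup_vmap_iff by blast
  moreover have "vmap V s t w \<in> im_sup L t \<inter> ker_sub L t"
    using uw im_sup_vmap ker_sub_vmap by blast
  ultimately show ?thesis unfolding lower_def by blast
qed

text \<open>The image part of \<open>vmap V s t x\<close> lifts to \<open>s\<close>, and what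
  remains of \<open>x\<close> after subtracting the lift dies inside \<open>L\<close> because its
  image at \<open>t\<close> does. Together with \<open>lower_vmap\<close>, this makes the map
  induced from \<open>upper L s\<close> modulo \<open>lower L s\<close> to the same quotient at
  \<open>t\<close> well defined and injective.\<close>

lemma lower_reflect:
  assumes x: "x \<in> upper L s" and "vmap V s t x \<in> lower L t"
  shows "x \<in> lower L s"
proof -
  obtain u w where uw: "vmap V s t x = u + w" "u \<in> im_sub L t" "u \<in> ker_sup L t"
      "w \<in> im_sup L t" "w \<in> ker_sub L t"
    using assms by (auto simp: lower_def)
  obtain u' where u': "u' \<in> im_sub L s" "vmap V s t u' = u" using im_sub_lift[OF uw(2)] by blast
  have in_s: "u' \<in> vspace V s" "x \<in> vspace V s" using u' x upper_subset by (auto simp: im_sub_def)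
  have "u' \<in> ker_sup L s" using ker_sup_vmap_iff in_s u' uw by blast
  moreover have "x - u' \<in> im_sup L s"
    using im_sub_subset_sup[OF sL] u' x subspace_diff[OF subspace_im_sup] by (auto simp: upper_def)
  moreover have "x - u' \<in> ker_sub L s"
  proof (rule ker_sub_reflect)
    show "vmap V s t (x - u') \<in> ker_sub L t"
      using vmap_diff[OF st in_s(2,1)] uw u' by simp
  qed (use in_s vspace_closed in simp)
  ultimately show ?thesis
    using u' unfolding lower_def by (intro CollectI exI[of _ u'] exI[of _ "x - u'"]) simp
qed

end

end

end

section \<open>Lifting vectors along a bar\<close>

locale pfd_pmod = pmod V for V :: "('f::field, 'v::ab_group_add) pmodule" +
  assumes pfd: "\<exists>B. finite B \<and> vspace V t \<subseteq> span B"
begin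

text \<open>The images form a chain of subspaces of a finite-dimensional space, so their
  intersection is one of them.\<close>

lemma im_sup_attained:
  assumes "t \<in> L"
  shows "\<exists>s\<in>L. s \<le> t \<and> im_sup L t = im s t"
proof -
  let ?F = "{im s t |s. s \<in> L \<and> s \<le> t}"
  obtain B where B: "finite B" "vspace V t \<subseteq> span B" using pfd by blast
  have "\<exists>S\<in>?F. \<forall>T\<in>?F. S \<subseteq> T"
  proof (rule chain_least_subspace[of ?F B])
    show "?F \<noteq> {}" using assms by blast
    show "subspace S \<and> S \<subseteq> span B" if "S \<in> ?F" for S
      using that B im_subset subspace_im by blast
    show "S \<subseteq> T \<or> T \<subseteq> S" if ST: "S \<in> ?F" "T \<in> ?F" for S T
    proof -
      obtain p q where "S = im p t" "T = im q t" "p \<le> t" "q \<le> t" using ST by blast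
      then show ?thesis using im_mono[of p q t] im_mono[of q p t] by (cases "p \<le> q") auto
    qed
  qed (rule B)
  then obtain s where s: "s \<in> L" "s \<le> t" "\<And>r. r \<in> L \<Longrightarrow> r \<le> t \<Longrightarrow> im s t \<subseteq> im r t" by blast
  then have "im_sup L t = im s t" using im_subset[OF s(2)] by (auto simp: im_sup_def)
  then show ?thesis using s by blast
qed

text \<open>The counterpart of \<open>lower_reflect\<close>: the induced maps of the quotients are
  onto. A preimage at the parameter where the images in \<open>s\<close> stabilise is pushed forward
  to \<open>s\<close>, which puts it into all these images at once.\<close>

lemma upper_lift:
  assumes L: "is_interval L" and st: "s \<le> t" "s \<in> L" "t \<in> L" and y: "y \<in> upper L t"
  shows "\<exists>x\<in>upper L s. vmap V s t x = y"
proof -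
  obtain p where p: "p \<in> L" "p \<le> s" "im_sup L s = im p s" using im_sup_attained[OF st(2)] by blast
  have "y \<in> im p t" using y p st by (auto simp: upper_def im_sup_def)
  then obtain z where z: "z \<in> vspace V p" "y = vmap V p t z" by (auto simp: im_iff)
  let ?x = "vmap V p s z"
  have xy: "vmap V s t ?x = y" using vmap_comp[OF p(2) st(1) z(1)] z by simp
  have x: "?x \<in> vspace V s" using vmap_in[OF p(2) z(1)] .
  have "?x \<in> im_sup L s" using p z by (auto simp: im_iff)
  moreover have "?x \<in> ker_sup L s"
    using ker_sup_vmap_iff[OF L st x] xy y by (simp add: upper_def)
  ultimately show ?thesis using xy by (auto simp: upper_def)
qed

end

text \<open>Compatible lifts are chosen one after the other, so the bar has to be exhausted
  downwards by a sequence. If it has no least point, its rational points achieve this.\<close>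

lemma interval_coinitial_sequence:
  assumes L: "is_interval (L :: real set)" and t0: "t0 \<in> L"
  obtains q :: "nat \<Rightarrow> real" where "q 0 = t0" "\<And>n. q n \<in> L" "\<And>m n. m \<le> n \<Longrightarrow> q n \<le> q m"
    "\<And>t. t \<in> L \<Longrightarrow> \<exists>n. q n \<le> t"
proof -
  have "\<exists>p :: nat \<Rightarrow> real. (\<forall>n. p n \<in> L) \<and> (\<forall>t\<in>L. \<exists>n. p n \<le> t)"
  proof (cases "\<exists>m\<in>L. \<forall>t\<in>L. m \<le> t")
    case True
    then obtain m where "m \<in> L" "\<forall>t\<in>L. m \<le> t" by blast
    then show ?thesis by (intro exI[of _ "\<lambda>_. m"]) auto
  next
    case False
    have r: "\<exists>x\<in>L \<inter> \<rat>. x \<le> t" if "t \<in> L" for t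
    proof -
      obtain t' where t': "t' \<in> L" "t' < t" using False \<open>t \<in> L\<close> by force
      obtain x where "x \<in> \<rat>" "t' < x" "x < t" using Rats_dense_in_real[OF t'(2)] by blast
      then have "x \<in> L" "x \<le> t" using t' that mem_is_interval_1_I[OF L t'(1) that, of x] by auto
      then show ?thesis using \<open>x \<in> \<rat>\<close> by blast
    qed
    have ne: "L \<inter> \<rat> \<noteq> {}" and co: "countable (L \<inter> \<rat>)" using r[OF t0] countable_rat by auto
    show ?thesis
    proof (intro exI[of _ "from_nat_into (L \<inter> \<rat>)"] conjI allI ballI)
      show "from_nat_into (L \<inter> \<rat>) n \<in> L" for n using from_nat_into[OF ne, of n] by blast
      fix t assume "t \<in> L"
      then obtain x where x: "x \<in> L \<inter> \<rat>" "x \<le> t" using r by blast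
      obtain n where "from_nat_into (L \<inter> \<rat>) n = x" using from_nat_into_surj[OF co x(1)] by blast
      then show "\<exists>n. from_nat_into (L \<inter> \<rat>) n \<le> t" using x by blast
    qed
  qed
  then obtain p :: "nat \<Rightarrow> real" where p: "\<And>n. p n \<in> L" "\<And>t. t \<in> L \<Longrightarrow> \<exists>n. p n \<le> t" by blast
  \<comment> \<open>Running minima started at \<open>t0\<close> make the sequence
    decreasing.\<close>
  define q where "q n = rec_nat t0 (\<lambda>n x. min x (p n)) n" for n
  have q: "q 0 = t0" "\<And>n. q (Suc n) = min (q n) (p n)" by (simp_all add: q_def)
  have "q n \<in> L" for n by (induction n) (auto simp: q t0 p min_def)
  moreover have "antimono q" by (rule decseq_SucI) (simp add: q)
  moreover have "\<exists>n. q n \<le> t" if "t \<in> L" for t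
    using p(2)[OF that] q(2) min.coboundedI2[of _ t] by (metis (no_types))
  ultimately show ?thesis using that[of q] q(1) unfolding antimono_def by blast
qed

context pfd_pmod
begin

text \<open>Preimages need not be unique, so separate lifts to each parameter below
  \<open>t0\<close> would not fit together; they are chosen successively along a coinitial sequence.
  Everything else is obtained by pushing forward.\<close>

lemma compatible_lift:
  assumes L: "is_interval L" and t0: "t0 \<in> L" and b: "b \<in> upper L t0"
  shows "\<exists>g. g t0 = b \<and> (\<forall>t\<in>L. g t \<in> upper L t) \<and> (\<forall>s\<in>L. \<forall>t\<in>L. s \<le> t \<longrightarrow> vmap V s t (g s) = g t)"
proof -
  obtain q :: "nat \<Rightarrow> real" where q: "q 0 = t0" "\<And>n. q n \<in> L" "\<And>m n. m \<le> n \<Longrightarrow> q n \<le> q m"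
    "\<And>t. t \<in> L \<Longrightarrow> \<exists>n. q n \<le> t" using interval_coinitial_sequence[OF L t0] by blast
  have "\<exists>x. \<forall>n. (x n \<in> upper L (q n) \<and> (n = 0 \<longrightarrow> x n = b)) \<and> vmap V (q (Suc n)) (q n) (x (Suc n)) = x n"
  proof (rule dependent_nat_choice)
    show "\<exists>x. x \<in> upper L (q 0) \<and> (0 = (0::nat) \<longrightarrow> x = b)" using b q(1) by auto
    show "\<exists>y. (y \<in> upper L (q (Suc n)) \<and> (Suc n = 0 \<longrightarrow> y = b)) \<and> vmap V (q (Suc n)) (q n) y = x"
      if "x \<in> upper L (q n) \<and> (n = 0 \<longrightarrow> x = b)" for x n
      using upper_lift[OF L _ q(2) q(2), of "Suc n" n x] q(3)[of n "Suc n"] that by auto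
  qed
  then obtain x where x: "\<And>n. x n \<in> upper L (q n)" "x 0 = b"
    "\<And>n. vmap V (q (Suc n)) (q n) (x (Suc n)) = x n" by blast
  have xV: "x n \<in> vspace V (q n)" for n using x(1) upper_subset by blast
  have xx: "vmap V (q n) (q m) (x n) = x m" if "m \<le> n" for m n
    using that
  proof (induction n rule: dec_induct)
    case base
    then show ?case using vmap_id xV by simp
  next
    case (step n)
    have "vmap V (q n) (q m) (vmap V (q (Suc n)) (q n) (x (Suc n))) = vmap V (q (Suc n)) (q m) (x (Suc n))"
      using step q(3) xV by (intro vmap_comp) auto
    then show ?case using x(3) step by simp
  qed
  \<comment> \<open>Any \<open>n\<close> with \<open>q n \<le> t\<close> gives the same vector, by
    \<open>g_le\<close>.\<close>
  define g where "g t = vmap V (q (SOME n. q n \<le> t)) t (x (SOME n. q n \<le> t))" for t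
  have g_le: "vmap V (q m) t (x m) = vmap V (q n) t (x n)" if "q m \<le> t" "m \<le> n" for m n t
    using vmap_comp[of "q n" "q m" t "x n"] q(3)[of m n] that xV xx[of m n] by simp
  have g: "g t = vmap V (q n) t (x n)" if t: "q n \<le> t" for n t
  proof -
    define m where "m = (SOME n. q n \<le> t)"
    have "q m \<le> t" unfolding m_def using t by (rule someI)
    then have "vmap V (q m) t (x m) = vmap V (q n) t (x n)"
      using g_le[of m t n] g_le[of n t m, symmetric] t by (meson nle_le)
    then show ?thesis unfolding g_def m_def .
  qed
  have "g t0 = b" using g[of 0 t0] q(1) x(2) vmap_id xV[of 0] by simp
  moreover have "g t \<in> upper L t" if t: "t \<in> L" for t
  proof -
    obtain n where n: "q n \<le> t" using q(4)[OF t] by blast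
    show ?thesis using upper_vmap[OF L n q(2) t x(1)] g[OF n] by simp
  qed
  moreover have "vmap V s t (g s) = g t" if st: "s \<in> L" "s \<le> t" for s t
  proof -
    obtain n where n: "q n \<le> s" using q(4)[OF st(1)] by blast
    show ?thesis using g[OF n] g[of n t] n st vmap_comp[OF n st(2) xV] by simp
  qed
  ultimately show ?thesis by blast
qed

text \<open>A relative basis is chosen at a single parameter. Since the quotients of
  \<open>upper\<close> by \<open>lower\<close> are mapped bijectively along \<open>L\<close>, its
  compatible lifts are relative bases everywhere.\<close>

lemma relative_interval_basis:
  assumes L: "is_interval L" "L \<noteq> {}"
  shows "\<exists>(B :: 'v set) g. finite B \<and> (\<forall>b\<in>B. \<forall>t\<in>L. g b t \<in> upper L t) \<and>
     (\<forall>b\<in>B. \<forall>s\<in>L. \<forall>t\<in>L. s \<le> t \<longrightarrow> vmap V s t (g b s) = g b t) \<and>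
     (\<forall>t\<in>L. \<forall>x\<in>upper L t. \<exists>a. x - (\<Sum>b\<in>B. vscale V (a b) (g b t)) \<in> lower L t) \<and>
     (\<forall>t\<in>L. \<forall>a. (\<Sum>b\<in>B. vscale V (a b) (g b t)) \<in> lower L t \<longrightarrow> (\<forall>b\<in>B. a b = 0))"
proof -
  obtain t0 where t0: "t0 \<in> L" using L by blast
  obtain D where D: "finite D" "vspace V t0 \<subseteq> span D" using pfd by blast
  obtain B where B: "finite B" "B \<subseteq> upper L t0"
    "\<forall>x\<in>upper L t0. \<exists>a. x - (\<Sum>b\<in>B. vscale V (a b) b) \<in> lower L t0"
    "\<forall>a. (\<Sum>b\<in>B. vscale V (a b) b) \<in> lower L t0 \<longrightarrow> (\<forall>b\<in>B. a b = 0)"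
    using relative_basis_exists[OF subspace_lower[OF t0] lower_subset_upper[OF L(1) t0] subspace_upper
        subset_trans[OF upper_subset D(2)] D(1)] by (elim exE conjE) (rule that)
  have "\<forall>b\<in>B. \<exists>g. g t0 = b \<and> (\<forall>t\<in>L. g t \<in> upper L t) \<and> (\<forall>s\<in>L. \<forall>t\<in>L. s \<le> t \<longrightarrow> vmap V s t (g s) = g t)"
    using compatible_lift[OF L(1) t0] B(2) by blast
  from bchoice[OF this] obtain g where g: "\<And>b. b \<in> B \<Longrightarrow> g b t0 = b"
    "\<And>b t. b \<in> B \<Longrightarrow> t \<in> L \<Longrightarrow> g b t \<in> upper L t"
    "\<And>b s t. b \<in> B \<Longrightarrow> s \<in> L \<Longrightarrow> t \<in> L \<Longrightarrow> s \<le> t \<Longrightarrow> vmap V s t (g b s) = g b t" by blast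
  have gV: "g b t \<in> vspace V t" if "b \<in> B" "t \<in> L" for b t using g(2)[OF that] upper_subset by blast
  have sumt0: "(\<Sum>b\<in>B. vscale V (a b) (g b t0)) = (\<Sum>b\<in>B. vscale V (a b) b)" for a
    using g(1) by (intro sum.cong) auto
  have sum_upper: "(\<Sum>b\<in>B. vscale V (a b) (g b t)) \<in> upper L t" if "t \<in> L" for a t
    using g(2)[OF _ that] by (intro subspace_sum[OF subspace_upper] subspace_scale[OF subspace_upper]) auto
  have sum_map: "vmap V s t (\<Sum>b\<in>B. vscale V (a b) (g b s)) = (\<Sum>b\<in>B. vscale V (a b) (g b t))"
    if "s \<in> L" "t \<in> L" "s \<le> t" for s t a
    using that by (subst vmap_sum) (auto simp: gV g(3) intro!: sum.cong)
  \<comment> \<open>Below \<open>t0\<close> the coefficients are found at \<open>t0\<close> and the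
    remainder is reflected back; above \<open>t0\<close> a lift to \<open>t0\<close> is expanded and
    the result pushed forward.\<close>
  have span_t: "\<exists>a. x - (\<Sum>b\<in>B. vscale V (a b) (g b t)) \<in> lower L t" if t: "t \<in> L" and x: "x \<in> upper L t" for t x
  proof (cases "t \<le> t0")
    case True
    obtain a where a: "vmap V t t0 x - (\<Sum>b\<in>B. vscale V (a b) b) \<in> lower L t0"
      using B(3) upper_vmap[OF L(1) True t t0 x] by blast
    have "vmap V t t0 (x - (\<Sum>b\<in>B. vscale V (a b) (g b t))) = vmap V t t0 x - (\<Sum>b\<in>B. vscale V (a b) b)"
      using x upper_subset sum_upper[OF t] sum_map[OF t t0 True] sumt0
      by (subst vmap_diff[OF True]) auto
    then have "x - (\<Sum>b\<in>B. vscale V (a b) (g b t)) \<in> lower L t"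
      using a lower_reflect[OF L(1) True t t0] subspace_diff[OF subspace_upper x sum_upper[OF t]] by metis
    then show ?thesis by blast
  next
    case False
    then have le: "t0 \<le> t" by simp
    obtain y where y: "y \<in> upper L t0" "vmap V t0 t y = x" using upper_lift[OF L(1) le t0 t x] by blast
    obtain a where a: "y - (\<Sum>b\<in>B. vscale V (a b) (g b t0)) \<in> lower L t0" using B(3) y(1) sumt0 by metis
    have "vmap V t0 t (y - (\<Sum>b\<in>B. vscale V (a b) (g b t0))) = x - (\<Sum>b\<in>B. vscale V (a b) (g b t))"
      using y upper_subset sum_upper[OF t0] sum_map[OF t0 t le]
      by (subst vmap_diff[OF le]) auto
    then show ?thesis using lower_vmap[OF L(1) le t0 t a] by metis
  qed
  have indep_t: "\<forall>b\<in>B. a b = 0" if t: "t \<in> L" and a: "(\<Sum>b\<in>B. vscale V (a b) (g b t)) \<in> lower L t" for t a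
  proof (cases "t \<le> t0")
    case True
    then show ?thesis using B(4) lower_vmap[OF L(1) True t t0 a] sum_map[OF t t0 True] sumt0 by metis
  next
    case False
    then have le: "t0 \<le> t" by simp
    show ?thesis
      using B(4) lower_reflect[OF L(1) le t0 t sum_upper[OF t0]] sum_map[OF t0 t le] a sumt0 by metis
  qed
  show ?thesis
  proof (intro exI[of _ B] exI[of _ g] conjI)
    show "\<forall>t\<in>L. \<forall>x\<in>upper L t. \<exists>a. x - (\<Sum>b\<in>B. vscale V (a b) (g b t)) \<in> lower L t"
      using span_t by (intro ballI)
    show "\<forall>t\<in>L. \<forall>a. (\<Sum>b\<in>B. vscale V (a b) (g b t)) \<in> lower L t \<longrightarrow> (\<forall>b\<in>B. a b = 0)"
      using indep_t by (intro ballI allI impI) blast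
  qed (use B(1) g(2,3) in auto)
qed

end

text \<open>An interval decomposition in coordinates: the vectors \<open>e i t\<close> with \<open>t \<in> K i\<close> form a basis
  of \<open>vspace V t\<close>, and the \<open>i\<close>-th one is a generator of a copy of the interval module of \<open>K i\<close>.\<close>

locale ibasis = pmod V for V :: "('f::field, 'v::ab_group_add) pmodule" +
  fixes I :: "'i set" and K :: "'i \<Rightarrow> real set" and e :: "'i \<Rightarrow> real \<Rightarrow> 'v"
  assumes interval: "i \<in> I \<Longrightarrow> is_interval (K i)"
    and nonempty: "i \<in> I \<Longrightarrow> K i \<noteq> {}"
    and finite_active: "finite {i \<in> I. t \<in> K i}"
    and e_in: "i \<in> I \<Longrightarrow> e i t \<in> vspace V t"
    and e_out: "i \<in> I \<Longrightarrow> t \<notin> K i \<Longrightarrow> e i t = 0"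
    and e_map: "i \<in> I \<Longrightarrow> s \<in> K i \<Longrightarrow> s \<le> t \<Longrightarrow> vmap V s t (e i s) = e i t"
    and spanning: "x \<in> vspace V t \<Longrightarrow> \<exists>a. x = (\<Sum>i | i \<in> I \<and> t \<in> K i. vscale V (a i) (e i t))"
    and indep: "(\<Sum>i | i \<in> I \<and> t \<in> K i. vscale V (a i) (e i t)) = 0 \<Longrightarrow> i \<in> I \<Longrightarrow> t \<in> K i \<Longrightarrow> a i = 0"

section \<open>Spanning and independence of the lifted bases\<close>

context pfd_pmod
begin

definition birth :: "real \<Rightarrow> 'v \<Rightarrow> real set" where
  "birth t x = {s. s \<le> t \<and> x \<in> im s t}"

definition death :: "real \<Rightarrow> 'v \<Rightarrow> real set" where
  "death t x = {r. t \<le> r \<and> vmap V t r x \<noteq> 0}"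

text \<open>The interval at which both filtrations jump for a nonzero \<open>x\<close>: it belongs
  to \<open>im_sup\<close> and \<open>ker_sup\<close> of this interval, but to neither
  \<open>im_sub\<close> nor \<open>ker_sub\<close>.\<close>

definition lifespan :: "real \<Rightarrow> 'v \<Rightarrow> real set" where
  "lifespan t x = birth t x \<union> death t x"

context
  fixes t x assumes x: "x \<in> vspace V t" and x0: "x \<noteq> 0"
begin

lemma t_in_birth: "t \<in> birth t x" and t_in_death: "t \<in> death t x"
  using x x0 vmap_id[OF x] by (auto simp: birth_def death_def im_iff intro: bexI[of _ x])

lemma lifespan_le: "s \<le> t \<Longrightarrow> s \<in> lifespan t x \<longleftrightarrow> x \<in> im s t"
  using t_in_birth by (cases "s = t") (auto simp: lifespan_def birth_def death_def)

lemma lifespan_ge: "t \<le> r \<Longrightarrow> r \<in> lifespan t x \<longleftrightarrow> vmap V t r x \<noteq> 0"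
  using t_in_death by (cases "r = t") (auto simp: lifespan_def birth_def death_def)

lemma t_in_lifespan: "t \<in> lifespan t x"
  using t_in_birth by (simp add: lifespan_def)

lemma interval_lifespan: "is_interval (lifespan t x)"
  unfolding is_interval_1
proof (intro ballI allI impI)
  fix a b c assume a: "a \<in> lifespan t x" and b: "b \<in> lifespan t x" and "a \<le> c \<and> c \<le> b"
  then have c: "a \<le> c" "c \<le> b" by auto
  show "c \<in> lifespan t x"
  proof (cases "c \<le> t")
    case True
    then have "x \<in> im a t" using lifespan_le[of a] a c by simp
    then show ?thesis using im_mono[OF c(1) True] lifespan_le[OF True] by blast
  next
    case False
    then have "vmap V t b x \<noteq> 0" using lifespan_ge[of b] b c by simp
    then have "vmap V t c x \<noteq> 0" using vmap_comp[of t c b x] vmap_0[of c b] c False x by auto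
    then show ?thesis using lifespan_ge[of c] False by simp
  qed
qed

lemma in_upper_lifespan: "x \<in> upper (lifespan t x) t"
  using lifespan_le lifespan_ge x by (auto simp: upper_def im_sup_def ker_sup_def)

lemma in_im_sup_lifespan: "x \<in> im_sup L t \<Longrightarrow> s \<in> L \<Longrightarrow> s \<le> t \<Longrightarrow> s \<in> lifespan t x"
  using lifespan_le by (auto simp: im_sup_def)

lemma in_ker_sup_lifespan: "x \<in> ker_sup L t \<Longrightarrow> r \<in> lifespan t x \<Longrightarrow> t \<le> r \<Longrightarrow> r \<in> L"
  using lifespan_ge by (auto simp: ker_sup_def)

end

text \<open>The induction measure for the spanning property: splitting a vector of \<open>lower (lifespan t x) t\<close>
  into its two parts lowers it.\<close>

definition lifespan_rank :: "real \<Rightarrow> 'v \<Rightarrow> nat" where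
  "lifespan_rank t x = dim (im_sup (lifespan t x) t) + dim (ker_sup (lifespan t x) t)"

lemma im_sup_antimono: "(\<And>s. s \<in> L \<Longrightarrow> s \<le> t \<Longrightarrow> s \<in> L') \<Longrightarrow> im_sup L' t \<subseteq> im_sup L t"
  by (auto simp: im_sup_def)

lemma ker_sup_mono: "(\<And>r. r \<in> L \<Longrightarrow> t \<le> r \<Longrightarrow> r \<in> L') \<Longrightarrow> ker_sup L t \<subseteq> ker_sup L' t"
  by (auto simp: ker_sup_def)

text \<open>The filtration steps of \<open>y\<close> are contained in those of \<open>x\<close>, and
  \<open>x\<close> witnesses that one inclusion is proper: a parameter outside the lifespan of
  \<open>x\<close> from which \<open>y\<close> comes, or one inside it at which \<open>y\<close> has
  died, excludes \<open>x\<close> from \<open>im_sup\<close> or \<open>ker_sup\<close> of the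
  lifespan of \<open>y\<close>.\<close>

lemma lifespan_rank_less:
  assumes x: "x \<in> vspace V t" "x \<noteq> 0" and y: "y \<noteq> 0"
    and "y \<in> im_sub (lifespan t x) t \<inter> ker_sup (lifespan t x) t
       \<or> y \<in> im_sup (lifespan t x) t \<inter> ker_sub (lifespan t x) t"
  shows "lifespan_rank t y < lifespan_rank t x"
proof -
  let ?L = "lifespan t x"
  obtain B where B: "finite B" "vspace V t \<subseteq> span B" using pfd by blast
  have subB: "im_sup L t \<subseteq> span B" "ker_sup L t \<subseteq> span B" for L
    using B by (auto simp: im_sup_def ker_sup_def)
  have yu: "y \<in> im_sup ?L t" "y \<in> ker_sup ?L t" "y \<in> vspace V t"
    using assms(4) im_sub_subset_sup[OF interval_lifespan[OF x] t_in_lifespan[OF x]]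
      ker_sub_subset_sup[OF interval_lifespan[OF x] t_in_lifespan[OF x]] by (auto simp: im_sup_def)
  have im: "im_sup (lifespan t y) t \<subseteq> im_sup ?L t"
    using im_sup_antimono in_im_sup_lifespan[OF yu(3) y yu(1)] by blast
  have ker: "ker_sup (lifespan t y) t \<subseteq> ker_sup ?L t"
    using ker_sup_mono in_ker_sup_lifespan[OF yu(3) y yu(2)] by blast
  note dims = dim_mono_finite[OF im subB(1) B(1)] dim_mono_finite[OF ker subB(2) B(1)]
  have xu: "x \<in> im_sup ?L t" "x \<in> ker_sup ?L t" using in_upper_lifespan[OF x] by (auto simp: upper_def)
  from assms(4) show ?thesis
  proof
    assume "y \<in> im_sub ?L t \<inter> ker_sup ?L t"
    then obtain s where s: "s \<le> t" "s \<notin> ?L" "y \<in> im s t" using y by (auto simp: im_sub_def)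
    then have "s \<in> lifespan t y" "x \<notin> im s t" using lifespan_le[OF yu(3) y] lifespan_le[OF x] by auto
    then have "x \<notin> im_sup (lifespan t y) t" using s by (auto simp: im_sup_def)
    then have "dim (im_sup (lifespan t y) t) < dim (im_sup ?L t)"
      using dim_psubset[OF subspace_im_sup _ subB(1) B(1)] im xu by blast
    then show ?thesis using dims unfolding lifespan_rank_def by linarith
  next
    assume "y \<in> im_sup ?L t \<inter> ker_sub ?L t"
    then obtain r where r: "t \<le> r" "r \<in> ?L" "vmap V t r y = 0" by (auto simp: ker_sub_def)
    then have "r \<notin> lifespan t y" "vmap V t r x \<noteq> 0"
      using lifespan_ge[OF yu(3) y] lifespan_ge[OF x] by auto
    then have "x \<notin> ker_sup (lifespan t y) t" using r by (auto simp: ker_sup_def)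
    then have "dim (ker_sup (lifespan t y) t) < dim (ker_sup ?L t)"
      using dim_psubset[OF subspace_ker_sup _ subB(2) B(1)] ker xu by blast
    then show ?thesis using dims unfolding lifespan_rank_def by linarith
  qed
qed

text \<open>The term \<open>M\<close> with the smallest image filtration, and among those the largest kernel
  filtration, contributes to a relation a vector that all other terms force into \<open>lower M t\<close>.\<close>

lemma upper_relation_in_lower:
  assumes fin: "finite F" "F \<noteq> {}" and F: "\<And>L. L \<in> F \<Longrightarrow> is_interval L \<and> t \<in> L \<and> z L \<in> upper L t"
    and sum0: "(\<Sum>L\<in>F. z L) = 0"
  shows "\<exists>L\<in>F. z L \<in> lower L t"
proof -
  have comparable_le: "L \<inter> {..t} \<subseteq> L' \<inter> {..t} \<or> L' \<inter> {..t} \<subseteq> L \<inter> {..t}" if L: "L \<in> F" "L' \<in> F" for L L'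
  proof (rule ccontr)
    assume "\<not> ?thesis"
    then obtain a b where "a \<in> L" "a \<le> t" "a \<notin> L'" "b \<in> L'" "b \<le> t" "b \<notin> L" by blast
    then show False using between[of L a t b] between[of L' b t a] F L by (meson linear)
  qed
  have comparable_ge: "L \<inter> {t..} \<subseteq> L' \<inter> {t..} \<or> L' \<inter> {t..} \<subseteq> L \<inter> {t..}" if L: "L \<in> F" "L' \<in> F" for L L'
  proof (rule ccontr)
    assume "\<not> ?thesis"
    then obtain a b where "a \<in> L" "a \<ge> t" "a \<notin> L'" "b \<in> L'" "b \<ge> t" "b \<notin> L" by blast
    then show False using between[of L t a b] between[of L' t b a] F L by (meson linear)
  qed
  \<comment> \<open>By minimality of \<open>P\<close>, every term either agrees with
    \<open>M\<close> below \<open>t\<close> or has a parameter there outside \<open>M\<close>, which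
    puts it into \<open>im_sub M t\<close>. Maximality of \<open>Q\<close> then puts the remaining
    terms of the first kind into \<open>ker_sub M t\<close>.\<close>
  let ?P = "(\<lambda>L. L \<inter> {..t}) ` F"
  have "\<exists>P\<in>?P. \<forall>P'\<in>?P. P' \<le> P \<longrightarrow> P = P'"
    using fin by (intro finite_has_minimal) auto
  then obtain P where P: "P \<in> ?P" "\<forall>P'\<in>?P. P' \<le> P \<longrightarrow> P = P'" by (elim bexE) (rule that)
  let ?G = "{L \<in> F. L \<inter> {..t} = P}"
  let ?Q = "(\<lambda>L. L \<inter> {t..}) ` ?G"
  have "\<exists>Q\<in>?Q. \<forall>Q'\<in>?Q. Q \<le> Q' \<longrightarrow> Q = Q'"
    using fin P(1) by (intro finite_has_maximal) auto
  then obtain Q where Q: "Q \<in> ?Q" "\<forall>Q'\<in>?Q. Q \<le> Q' \<longrightarrow> Q = Q'" by (elim bexE) (rule that)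
  from Q(1) obtain M where M: "M \<in> F" "M \<inter> {..t} = P" "M \<inter> {t..} = Q" by blast
  let ?A = "?G - {M}" and ?B = "F - ?G"
  have tM: "t \<in> M" using F M by blast
  have A: "z L \<in> im_sup M t \<inter> ker_sub M t" if "L \<in> ?A" for L
  proof -
    have L: "L \<in> F" "L \<inter> {..t} = P" "L \<noteq> M" using that by auto
    have "\<not> Q \<subseteq> L \<inter> {t..}"
    proof
      assume "Q \<subseteq> L \<inter> {t..}"
      then have "L \<inter> {t..} = Q" using bspec[OF Q(2), of "L \<inter> {t..}"] L by auto
      then have "L = M" using L M by (auto simp: set_eq_iff) (metis linear)+
      then show False using L by simp
    qed
    then obtain r where r: "r \<in> M" "r \<ge> t" "r \<notin> L" using M by blast
    have z: "z L \<in> im_sup L t" "z L \<in> ker_sup L t" using F L by (auto simp: upper_def)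
    have "z L \<in> im_sup M t" using im_sup_antimono[of M t L] L M z by blast
    moreover have "z L \<in> ker_sub M t" using r z by (auto simp: ker_sub_def ker_sup_def)
    ultimately show ?thesis by blast
  qed
  have B: "z L \<in> im_sub M t" if "L \<in> ?B" for L
  proof -
    have L: "L \<in> F" "L \<inter> {..t} \<noteq> P" using that by auto
    then have "\<not> L \<inter> {..t} \<subseteq> M \<inter> {..t}" using bspec[OF P(2), of "L \<inter> {..t}"] M by auto
    then obtain s where "s \<in> L" "s \<le> t" "s \<notin> M" by blast
    then show ?thesis using F[OF L(1)] by (auto simp: im_sub_def upper_def im_sup_def)
  qed
  define w where "w = - (\<Sum>L\<in>?A. z L)"
  define u where "u = - (\<Sum>L\<in>?B. z L)"
  have "(\<Sum>L\<in>F. z L) = (\<Sum>L\<in>?B. z L) + (\<Sum>L\<in>?G. z L)"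
    using fin(1) by (intro sum.subset_diff) auto
  also have "(\<Sum>L\<in>?G. z L) = z M + (\<Sum>L\<in>?A. z L)"
    using fin(1) M by (intro sum.remove) auto
  finally have "(\<Sum>L\<in>F. z L) = (\<Sum>L\<in>?B. z L) + (z M + (\<Sum>L\<in>?A. z L))" .
  then have zM: "z M = u + w" using sum0 unfolding u_def w_def by (simp add: algebra_simps eq_neg_iff_add_eq_0)
  have w: "w \<in> im_sup M t \<inter> ker_sub M t"
    unfolding w_def using A subspace_neg subspace_sum subspace_inter[OF subspace_im_sup subspace_ker_sub[OF tM]]
    by (metis (no_types, lifting))
  have u: "u \<in> im_sub M t"
    unfolding u_def using B subspace_neg[OF subspace_im_sub] subspace_sum[OF subspace_im_sub] by (metis (no_types, lifting))
  have iM: "is_interval M" using F M by blast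
  \<comment> \<open>\<open>u\<close> is a sum of vectors for which only \<open>im_sub\<close> is
    known; its kernel condition comes from \<open>z M\<close> and \<open>w\<close>.\<close>
  have "z M - w \<in> ker_sup M t"
    using F[OF M(1)] w ker_sub_subset_sup[OF iM tM] by (intro subspace_diff[OF subspace_ker_sup]) (auto simp: upper_def)
  then have "u \<in> im_sub M t \<inter> ker_sup M t" using u zM by simp
  then have "z M \<in> lower M t" using w zM unfolding lower_def by blast
  then show ?thesis using M by blast
qed

end

text \<open>No finite subfamily has more than \<open>card B\<close> members. This is how pointwise
  finite dimension bounds the number of bars alive at a parameter, before their number is known to
  be finite.\<close>

lemma (in vector_space) finite_independent_family:
  assumes indep: "\<And>S a. finite S \<Longrightarrow> S \<subseteq> A \<Longrightarrow> (\<Sum>i\<in>S. scale (a i) (f i)) = 0 \<Longrightarrow> \<forall>i\<in>S. a i = 0"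
    and B: "finite B" "f ` A \<subseteq> span B"
  shows "finite A"
proof -
  have "card S \<le> card B" if S: "finite S" "S \<subseteq> A" for S
  proof -
    have "inj_on f S" "independent (f ` S)"
      using family_independent[OF S(1), of f] indep[OF S] by blast+
    moreover have "f ` S \<subseteq> span B" using S B by blast
    ultimately show ?thesis using independent_span_bound[OF B(1)] card_image by metis
  qed
  then show ?thesis using finite_if_finite_subsets_card_bdd[of A "card B"] by blast
qed

theorem (in pfd_pmod) interval_decomposition:
  "\<exists>(I :: (real set \<times> 'v) set) K e. ibasis V I K e"
proof -
  define R where "R L B g \<longleftrightarrow> finite B \<and> (\<forall>b\<in>B. \<forall>t\<in>L. g b t \<in> upper L t) \<and>
     (\<forall>b\<in>B. \<forall>s\<in>L. \<forall>t\<in>L. s \<le> t \<longrightarrow> vmap V s t (g b s) = g b t) \<and>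
     (\<forall>t\<in>L. \<forall>x\<in>upper L t. \<exists>a. x - (\<Sum>b\<in>B. vscale V (a b) (g b t)) \<in> lower L t) \<and>
     (\<forall>t\<in>L. \<forall>a. (\<Sum>b\<in>B. vscale V (a b) (g b t)) \<in> lower L t \<longrightarrow> (\<forall>b\<in>B. a b = 0))"
    for L and B :: "'v set" and g
  have "\<forall>L\<in>{L. is_interval L \<and> L \<noteq> {}}. \<exists>p. R L (fst p) (snd p)"
    using relative_interval_basis unfolding R_def by simp
  from bchoice[OF this] obtain F where
    F: "\<And>L. is_interval L \<Longrightarrow> L \<noteq> {} \<Longrightarrow> R L (fst (F L)) (snd (F L))" by blast
  define B where "B L = fst (F L)" for L
  define g where "g L = snd (F L)" for L
  have R: "R L (B L) (g L)" if "is_interval L" "L \<noteq> {}" for L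
    using F[OF that] by (simp add: B_def g_def)
  \<comment> \<open>The same vector may occur in the relative bases of several intervals, hence the
    pairs.\<close>
  define I where "I = {(L, b). is_interval L \<and> L \<noteq> {} \<and> b \<in> B L}"
  define e where "e i t = (if t \<in> fst i then g (fst i) (snd i) t else 0)" for i t
  let ?act = "\<lambda>t. {i \<in> I. t \<in> fst i}"
  have RI: "R (fst i) (B (fst i)) (g (fst i))" "snd i \<in> B (fst i)" if "i \<in> I" for i
    using that by (auto simp: I_def intro: R)
  have e_upper: "e i t \<in> upper (fst i) t" if "i \<in> ?act t" for i t
    using that RI[of i] unfolding e_def R_def by simp
  have e_in: "e i t \<in> vspace V t" if "i \<in> I" for i t
    using e_upper[of i t] that upper_subset vspace_closed(1) by (cases "t \<in> fst i") (auto simp: e_def)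
  have indep: "\<forall>i\<in>S. a i = 0"
    if S: "finite S" "S \<subseteq> ?act t" and z: "(\<Sum>i\<in>S. vscale V (a i) (e i t)) = 0" for S a t
  proof (rule ccontr)
    assume n: "\<not> (\<forall>i\<in>S. a i = 0)"
    \<comment> \<open>Only nonzero coefficients are kept, so that every interval that occurs carries
      one. Grouped by intervals, the relation has a term in \<open>lower L t\<close>, against the
      relative independence of the basis for \<open>L\<close>.\<close>
    define S' where "S' = {i \<in> S. a i \<noteq> 0}"
    have S': "finite S'" "S' \<noteq> {}" "S' \<subseteq> ?act t" using S n by (auto simp: S'_def)
    define z where "z L = (\<Sum>i | i \<in> S' \<and> fst i = L. vscale V (a i) (e i t))" for L
    have L: "is_interval L \<and> t \<in> L \<and> z L \<in> upper L t" if "L \<in> fst ` S'" for L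
    proof (intro conjI)
      show "z L \<in> upper L t" unfolding z_def
        using e_upper S' by (intro subspace_sum[OF subspace_upper] subspace_scale[OF subspace_upper]) auto
    qed (use that S' in \<open>auto simp: I_def\<close>)
    have "(\<Sum>i\<in>S. vscale V (a i) (e i t)) = (\<Sum>i\<in>S'. vscale V (a i) (e i t))"
      using S by (intro sum.mono_neutral_right) (auto simp: S'_def)
    also have "\<dots> = (\<Sum>L\<in>fst ` S'. z L)" unfolding z_def by (rule sum.image_gen[OF S'(1)])
    finally have "\<exists>L\<in>fst ` S'. z L \<in> lower L t"
      using \<open>(\<Sum>i\<in>S. vscale V (a i) (e i t)) = 0\<close> S' L by (intro upper_relation_in_lower) auto
    then obtain L where L': "L \<in> fst ` S'" "z L \<in> lower L t" by blast
    then have tL: "is_interval L" "t \<in> L" using L by blast+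
    define c where "c b = (if (L, b) \<in> S' then a (L, b) else 0)" for b
    have RL: "R L (B L) (g L)" using R tL by blast
    have inj: "inj_on (Pair L) {b \<in> B L. (L, b) \<in> S'}" by (auto simp: inj_on_def)
    have "{i \<in> S'. fst i = L} = Pair L ` {b \<in> B L. (L, b) \<in> S'}" using S' by (auto simp: I_def)
    then have "z L = (\<Sum>b\<in>{b \<in> B L. (L, b) \<in> S'}. vscale V (c b) (g L b t))"
      unfolding z_def using tL by (simp add: sum.reindex[OF inj] c_def e_def)
    also have "\<dots> = (\<Sum>b\<in>B L. vscale V (c b) (g L b t))"
      using RL by (intro sum.mono_neutral_left) (auto simp: c_def R_def)
    finally have "\<forall>b\<in>B L. c b = 0" using RL L'(2) tL unfolding R_def by metis
    moreover obtain b where "(L, b) \<in> S'" using L'(1) by auto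
    ultimately show False using S' by (auto simp: c_def S'_def I_def split: if_splits)
  qed
  have fin: "finite (?act t)" for t
  proof -
    obtain D where D: "finite D" "vspace V t \<subseteq> span D" using pfd by blast
    have "(\<lambda>i. e i t) ` ?act t \<subseteq> span D" using e_in D(2) by blast
    then show ?thesis using finite_independent_family[of "?act t" "\<lambda>i. e i t" D] indep D(1) by blast
  qed
  have span: "x \<in> span ((\<lambda>i. e i t) ` ?act t)" if "x \<in> vspace V t" for x t
    using that
  proof (induction "lifespan_rank t x" arbitrary: x rule: less_induct)
    case less
    let ?E = "(\<lambda>i. e i t) ` ?act t"
    show ?case
    proof (cases "x = 0")
      case True
      then show ?thesis by (simp add: span_zero)
    next
      case False
      note x = less.prems False
      let ?L = "lifespan t x"
      have L: "is_interval ?L" "t \<in> ?L" using interval_lifespan[OF x] t_in_lifespan[OF x] .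
      have RL: "R ?L (B ?L) (g ?L)" using R L by blast
      then have "\<forall>t\<in>?L. \<forall>x\<in>upper ?L t. \<exists>a. x - (\<Sum>b\<in>B ?L. vscale V (a b) (g ?L b t)) \<in> lower ?L t"
        unfolding R_def by (elim conjE)
      from bspec[OF bspec[OF this L(2)] in_upper_lifespan[OF x]]
      obtain a where "x - (\<Sum>b\<in>B ?L. vscale V (a b) (g ?L b t)) \<in> lower ?L t" ..
      then obtain u w where uw: "x - (\<Sum>b\<in>B ?L. vscale V (a b) (g ?L b t)) = u + w"
        "u \<in> im_sub ?L t \<inter> ker_sup ?L t" "w \<in> im_sup ?L t \<inter> ker_sub ?L t"
        unfolding lower_def by blast
      have sp: "y \<in> span ?E" if "y \<in> im_sub ?L t \<inter> ker_sup ?L t \<or> y \<in> im_sup ?L t \<inter> ker_sub ?L t" for y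
      proof (cases "y = 0")
        case True
        then show ?thesis by (simp add: span_zero)
      next
        case False
        have "y \<in> vspace V t" using that by (auto simp: im_sub_def im_sup_def)
        then show ?thesis using less.hyps lifespan_rank_less[OF x False that] by blast
      qed
      have "g ?L b t \<in> ?E" if "b \<in> B ?L" for b
        using that L by (intro image_eqI[of _ _ "(?L, b)"]) (auto simp: I_def e_def)
      then have "(\<Sum>b\<in>B ?L. vscale V (a b) (g ?L b t)) \<in> span ?E"
        by (intro span_sum span_scale span_base)
      then have "(u + w) + (\<Sum>b\<in>B ?L. vscale V (a b) (g ?L b t)) \<in> span ?E"
        using sp uw by (intro span_add) auto
      then show ?thesis using uw(1) by (simp add: algebra_simps)
    qed
  qed
  have "ibasis V I fst e"
  proof unfold_locales
    show "\<exists>a. x = (\<Sum>i | i \<in> I \<and> t \<in> fst i. vscale V (a i) (e i t))" if "x \<in> vspace V t" for x t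
      using span_image_sum[OF fin span[OF that]] .
    show "a i = 0" if "(\<Sum>i | i \<in> I \<and> t \<in> fst i. vscale V (a i) (e i t)) = 0" "i \<in> I" "t \<in> fst i" for a i t
      using indep[OF fin subset_refl that(1)] that by blast
    show "vmap V s t (e i s) = e i t" if i: "i \<in> I" "s \<in> fst i" "s \<le> t" for i s t
    proof -
      show ?thesis
      proof (cases "t \<in> fst i")
        case True
        then show ?thesis using RI[OF i(1)] i unfolding R_def e_def by simp
      next
        case False
        have "e i s \<in> ker_sup (fst i) s" using e_upper[of i s] i by (auto simp: upper_def)
        then show ?thesis using i False by (auto simp: ker_sup_def e_def)
      qed
    qed
  qed (use fin e_in in \<open>auto simp: I_def e_def\<close>)
  then show ?thesis by blast
qed

section \<open>Barcodes and coordinates\<close>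

context ibasis
begin

abbreviation active :: "real \<Rightarrow> 'i set" where
  "active t \<equiv> {i \<in> I. t \<in> K i}"

text \<open>The default \<open>0\<close> off \<open>active t\<close> makes \<open>coord t x\<close>
  determined by \<open>x\<close> at every index, so that coordinates can be compared as
  functions.\<close>

definition coord :: "real \<Rightarrow> 'v \<Rightarrow> 'i \<Rightarrow> 'f" where
  "coord t x i = (if i \<in> active t then (SOME a. x = (\<Sum>i\<in>active t. vscale V (a i) (e i t))) i else 0)"

lemma coord_out: "i \<notin> active t \<Longrightarrow> coord t x i = 0"
  unfolding coord_def by (rule if_not_P)

lemma coord_sum:
  assumes "x \<in> vspace V t"
  shows "x = (\<Sum>i\<in>active t. vscale V (coord t x i) (e i t))"
proof -
  have "x = (\<Sum>i\<in>active t. vscale V ((SOME a. x = (\<Sum>i\<in>active t. vscale V (a i) (e i t))) i) (e i t))"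
    by (rule someI_ex[OF spanning[OF assms]])
  also have "\<dots> = (\<Sum>i\<in>active t. vscale V (coord t x i) (e i t))"
    by (intro sum.cong) (auto simp: coord_def)
  finally show ?thesis .
qed

lemma coord_unique:
  assumes "(\<Sum>i\<in>active t. vscale V (a i) (e i t)) = (\<Sum>i\<in>active t. vscale V (b i) (e i t))" "i \<in> active t"
  shows "a i = b i"
proof -
  have "(\<Sum>i\<in>active t. vscale V (a i - b i) (e i t)) = 0"
    using assms(1) by (simp add: scale_left_diff_distrib sum_subtractf)
  then show ?thesis using indep[where t = t and i = i and a = "\<lambda>i. a i - b i"] assms(2) by simp
qed

lemma coord_eqI:
  assumes "x = (\<Sum>i\<in>active t. vscale V (a i) (e i t))" "\<And>i. i \<notin> active t \<Longrightarrow> a i = 0"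
  shows "coord t x = a"
proof
  fix i
  have x: "x \<in> vspace V t" unfolding assms(1) by (rule vspace_sum) (use e_in in blast)
  show "coord t x i = a i"
    using coord_unique[where t = t and i = i and a = "coord t x" and b = a] coord_sum[OF x] assms coord_out[of i t x]
    by (cases "i \<in> active t") auto
qed

lemma coord_add:
  assumes "x \<in> vspace V t" "y \<in> vspace V t"
  shows "coord t (x + y) = (\<lambda>i. coord t x i + coord t y i)"
proof (rule coord_eqI)
  show "x + y = (\<Sum>i\<in>active t. vscale V (coord t x i + coord t y i) (e i t))"
    using coord_sum[OF assms(1)] coord_sum[OF assms(2)] by (simp add: scale_left_distrib sum.distrib)
qed (auto simp: coord_out)

lemma coord_scale:
  assumes "x \<in> vspace V t"
  shows "coord t (vscale V c x) = (\<lambda>i. c * coord t x i)"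
proof (rule coord_eqI)
  have "vscale V c x = vscale V c (\<Sum>i\<in>active t. vscale V (coord t x i) (e i t))"
    using coord_sum[OF assms] by simp
  then show "vscale V c x = (\<Sum>i\<in>active t. vscale V (c * coord t x i) (e i t))"
    by (simp add: scale_sum_right)
qed (auto simp: coord_out)

lemma coord_zero: "coord t 0 = (\<lambda>i. 0)"
  by (rule coord_eqI) auto

lemma coord_e: "i \<in> active t \<Longrightarrow> coord t (e i t) = (\<lambda>j. if j = i then 1 else 0)"
  using finite_active by (intro coord_eqI) (auto simp: if_distrib[of "\<lambda>c. vscale V c _"] sum.delta cong: if_cong)

text \<open>\<open>e_map\<close> and \<open>e_out\<close> make the structure maps diagonal in these
  bases, with entries \<open>1\<close> and \<open>0\<close>.\<close>

lemma coord_vmap: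
  assumes st: "s \<le> t" and x: "x \<in> vspace V s"
  shows "coord t (vmap V s t x) = (\<lambda>i. if t \<in> K i then coord s x i else 0)"
proof (rule coord_eqI)
  have "vmap V s t x = vmap V s t (\<Sum>i\<in>active s. vscale V (coord s x i) (e i s))"
    using coord_sum[OF x] by simp
  also have "\<dots> = (\<Sum>i\<in>active s. vscale V (coord s x i) (e i t))"
    using e_in e_map st by (subst vmap_sum) (auto intro!: sum.cong)
  also have "\<dots> = (\<Sum>i\<in>active s \<inter> active t. vscale V (coord s x i) (e i t))"
    using finite_active e_out by (intro sum.mono_neutral_right) auto
  also have "\<dots> = (\<Sum>i\<in>active s \<inter> active t. vscale V (if t \<in> K i then coord s x i else 0) (e i t))"
    by (intro sum.cong) auto
  also have "\<dots> = (\<Sum>i\<in>active t. vscale V (if t \<in> K i then coord s x i else 0) (e i t))"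
    using finite_active coord_out[of _ s x] by (intro sum.mono_neutral_left) auto
  finally show "vmap V s t x = (\<Sum>i\<in>active t. vscale V (if t \<in> K i then coord s x i else 0) (e i t))" .
qed (auto simp: coord_out)

lemma linear_on_basis:
  assumes f: "linear_between (vscale V) (vspace V t) sc T f" and x: "x \<in> vspace V t"
  shows "f x = (\<Sum>i\<in>active t. sc (coord t x i) (f (e i t)))"
proof -
  have "f x = f (\<Sum>i\<in>active t. vscale V (coord t x i) (e i t))"
    using coord_sum[OF x] by simp
  then show ?thesis
    using linear_between_sum[OF f vector_space_axioms subspace_vspace, of "active t" "\<lambda>i. e i t" "coord t x"] e_in
    by simp
qed

lemma linear_eq_on_basis:
  assumes f: "linear_between (vscale V) (vspace V t) sc T f" and g: "linear_between (vscale V) (vspace V t) sc T' g"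
    and eq: "\<And>i. i \<in> active t \<Longrightarrow> f (e i t) = g (e i t)" and x: "x \<in> vspace V t"
  shows "f x = g x"
  unfolding linear_on_basis[OF f x] linear_on_basis[OF g x] using eq by (intro sum.cong) auto

lemma reindex:
  assumes h: "bij_betw h I J" and K: "\<And>i. i \<in> I \<Longrightarrow> K' (h i) = K i"
  shows "ibasis V J K' (\<lambda>j. e (inv_into I h j))"
proof -
  let ?k = "inv_into I h"
  have k: "?k j \<in> I" "h (?k j) = j" "K' j = K (?k j)" if "j \<in> J" for j
    using h that K[of "?k j"] by (auto simp: bij_betw_def inv_into_into f_inv_into_f)
  have kh: "?k (h i) = i" "h i \<in> J" if "i \<in> I" for i
    using h that by (auto simp: bij_betw_def)
  have act: "{j \<in> J. t \<in> K' j} = h ` active t" for t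
    using k kh K by (auto simp: image_iff) metis
  have inj: "inj_on h (active t)" for t using h by (auto simp: bij_betw_def inj_on_def)
  have sum: "(\<Sum>j\<in>{j \<in> J. t \<in> K' j}. vscale V (a j) (e (?k j) t)) = (\<Sum>i\<in>active t. vscale V (a (h i)) (e i t))" for a t
    unfolding act using kh by (subst sum.reindex[OF inj]) (auto intro!: sum.cong)
  show ?thesis
  proof unfold_locales
    show "\<exists>a. x = (\<Sum>j\<in>{j \<in> J. t \<in> K' j}. vscale V (a j) (e (?k j) t))" if x: "x \<in> vspace V t" for x t
    proof -
      have "x = (\<Sum>i\<in>active t. vscale V (coord t x (?k (h i))) (e i t))"
        using coord_sum[OF x] kh by (auto intro!: sum.cong elim!: trans)
      then show ?thesis unfolding sum by (intro exI[of _ "\<lambda>j. coord t x (?k j)"])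
    qed
    show "a j = 0" if "(\<Sum>j\<in>{j \<in> J. t \<in> K' j}. vscale V (a j) (e (?k j) t)) = 0" "j \<in> J" "t \<in> K' j" for a t j
      using that indep[where t = t and i = "?k j" and a = "\<lambda>i. a (h i)"] k[of j] unfolding sum by simp
    show "finite {j \<in> J. t \<in> K' j}" for t unfolding act using finite_active by simp
  qed (use k interval nonempty e_in e_out e_map in auto)
qed

end

text \<open>An index with value \<open>p\<close> is sent to \<open>p\<close> together with its
  number in the finite fibre over \<open>p\<close>. The restriction to \<open>Q\<close> is for
  diagrams, whose multiplicities are those of a given smoothing only at points of large enough
  persistence.\<close>

lemma copies_bij:
  assumes fib: "\<And>p. p \<in> Q \<Longrightarrow> finite {i \<in> A. f i = p} \<and> m p = enat (card {i \<in> A. f i = p})"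
  shows "\<exists>h. bij_betw h {i \<in> A. f i \<in> Q} {x \<in> copies m. fst x \<in> Q} \<and> (\<forall>i\<in>A. f i \<in> Q \<longrightarrow> fst (h i) = f i)"
proof -
  have "\<forall>p\<in>Q. \<exists>h. bij_betw h {i \<in> A. f i = p} {0..<card {i \<in> A. f i = p}}"
    using ex_bij_betw_finite_nat fib by blast
  from bchoice[OF this] obtain h where
    h: "\<And>p. p \<in> Q \<Longrightarrow> bij_betw (h p) {i \<in> A. f i = p} {0..<card {i \<in> A. f i = p}}" by blast
  let ?h = "\<lambda>i. (f i, h (f i) i)"
  have lt: "h (f i) i < card {j \<in> A. f j = f i}" if "i \<in> A" "f i \<in> Q" for i
    using h[OF that(2)] that(1) by (auto simp: bij_betw_def)
  have "bij_betw ?h {i \<in> A. f i \<in> Q} {x \<in> copies m. fst x \<in> Q}"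
  proof (rule bij_betw_imageI)
    show "inj_on ?h {i \<in> A. f i \<in> Q}"
    proof (rule inj_onI)
      fix i j assume ij: "i \<in> {i \<in> A. f i \<in> Q}" "j \<in> {i \<in> A. f i \<in> Q}" "?h i = ?h j"
      then have fj: "f j = f i" "h (f i) i = h (f i) j" by auto
      have "inj_on (h (f i)) {j \<in> A. f j = f i}" using h[of "f i"] ij(1) unfolding bij_betw_def by blast
      from inj_onD[OF this fj(2)] show "i = j" using ij(1,2) fj(1) by blast
    qed
    show "?h ` {i \<in> A. f i \<in> Q} = {x \<in> copies m. fst x \<in> Q}"
    proof (intro subset_antisym subsetI)
      fix x assume "x \<in> ?h ` {i \<in> A. f i \<in> Q}"
      then obtain i where i: "i \<in> A" "f i \<in> Q" "x = ?h i" by blast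
      then show "x \<in> {x \<in> copies m. fst x \<in> Q}" using lt[OF i(1,2)] fib[OF i(2)] by (simp add: copies_def)
    next
      fix x assume x: "x \<in> {x \<in> copies m. fst x \<in> Q}"
      obtain p k where pk: "x = (p, k)" by (rule prod.exhaust)
      then have p: "p \<in> Q" using x by simp
      then have "k < card {i \<in> A. f i = p}" using x fib[OF p] pk by (simp add: copies_def)
      then have "k \<in> h p ` {i \<in> A. f i = p}" using bij_betw_imp_surj_on[OF h[OF p]] by simp
      then obtain i where "i \<in> A" "f i = p" "k = h p i" by blast
      then show "x \<in> ?h ` {i \<in> A. f i \<in> Q}" using pk p by blast
    qed
  qed
  then show ?thesis by (intro exI[of _ ?h]) simp
qed

section \<open>Comparison with direct sums of interval modules\<close>

abbreviation bar_sum :: "(real set \<Rightarrow> enat) \<Rightarrow> ('f::field, (real set \<times> nat) \<Rightarrow>\<^sub>0 'f) pmodule" where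
  "bar_sum m \<equiv> direct_sum (copies m) (\<lambda>i. interval_module (fst i))"

lemma lookup_bar_sum_scale: "Poly_Mapping.lookup (vscale (bar_sum m) c p) i = c * Poly_Mapping.lookup p i"
  by (simp add: direct_sum_def interval_module_def lookup_mapp when_def in_keys_iff)

lemma bar_sum_vspace: "p \<in> vspace (bar_sum m) t \<longleftrightarrow>
    Poly_Mapping.keys p \<subseteq> {i \<in> copies m. t \<in> fst i}"
  by (auto simp: direct_sum_def interval_module_def in_keys_iff split: if_splits)

lemma lookup_bar_sum_vmap: "Poly_Mapping.lookup (vmap (bar_sum m) s t p) i =
    (if s \<in> fst i \<and> t \<in> fst i then Poly_Mapping.lookup p i else 0)"
  by (simp add: direct_sum_def interval_module_def lookup_mapp when_def in_keys_iff)

lemma vector_space_bar_sum: "vector_space (vscale (bar_sum m))"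
  by unfold_locales
    (auto intro!: poly_mapping_eqI simp: lookup_bar_sum_scale lookup_add algebra_simps)

lemma subspace_bar_sum: "module.subspace (vscale (bar_sum m)) (vspace (bar_sum m) t)"
proof -
  interpret vector_space "vscale (bar_sum m)" by (rule vector_space_bar_sum)
  show ?thesis
  proof (rule subspaceI)
    fix p q :: "(real set \<times> nat) \<Rightarrow>\<^sub>0 'a" and c
    assume p: "p \<in> vspace (bar_sum m) t"
    then show "vscale (bar_sum m) c p \<in> vspace (bar_sum m) t"
      unfolding bar_sum_vspace by (auto simp: in_keys_iff lookup_bar_sum_scale)
    assume "q \<in> vspace (bar_sum m) t"
    then show "p + q \<in> vspace (bar_sum m) t"
      using p Poly_Mapping.keys_add[of p q] unfolding bar_sum_vspace by blast
  qed (simp add: bar_sum_vspace)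
qed

text \<open>Indices with the same bar are all alive at any point of it, so multiplicities are
  finite; the coordinates are then an isomorphism onto the direct sum.\<close>

lemma (in ibasis) barcode_exists: "\<exists>m. is_barcode V m"
proof -
  define m where "m L = enat (card {i \<in> I. K i = L})" for L
  have fin: "finite {i \<in> I. K i = L}" for L
  proof (cases "{i \<in> I. K i = L} = {}")
    case True
    show ?thesis unfolding True by simp
  next
    case False
    then obtain t where "t \<in> L" using nonempty by blast
    then have "{i \<in> I. K i = L} \<subseteq> active t" by blast
    then show ?thesis by (rule finite_subset[OF _ finite_active])
  qed
  have m0: "is_interval L \<and> L \<noteq> {}" if "m L \<noteq> 0" for L
  proof -
    have "card {i \<in> I. K i = L} \<noteq> 0" using that by (simp add: m_def zero_enat_def)
    then obtain i where "i \<in> I" "K i = L" by (auto simp: card_eq_0_iff)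
    then show ?thesis using interval nonempty by blast
  qed
  obtain h where h: "bij_betw h I (copies m)" "\<And>i. i \<in> I \<Longrightarrow> fst (h i) = K i"
    using copies_bij[of UNIV I K m] fin by (auto simp: m_def)
  let ?D = "bar_sum m :: ('f, _) pmodule"
  interpret b: ibasis V "copies m" fst "\<lambda>j. e (inv_into I h j)"
    by (rule reindex[OF h])
  let ?e = "\<lambda>j. e (inv_into I h j)"
  interpret D: vector_space "vscale ?D" by (rule vector_space_bar_sum)
  define \<phi> where "\<phi> t x = (\<Sum>i\<in>b.active t. Poly_Mapping.single i (b.coord t x i))" for t x
  define \<psi> where "\<psi> t p = (\<Sum>i\<in>b.active t. vscale V (Poly_Mapping.lookup p i) (?e i t))" for t p
  have lookup_\<phi>: "Poly_Mapping.lookup (\<phi> t x) i = b.coord t x i" for t x i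
    using b.finite_active[of t] b.coord_out[of i t x]
    by (auto simp: \<phi>_def lookup_sum lookup_single when_def sum.delta if_distrib cong: if_cong)
  have coord_\<psi>: "b.coord t (\<psi> t p) = Poly_Mapping.lookup p" if "p \<in> vspace ?D t" for t p
    using that by (intro b.coord_eqI) (auto simp: \<psi>_def bar_sum_vspace in_keys_iff)
  have \<psi>V: "\<psi> t p \<in> vspace V t" for t p
    unfolding \<psi>_def by (intro vspace_sum b.e_in) auto
  have \<phi>D: "\<phi> t x \<in> vspace ?D t" for t x
    unfolding bar_sum_vspace
  proof
    fix i assume "i \<in> Poly_Mapping.keys (\<phi> t x)"
    then have "b.coord t x i \<noteq> 0" by (simp add: in_keys_iff lookup_\<phi>)
    then show "i \<in> b.active t" using b.coord_out by blast
  qed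
  have \<psi>\<phi>: "\<psi> t (\<phi> t x) = x" if "x \<in> vspace V t" for t x
    unfolding \<psi>_def lookup_\<phi> using b.coord_sum[OF that] by simp
  have \<phi>\<psi>: "\<phi> t (\<psi> t p) = p" if "p \<in> vspace ?D t" for t p
    by (rule poly_mapping_eqI) (simp add: lookup_\<phi> coord_\<psi>[OF that])
  have 1: "morphism V ?D \<phi>"
    unfolding morphism_def linear_between_def
  proof (intro conjI allI impI ballI)
    fix s t x assume "s \<le> t" "x \<in> vspace V s"
    then show "\<phi> t (vmap V s t x) = vmap ?D s t (\<phi> s x)"
      using b.coord_out[of _ s x]
      by (intro poly_mapping_eqI) (auto simp: lookup_\<phi> lookup_bar_sum_vmap b.coord_vmap)
  qed (use \<phi>D in \<open>auto intro!: poly_mapping_eqI simp: lookup_\<phi> lookup_add b.coord_add b.coord_scale lookup_bar_sum_scale\<close>)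
  have 2: "morphism ?D V \<psi>"
    unfolding morphism_def linear_between_def
  proof (intro conjI allI impI ballI)
    fix s t p assume st: "s \<le> t" and p: "p \<in> vspace ?D s"
    have "\<phi> t (vmap V s t (\<psi> s p)) = vmap ?D s t p"
      using 1 \<psi>V \<phi>\<psi>[OF p] st unfolding morphism_def by metis
    then show "\<psi> t (vmap ?D s t p) = vmap V s t (\<psi> s p)"
      using \<psi>\<phi>[of "vmap V s t (\<psi> s p)" t] vmap_in[OF st \<psi>V] by metis
  qed (use \<psi>V in \<open>auto simp: \<psi>_def lookup_add lookup_bar_sum_scale scale_left_distrib sum.distrib scale_sum_right\<close>)
  have "isomorphic V ?D"
    unfolding isomorphic_def using 1 2 \<psi>\<phi> \<phi>\<psi> by blast
  then show ?thesis using m0 unfolding is_barcode_def by blast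
qed

text \<open>\<open>barcode\<close> is an unspecified choice, so a basis must be extracted from an
  arbitrary isomorphism. It consists of the preimages of the unit vectors, and pointwise finite
  dimension yields \<open>finite_active\<close>.\<close>

lemma (in pfd_pmod) barcode_ibasis:
  assumes "is_barcode V m"
  shows "\<exists>e. ibasis V (copies m) fst e"
proof -
  let ?D = "bar_sum m :: ('f, _) pmodule"
  let ?one = "\<lambda>i. Poly_Mapping.single i (1 :: 'f)"
  interpret D: vector_space "vscale ?D" by (rule vector_space_bar_sum)
  obtain \<phi> \<psi> where \<phi>: "morphism V ?D \<phi>" and \<psi>: "morphism ?D V \<psi>"
    and \<psi>\<phi>: "\<And>t x. x \<in> vspace V t \<Longrightarrow> \<psi> t (\<phi> t x) = x"
    and \<phi>\<psi>: "\<And>t p. p \<in> vspace ?D t \<Longrightarrow> \<phi> t (\<psi> t p) = p"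
    using assms unfolding is_barcode_def isomorphic_def by blast
  have \<psi>lin: "linear_between (vscale ?D) (vspace ?D t) (vscale V) (vspace V t) (\<psi> t)" for t
    using \<psi> unfolding morphism_def by blast
  have \<phi>lin: "linear_between (vscale V) (vspace V t) (vscale ?D) (vspace ?D t) (\<phi> t)" for t
    using \<phi> unfolding morphism_def by blast
  have \<psi>V: "\<psi> t p \<in> vspace V t" if "p \<in> vspace ?D t" for t p
    using \<psi>lin that unfolding linear_between_def by blast
  have \<phi>D: "\<phi> t x \<in> vspace ?D t" if "x \<in> vspace V t" for t x
    using \<phi>lin that unfolding linear_between_def by blast
  let ?act = "\<lambda>t. {i \<in> copies m. t \<in> fst i}"
  have one: "?one i \<in> vspace ?D t" if "i \<in> ?act t" for i t
    using that by (simp add: bar_sum_vspace)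
  define e where "e i t = (if t \<in> fst i then \<psi> t (?one i) else 0)" for i :: "real set \<times> nat" and t
  have e_in: "e i t \<in> vspace V t" if "i \<in> copies m" for i t
    using that \<psi>V one vspace_closed(1) by (auto simp: e_def)
  have e_sum: "(\<Sum>i\<in>S. vscale V (a i) (e i t)) = \<psi> t (\<Sum>i\<in>S. vscale ?D (a i) (?one i))"
    if "S \<subseteq> ?act t" for S a t
    using that one by (subst linear_between_sum[OF \<psi>lin vector_space_bar_sum subspace_bar_sum])
      (auto simp: e_def intro!: sum.cong)
  have lookup_sum_one: "Poly_Mapping.lookup (\<Sum>i\<in>S. vscale ?D (a i) (?one i)) j = (if j \<in> S then a j else 0)"
    if "finite S" for S a j
    using that by (auto simp: lookup_sum lookup_bar_sum_scale lookup_single when_def if_distrib cong: if_cong)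
  have indep: "\<forall>i\<in>S. a i = 0"
    if S: "finite S" "S \<subseteq> ?act t" and z: "(\<Sum>i\<in>S. vscale V (a i) (e i t)) = 0" for S a t
  proof -
    let ?p = "\<Sum>i\<in>S. vscale ?D (a i) (?one i)"
    have "?p \<in> vspace ?D t"
      using S one by (intro D.subspace_sum[OF subspace_bar_sum] D.subspace_scale[OF subspace_bar_sum]) auto
    then have "\<phi> t (\<psi> t ?p) = ?p" by (rule \<phi>\<psi>)
    moreover have "\<psi> t ?p = 0" using z e_sum[OF S(2), of a] by simp
    ultimately have "?p = \<phi> t 0" by simp
    also have "\<dots> = 0" using linear_between_zero[OF \<phi>lin vspace_closed(1)] .
    finally have p0: "?p = 0" .
    show ?thesis
    proof
      fix i assume "i \<in> S"
      then have "a i = Poly_Mapping.lookup ?p i" using lookup_sum_one[OF S(1)] by simp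
      then show "a i = 0" using p0 by simp
    qed
  qed
  have fin: "finite (?act t)" for t
  proof -
    obtain B where B: "finite B" "vspace V t \<subseteq> span B" using pfd by blast
    have "(\<lambda>i. e i t) ` ?act t \<subseteq> span B" using e_in B(2) by blast
    then show ?thesis using finite_independent_family[of "?act t" "\<lambda>i. e i t" B] indep B(1) by blast
  qed
  have "ibasis V (copies m) fst e"
  proof unfold_locales
    fix i :: "real set \<times> nat" assume i: "i \<in> copies m"
    then have "m (fst i) \<noteq> 0" by (auto simp: copies_def)
    then show "is_interval (fst i)" "fst i \<noteq> {}" using assms by (auto simp: is_barcode_def)
    show "vmap V s t (e i s) = e i t" if "s \<in> fst i" "s \<le> t" for s t
    proof -
      have "vmap V s t (e i s) = \<psi> t (vmap ?D s t (?one i))"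
        using \<psi> one[of i s] i that unfolding morphism_def e_def by auto
      also have "vmap ?D s t (?one i) = (if t \<in> fst i then ?one i else 0)"
        using that by (intro poly_mapping_eqI) (auto simp: lookup_bar_sum_vmap lookup_single when_def)
      also have "\<psi> t \<dots> = e i t"
        using linear_between_zero[OF \<psi>lin D.subspace_0[OF subspace_bar_sum]] by (auto simp: e_def)
      finally show ?thesis .
    qed
  next
    fix x t assume x: "x \<in> vspace V t"
    let ?p = "\<phi> t x"
    have "?p = (\<Sum>i\<in>?act t. vscale ?D (Poly_Mapping.lookup ?p i) (?one i))"
    proof (rule poly_mapping_eqI)
      fix i
      have "i \<in> ?act t" if "Poly_Mapping.lookup ?p i \<noteq> 0"
        using \<phi>D[OF x] that unfolding bar_sum_vspace by (meson in_keys_iff subsetD)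
      then show "Poly_Mapping.lookup ?p i
          = Poly_Mapping.lookup (\<Sum>i\<in>?act t. vscale ?D (Poly_Mapping.lookup ?p i) (?one i)) i"
        unfolding lookup_sum_one[OF fin] by metis
    qed
    then have "x = (\<Sum>i\<in>?act t. vscale V (Poly_Mapping.lookup ?p i) (e i t))"
      using \<psi>\<phi>[OF x] e_sum[of "?act t" t "Poly_Mapping.lookup ?p"] by simp
    then show "\<exists>a. x = (\<Sum>i\<in>?act t. vscale V (a i) (e i t))" by blast
  next
    fix a i t assume "(\<Sum>i\<in>?act t. vscale V (a i) (e i t)) = 0" "i \<in> copies m" "t \<in> fst i"
    then show "a i = 0" using indep[OF fin subset_refl] by blast
  qed (use fin e_in in \<open>auto simp: e_def\<close>)
  then show ?thesis by blast
qed

theorem (in pfd_pmod) barcode_basis_exists: "\<exists>e. ibasis V (copies (barcode V)) fst e"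
proof -
  obtain I :: "(real set \<times> 'v) set" and K e where "ibasis V I K e" using interval_decomposition by blast
  then have "\<exists>m. is_barcode V m" by (rule ibasis.barcode_exists)
  then have "is_barcode V (barcode V)" unfolding barcode_def by (rule someI_ex)
  then show ?thesis by (rule barcode_ibasis)
qed

section \<open>Matchings and linear systems\<close>

text \<open>Rado's proof: in a minimal family with Hall's condition all sets are singletons. The family is
  encoded by the set \<open>R\<close> of removed pairs, so that minimal families become maximal \<open>R\<close>.\<close>

lemma marriage:
  assumes fin: "\<And>i. i \<in> A \<Longrightarrow> finite (S i)"
    and hall: "\<And>X. finite X \<Longrightarrow> X \<subseteq> A \<Longrightarrow> card X \<le> card (\<Union>i\<in>X. S i)"
  shows "\<exists>f. inj_on f A \<and> (\<forall>i\<in>A. f i \<in> S i)"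
proof -
  let ?S = "Sigma A S"
  define good where "good R \<longleftrightarrow> (\<forall>X. finite X \<longrightarrow> X \<subseteq> A \<longrightarrow> card X \<le> card ((?S - R) `` X))" for R
  have im_fin: "finite ((?S - R) `` X)" if "finite X" "X \<subseteq> A" for R X
  proof -
    have "(?S - R) `` X \<subseteq> (\<Union>i\<in>X. S i)" using that by auto
    then show ?thesis using that fin by (meson finite_UN_I finite_subset subsetD)
  qed
  have "\<exists>M\<in>Collect good. \<forall>X\<in>Collect good. M \<subseteq> X \<longrightarrow> X = M"
  proof (rule subset_Zorn')
    fix C assume C: "subset.chain (Collect good) C"
    show "\<Union>C \<in> Collect good"
    proof (cases "C = {}")
      case True
      have "?S `` X = (\<Union>i\<in>X. S i)" if "X \<subseteq> A" for X using that by auto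
      then show ?thesis using True hall by (simp add: good_def)
    next
      case False
      have "card X \<le> card ((?S - \<Union>C) `` X)" if X: "finite X" "X \<subseteq> A" for X
      proof -
        \<comment> \<open>Hall's condition for one \<open>X\<close> involves finitely many pairs, so
          those removed by \<open>\<Union>C\<close> are already removed by one member of the
          chain.\<close>
        have "finite (Sigma X S)" using X fin by (intro finite_SigmaI) auto
        then obtain R where R: "R \<in> C" "Sigma X S \<inter> \<Union>C \<subseteq> R"
          using finite_subset_Union_chain[of "Sigma X S \<inter> \<Union>C" C "Collect good"] False C by auto
        have "(?S - \<Union>C) `` X = (?S - R) `` X" using R X by auto
        moreover have "good R" using R C by (auto simp: subset.chain_def)
        ultimately show ?thesis using X by (simp add: good_def)
      qed
      then show ?thesis by (simp add: good_def)
    qed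
  qed
  then obtain R where R: "good R" and max: "\<And>R'. good R' \<Longrightarrow> R \<subseteq> R' \<Longrightarrow> R' = R" by auto
  define E where "E = ?S - R"
  have E: "card X \<le> card (E `` X)" if "finite X" "X \<subseteq> A" for X
    using R that unfolding good_def E_def by blast
  have Efin: "finite (E `` X)" if "finite X" "X \<subseteq> A" for X
    using im_fin that unfolding E_def by blast
  \<comment> \<open>By maximality, removing one more pair violates Hall's condition for some set.
    That set contains \<open>i\<close>, since otherwise the removal would not affect it; the claim
    is about the rest of it.\<close>
  have deficient: "\<exists>X. finite X \<and> X \<subseteq> A \<and> i \<notin> X \<and> card (E `` X \<union> (E `` {i} - {x})) \<le> card X"
    if ix: "(i, x) \<in> E" for i x
  proof -
    have "insert (i, x) R \<noteq> R" using ix by (auto simp: E_def)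
    then have "\<not> good (insert (i, x) R)" using max by blast
    then obtain X where X: "finite X" "X \<subseteq> A" "card ((?S - insert (i, x) R) `` X) < card X"
      unfolding good_def by (auto simp: not_le)
    have eq: "?S - insert (i, x) R = E - {(i, x)}" by (auto simp: E_def)
    have "i \<in> X"
    proof (rule ccontr)
      assume "i \<notin> X"
      then have "(E - {(i, x)}) `` X = E `` X" by auto
      then show False using X E[of X] eq by simp
    qed
    then have "(E - {(i, x)}) `` X = E `` (X - {i}) \<union> (E `` {i} - {x})" by auto
    moreover have "card X = Suc (card (X - {i}))" using X \<open>i \<in> X\<close> by (simp add: card_Suc_Diff1)
    ultimately have "card (E `` (X - {i}) \<union> (E `` {i} - {x})) \<le> card (X - {i})"
      using X eq by simp
    then show ?thesis using X by (intro exI[of _ "X - {i}"]) auto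
  qed
  have unique: "x = y" if xy: "(i, x) \<in> E" "(i, y) \<in> E" for i x y
  proof (rule ccontr)
    assume ne: "x \<noteq> y"
    obtain X where X: "finite X" "X \<subseteq> A" "i \<notin> X" "card (E `` X \<union> (E `` {i} - {x})) \<le> card X"
      using deficient[OF xy(1)] by blast
    obtain Y where Y: "finite Y" "Y \<subseteq> A" "i \<notin> Y" "card (E `` Y \<union> (E `` {i} - {y})) \<le> card Y"
      using deficient[OF xy(2)] by blast
    let ?P = "E `` X \<union> (E `` {i} - {x})" and ?Q = "E `` Y \<union> (E `` {i} - {y})"
    have i: "i \<in> A" using xy by (auto simp: E_def)
    have fin': "finite ?P" "finite ?Q" using Efin[of X] Efin[of Y] Efin[of "{i}"] X Y i by auto
    \<comment> \<open>Since \<open>x \<noteq> y\<close>, the set \<open>?P \<union> ?Q\<close>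
      contains all neighbours of \<open>insert i (X \<union> Y)\<close>, and
      \<open>?P \<inter> ?Q\<close> contains those of \<open>X \<inter> Y\<close>. Adding the two
      Hall inequalities gives \<open>card X + card Y + 1 \<le> card ?P + card ?Q\<close>, one more
      than deficiency permits.\<close>
    have "card (insert i (X \<union> Y)) \<le> card (E `` (insert i (X \<union> Y)))"
      using X Y i by (intro E) auto
    also have "\<dots> \<le> card (?P \<union> ?Q)"
      using fin' ne by (intro card_mono) auto
    finally have 1: "Suc (card (X \<union> Y)) \<le> card (?P \<union> ?Q)" using X Y by simp
    have "card (X \<inter> Y) \<le> card (E `` (X \<inter> Y))" using X Y by (intro E) auto
    also have "\<dots> \<le> card (?P \<inter> ?Q)" using fin' by (intro card_mono) auto
    finally have 2: "card (X \<inter> Y) \<le> card (?P \<inter> ?Q)" .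
    show False
      using 1 2 card_Un_Int[OF fin'] card_Un_Int[OF X(1) Y(1)] X(4) Y(4) by linarith
  qed
  have "\<exists>x. (i, x) \<in> E" if "i \<in> A" for i
  proof (rule ccontr)
    assume "\<not> ?thesis"
    then have "E `` {i} = {}" by blast
    then show False using E[of "{i}"] that by simp
  qed
  then obtain f where f: "\<And>i. i \<in> A \<Longrightarrow> (i, f i) \<in> E" by metis
  have "inj_on f A"
  proof (rule inj_onI, rule ccontr)
    fix i j assume ij: "i \<in> A" "j \<in> A" "f i = f j" "i \<noteq> j"
    then have "(i, x) \<in> E \<longleftrightarrow> x = f i" "(j, x) \<in> E \<longleftrightarrow> x = f i" for x
      using f[OF ij(1)] f[OF ij(2)] unique[of i x "f i"] unique[of j x "f i"] by auto
    then have "E `` {i, j} = {f i}" by blast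
    then show False using E[of "{i, j}"] ij by simp
  qed
  moreover have "f i \<in> S i" if "i \<in> A" for i using f[OF that] by (auto simp: E_def)
  ultimately show ?thesis by blast
qed

text \<open>As in the Cantor--Bernstein theorem, \<open>f\<close> is used on the alternating paths that start outside
  the range of \<open>g\<close>, and \<open>g\<close> elsewhere.\<close>

lemma combine_matchings:
  assumes f: "inj_on f A" and g: "inj_on g B"
  shows "\<exists>M. M \<subseteq> {(a, f a) |a. a \<in> A} \<union> {(g b, b) |b. b \<in> B} \<and>
    (\<forall>i j j'. (i, j) \<in> M \<longrightarrow> (i, j') \<in> M \<longrightarrow> j = j') \<and>
    (\<forall>i i' j. (i, j) \<in> M \<longrightarrow> (i', j) \<in> M \<longrightarrow> i = i') \<and>
    A \<subseteq> Domain M \<and> B \<subseteq> Range M"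
proof -
  define F where "F X = (A - g ` B) \<union> {a \<in> A. \<exists>x\<in>X. f x \<in> B \<and> a = g (f x)}" for X
  define X where "X = lfp F"
  have "mono F" by (rule monoI) (auto simp: F_def)
  then have "X = (A - g ` B) \<union> {a \<in> A. \<exists>x\<in>X. f x \<in> B \<and> a = g (f x)}"
    using lfp_unfold[of F] unfolding X_def F_def by blast
  from eqset_imp_iff[OF this]
  have X: "a \<in> X \<longleftrightarrow> a \<in> A \<and> (a \<in> g ` B \<longrightarrow> (\<exists>x\<in>X. f x \<in> B \<and> a = g (f x)))" for a
    by blast
  have XA: "X \<subseteq> A" using X by blast
  \<comment> \<open>The two halves of \<open>M\<close> never share a first coordinate: a point of
    \<open>X\<close> in the range of \<open>g\<close> was reached through some \<open>f x'\<close>,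
    which must be \<open>y\<close> because \<open>g\<close> is injective.\<close>
  have cross: False if xy: "x \<in> X" "y \<in> B" "y \<notin> f ` X" "x = g y" for x y
  proof -
    obtain x' where x': "x' \<in> X" "f x' \<in> B" "g (f x') = g y" using X[of x] xy by auto
    then have "f x' = y" using inj_onD[OF g] xy(2) by blast
    then show False using x'(1) xy(3) by blast
  qed
  define M where "M = {(x, f x) |x. x \<in> X} \<union> {(g y, y) |y. y \<in> B \<and> y \<notin> f ` X}"
  have "M \<subseteq> {(a, f a) |a. a \<in> A} \<union> {(g b, b) |b. b \<in> B}" using XA by (auto simp: M_def)
  moreover have "\<forall>i j j'. (i, j) \<in> M \<longrightarrow> (i, j') \<in> M \<longrightarrow> j = j'"
    using cross inj_onD[OF g] unfolding M_def by blast
  moreover have "\<forall>i i' j. (i, j) \<in> M \<longrightarrow> (i', j) \<in> M \<longrightarrow> i = i'"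
    using inj_onD[OF f] XA unfolding M_def by blast
  moreover have "A \<subseteq> Domain M"
  proof
    fix a assume a: "a \<in> A"
    show "a \<in> Domain M"
    proof (cases "a \<in> X")
      case True
      then show ?thesis by (auto simp: M_def)
    next
      case False
      then obtain y where y: "y \<in> B" "a = g y" using a X[of a] by blast
      have "y \<notin> f ` X" using False X[of a] a y by blast
      then show ?thesis using y by (auto simp: M_def)
    qed
  qed
  moreover have "B \<subseteq> Range M"
  proof
    fix y assume "y \<in> B"
    then have "(g y, y) \<in> M \<or> (\<exists>x. y = f x \<and> (x, f x) \<in> M)" unfolding M_def by blast
    then show "y \<in> Range M" by blast
  qed
  ultimately show ?thesis by (intro exI[of _ M]) simp
qed

text \<open>Gaussian elimination: if equation \<open>k\<close> has a nonzero coefficient at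
  \<open>p\<close>, it is solved for the unknown at \<open>p\<close>, which removes one equation and
  one unknown.\<close>

lemma homogeneous_system_nontrivial:
  fixes a :: "'i \<Rightarrow> 'j \<Rightarrow> 'f::field"
  assumes "finite B" "finite A" "card B < card A"
  shows "\<exists>x. (\<exists>i\<in>A. x i \<noteq> 0) \<and> (\<forall>j\<in>B. (\<Sum>i\<in>A. x i * a i j) = 0)"
  using assms
proof (induction B arbitrary: A a rule: finite_induct)
  case empty
  then obtain i where "i \<in> A" by fastforce
  then show ?case by (intro exI[of _ "\<lambda>_. 1"]) auto
next
  case (insert k B)
  show ?case
  proof (cases "\<forall>i\<in>A. a i k = 0")
    case True
    have "card B < card A" using insert by simp
    from insert.IH[OF insert.prems(1) this, of a] obtain x
      where "\<exists>i\<in>A. x i \<noteq> 0" "\<forall>j\<in>B. (\<Sum>i\<in>A. x i * a i j) = 0" by blast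
    then show ?thesis using True by (intro exI[of _ x]) auto
  next
    case False
    then obtain p where p: "p \<in> A" "a p k \<noteq> 0" by blast
    let ?A = "A - {p}"
    have "card B < card ?A" "finite ?A" using insert p by auto
    from insert.IH[OF this(2,1), of "\<lambda>i j. a i j - a i k / a p k * a p j"]
    obtain x where x: "\<exists>i\<in>?A. x i \<noteq> 0"
      "\<forall>j\<in>B. (\<Sum>i\<in>?A. x i * (a i j - a i k / a p k * a p j)) = 0" by blast
    define y where "y = x(p := - (\<Sum>i\<in>?A. x i * a i k) / a p k)"
    have sum_y: "(\<Sum>i\<in>A. y i * a i j) = y p * a p j + (\<Sum>i\<in>?A. x i * a i j)" for j
      using insert.prems p by (simp add: sum.remove y_def)
    have "(\<Sum>i\<in>A. y i * a i j) = 0" if "j \<in> insert k B" for j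
    proof (cases "j = k")
      case True
      then show ?thesis using p sum_y[of k] by (simp add: y_def)
    next
      case False
      then have "(\<Sum>i\<in>?A. x i * (a i j - a i k / a p k * a p j)) = 0" using x(2) that by blast
      moreover have "(\<Sum>i\<in>?A. x i * (a i j - a i k / a p k * a p j))
          = (\<Sum>i\<in>?A. x i * a i j) - (\<Sum>i\<in>?A. x i * a i k) / a p k * a p j"
        by (simp add: right_diff_distrib sum_subtractf sum_distrib_right sum_divide_distrib mult.assoc)
      ultimately show ?thesis using sum_y[of j] by (simp add: y_def)
    qed
    then show ?thesis using x(1) by (intro exI[of _ y]) (auto simp: y_def)
  qed
qed

section \<open>Algebraic stability\<close>

abbreviation lo :: "real set \<Rightarrow> ereal" where "lo S \<equiv> Inf (ereal ` S)"
abbreviation hi :: "real set \<Rightarrow> ereal" where "hi S \<equiv> Sup (ereal ` S)"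

lemma lo_le: "t \<in> S \<Longrightarrow> lo S \<le> ereal t"
  by (simp add: Inf_lower)

lemma hi_ge: "t \<in> S \<Longrightarrow> ereal t \<le> hi S"
  by (simp add: Sup_upper)

lemma lo_neq_infinity: "S \<noteq> {} \<Longrightarrow> lo S \<noteq> \<infinity>"
  using lo_le by fastforce

lemma hi_neq_minus_infinity: "S \<noteq> {} \<Longrightarrow> hi S \<noteq> -\<infinity>"
  using hi_ge by fastforce

lemma between_lo_hi:
  assumes S: "is_interval S" and t: "lo S < ereal t" "ereal t < hi S"
  shows "t \<in> S"
proof -
  obtain a where "a \<in> S" "a < t" using t(1) by (auto simp: Inf_less_iff)
  moreover obtain b where "b \<in> S" "t < b" using t(2) by (auto simp: less_Sup_iff)
  ultimately show ?thesis using mem_is_interval_1_I[OF S, of a b t] by simp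
qed

text \<open>In this form without differences, equal infinite endpoints need no exception.\<close>

lemma ediff_le_iff:
  assumes "0 \<le> \<epsilon>"
  shows "ediff x y \<le> ereal \<epsilon> \<longleftrightarrow> x \<le> y + ereal \<epsilon> \<and> y \<le> x + ereal \<epsilon>"
  using assms by (cases x; cases y) (auto simp: ediff_def)

definition close_bars :: "real \<Rightarrow> real set \<Rightarrow> real set \<Rightarrow> bool" where
  "close_bars \<epsilon> S T \<longleftrightarrow> ediff (lo S) (lo T) \<le> ereal \<epsilon> \<and> ediff (hi S) (hi T) \<le> ereal \<epsilon>"

definition long_bar :: "real \<Rightarrow> real set \<Rightarrow> bool" where
  "long_bar \<epsilon> S \<longleftrightarrow> lo S + ereal (2 * \<epsilon>) < hi S"

lemma close_bars_iff:
  assumes "0 \<le> \<epsilon>"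
  shows "close_bars \<epsilon> S T \<longleftrightarrow> lo S \<le> lo T + ereal \<epsilon> \<and> lo T \<le> lo S + ereal \<epsilon> \<and>
    hi S \<le> hi T + ereal \<epsilon> \<and> hi T \<le> hi S + ereal \<epsilon>"
  using ediff_le_iff[OF assms] by (auto simp: close_bars_def)

lemma close_bars_sym: "0 \<le> \<epsilon> \<Longrightarrow> close_bars \<epsilon> S T \<longleftrightarrow> close_bars \<epsilon> T S"
  by (auto simp: close_bars_iff)

lemma long_bar_nondegenerate: "0 \<le> \<epsilon> \<Longrightarrow> long_bar \<epsilon> S \<Longrightarrow> lo S < hi S"
  unfolding long_bar_def by (cases "lo S"; cases "hi S") auto

text \<open>Cutting \<epsilon> off both ends of a bar longer than 2\<epsilon> leaves a nonempty open
  core, and the endpoints of every close bar lie on either side of it. A point of the core thus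
  belongs to all close bars at once, which will make their number finite.\<close>

lemma close_long_bar:
  assumes "0 \<le> \<epsilon>" "close_bars \<epsilon> S T" "long_bar \<epsilon> S"
  shows "\<exists>t. lo S + ereal \<epsilon> < ereal t \<and> ereal t + ereal \<epsilon> < hi S" "lo T < hi T"
proof -
  obtain x where x: "lo S + ereal (2 * \<epsilon>) < ereal x" "ereal x < hi S"
    using assms(3) ereal_dense2 unfolding long_bar_def by blast
  have x': "lo S + ereal \<epsilon> < ereal (x - \<epsilon>)" "ereal (x - \<epsilon>) + ereal \<epsilon> < hi S"
    using x by (cases "lo S"; cases "hi S"; simp)+
  then show "\<exists>t. lo S + ereal \<epsilon> < ereal t \<and> ereal t + ereal \<epsilon> < hi S" by blast
  have "lo T < ereal (x - \<epsilon>)" "ereal (x - \<epsilon>) + ereal \<epsilon> < hi T + ereal \<epsilon>"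
    using x' assms(2) unfolding close_bars_iff[OF assms(1)] by (auto intro: le_less_trans less_le_trans)
  then show "lo T < hi T" by (cases "lo T"; cases "hi T") auto
qed

text \<open>Sums of endpoints order the bars only if the endpoints are finite. \<open>bar_type\<close> records which ones
  are infinite, in such a way that it can only drop along a nonzero map of interval modules.\<close>

definition bar_type :: "ereal \<Rightarrow> ereal \<Rightarrow> nat" where
  "bar_type b d = (if b = -\<infinity> then 0 else 1) + (if d = \<infinity> then 1 else 0)"

text \<open>\<open>real_of_ereal\<close> sends infinite endpoints to \<open>0\<close>, so for
  nonempty bars of type \<open>0\<close> or \<open>2\<close> the sum compares the one finite
  endpoint. Type \<open>1\<close> contains the bounded bars and the full line; no nonzero map joins
  these two kinds, in either direction, so comparing their sums does no harm.\<close>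

definition bar_less :: "real set \<Rightarrow> real set \<Rightarrow> bool" where
  "bar_less S T \<longleftrightarrow> bar_type (lo S) (hi S) < bar_type (lo T) (hi T) \<or>
     bar_type (lo S) (hi S) = bar_type (lo T) (hi T) \<and>
     real_of_ereal (lo S) + real_of_ereal (hi S) < real_of_ereal (lo T) + real_of_ereal (hi T)"

lemma bar_less_trans: "bar_less R S \<Longrightarrow> bar_less S T \<Longrightarrow> bar_less R T"
  unfolding bar_less_def by auto

lemma bar_less_maximal:
  assumes "finite A" "A \<noteq> {}"
  shows "\<exists>m\<in>A. \<forall>i\<in>A. \<not> bar_less (K m) (K i)"
proof -
  define \<tau> where "\<tau> i = bar_type (lo (K i)) (hi (K i))" for i
  define \<sigma> where "\<sigma> i = real_of_ereal (lo (K i)) + real_of_ereal (hi (K i))" for i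
  have "Max (\<tau> ` A) \<in> \<tau> ` A" using assms by simp
  then have ne: "{i \<in> A. \<tau> i = Max (\<tau> ` A)} \<noteq> {}" (is "?B \<noteq> {}") by auto
  have "Max (\<sigma> ` ?B) \<in> \<sigma> ` ?B" using assms ne by (intro Max_in) auto
  then obtain m where m: "m \<in> ?B" "\<sigma> m = Max (\<sigma> ` ?B)" by auto
  have "\<not> bar_less (K m) (K i)" if i: "i \<in> A" for i
  proof
    assume "bar_less (K m) (K i)"
    then have *: "\<tau> m < \<tau> i \<or> \<tau> m = \<tau> i \<and> \<sigma> m < \<sigma> i" by (simp add: bar_less_def \<tau>_def \<sigma>_def)
    have "\<tau> i \<le> \<tau> m" using m i assms by simp
    then have "\<tau> i = \<tau> m" "\<sigma> m < \<sigma> i" using * by auto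
    moreover have "\<sigma> i \<le> Max (\<sigma> ` ?B)"
      using i m \<open>\<tau> i = \<tau> m\<close> assms by (intro Max_ge) auto
    ultimately show False using m by simp
  qed
  then show ?thesis using m by blast
qed

text \<open>If the bars are not close, one endpoint of \<open>T\<close> lies more than \<epsilon>
  below that of \<open>S\<close>, while the other is at most \<epsilon> above. So the sum drops if
  the endpoints concerned are finite, and the type drops if a finite endpoint is replaced by an
  infinite one or conversely.\<close>

lemma close_or_bar_less:
  assumes "0 \<le> \<epsilon>" "S \<noteq> {}" "T \<noteq> {}" "lo T \<le> lo S + ereal \<epsilon>" "hi T \<le> hi S + ereal \<epsilon>"
  shows "close_bars \<epsilon> S T \<or> bar_less T S"
  using assms(4,5) lo_neq_infinity[OF assms(2)] lo_neq_infinity[OF assms(3)]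
    hi_neq_minus_infinity[OF assms(2)] hi_neq_minus_infinity[OF assms(3)]
  unfolding close_bars_iff[OF assms(1)] bar_less_def bar_type_def
  by (cases "lo S"; cases "lo T"; cases "hi S"; cases "hi T") auto

text \<open>For finite endpoints: if \<open>hi T\<close> were at most
  \<open>lo S + 2\<epsilon>\<close>, then, both bars being long, both endpoints of \<open>T\<close>
  would be smaller than those of \<open>S\<close>, against the order. The strict inequality leaves
  room for a structure map of length 2\<epsilon> from a point of \<open>S\<close> to a point of
  \<open>T\<close>.\<close>

lemma bar_overlap:
  assumes "long_bar \<epsilon> S" "long_bar \<epsilon> T" "\<not> bar_less T S" "0 \<le> \<epsilon>" "S \<noteq> {}" "T \<noteq> {}"
    and "lo T \<le> lo S + ereal (2 * \<epsilon>)" "hi T \<le> hi S + ereal (2 * \<epsilon>)"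
  shows "lo S + ereal (2 * \<epsilon>) < hi T"
  using assms(1-4,7,8) lo_neq_infinity[OF assms(5)] lo_neq_infinity[OF assms(6)]
    hi_neq_minus_infinity[OF assms(5)] hi_neq_minus_infinity[OF assms(6)]
  unfolding long_bar_def bar_less_def bar_type_def
  by (cases "lo S"; cases "lo T"; cases "hi S"; cases "hi T") auto

section \<open>The matrix of an interleaving\<close>

locale interleaved = U: ibasis U I K e + V: ibasis V J L f
  for U :: "('f::field, 'u::ab_group_add) pmodule" and I :: "'i set" and K e
    and V :: "('f, 'v::ab_group_add) pmodule" and J :: "'j set" and L f +
  fixes \<epsilon> \<phi> \<psi>
  assumes eps: "0 \<le> \<epsilon>" and interleaving: "interleaving \<epsilon> U V \<phi> \<psi>"
begin

lemma swap: "interleaved V J L f U I K e \<epsilon> \<psi> \<phi>"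
  using interleaving eps by unfold_locales (auto simp: interleaving_def)

lemma phi_linear: "linear_between (vscale U) (vspace U t) (vscale V) (vspace V (t + \<epsilon>)) (\<phi> t)"
  using interleaving by (simp add: interleaving_def morphism_def shift_def)

lemma psi_linear: "linear_between (vscale V) (vspace V t) (vscale U) (vspace U (t + \<epsilon>)) (\<psi> t)"
  using interleaving by (simp add: interleaving_def morphism_def shift_def)

lemma phi_in: "x \<in> vspace U t \<Longrightarrow> \<phi> t x \<in> vspace V (t + \<epsilon>)"
  using phi_linear unfolding linear_between_def by blast

lemma phi_natural: "s \<le> t \<Longrightarrow> x \<in> vspace U s \<Longrightarrow> \<phi> t (vmap U s t x) = vmap V (s + \<epsilon>) (t + \<epsilon>) (\<phi> s x)"
  using interleaving by (simp add: interleaving_def morphism_def shift_def)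

lemma psi_phi: "x \<in> vspace U t \<Longrightarrow> \<psi> (t + \<epsilon>) (\<phi> t x) = vmap U t (t + 2 * \<epsilon>) x"
  using interleaving by (simp add: interleaving_def)

definition entry_at :: "real \<Rightarrow> 'j \<Rightarrow> 'i \<Rightarrow> 'f" where
  "entry_at t j i = V.coord (t + \<epsilon>) (\<phi> t (e i t)) j"

text \<open>\<open>entry_at t j i\<close> does not depend on \<open>t\<close> where it can be nonzero, so the choice is immaterial.\<close>

definition entry :: "'j \<Rightarrow> 'i \<Rightarrow> 'f" where
  "entry j i = (if \<exists>t. entry_at t j i \<noteq> 0 then entry_at (SOME t. entry_at t j i \<noteq> 0) j i else 0)"

context
  fixes i j assumes i: "i \<in> I" and j: "j \<in> J"
begin

text \<open>The image of \<open>e i t\<close> is pushed forward from \<open>s\<close>, and by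
  \<open>coord_vmap\<close> this keeps the coordinate \<open>j\<close> if
  \<open>t + \<epsilon>\<close> is in \<open>L j\<close> and kills it otherwise.\<close>

lemma entry_at_later:
  assumes "s \<in> K i" "s \<le> t"
  shows "entry_at t j i = (if t + \<epsilon> \<in> L j then entry_at s j i else 0)"
proof -
  have "\<phi> t (e i t) = vmap V (s + \<epsilon>) (t + \<epsilon>) (\<phi> s (e i s))"
    using phi_natural[OF assms(2) U.e_in[OF i]] U.e_map[OF i assms] by simp
  then show ?thesis
    using V.coord_vmap[OF _ phi_in[OF U.e_in[OF i]], of s "t + \<epsilon>"] assms by (simp add: entry_at_def)
qed

lemma entry_at_nonzero:
  assumes "entry_at t j i \<noteq> 0"
  shows "t \<in> K i" "t + \<epsilon> \<in> L j"
proof -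
  show "t \<in> K i"
    using assms U.e_out[OF i, of t] linear_between_zero[OF phi_linear U.vspace_closed(1)]
    unfolding entry_at_def by (metis V.coord_zero)
  show "t + \<epsilon> \<in> L j"
    using assms V.coord_out unfolding entry_at_def by fastforce
qed

lemma entry_at_eq:
  assumes "t \<in> K i" "t + \<epsilon> \<in> L j"
  shows "entry_at t j i = entry j i"
proof (cases "\<exists>t. entry_at t j i \<noteq> 0")
  case True
  define s where "s = (SOME t. entry_at t j i \<noteq> 0)"
  have "entry_at s j i \<noteq> 0" unfolding s_def using True by (rule someI_ex)
  then have "s \<in> K i" "s + \<epsilon> \<in> L j" by (rule entry_at_nonzero)+
  then have "entry_at t j i = entry_at s j i"
    using entry_at_later[of s t] entry_at_later[of t s] assms by (cases "s \<le> t") auto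
  then show ?thesis using True by (simp add: entry_def s_def)
qed (auto simp: entry_def)

text \<open>By naturality, a nonzero entry at \<open>t\<close> spreads to all earlier points of
  \<open>K i\<close> and, shifted by \<epsilon>, to all later points of \<open>L j\<close>. The
  first gives the bound on the infima, the second the one on the suprema.\<close>

lemma entry_nonzero:
  assumes "entry j i \<noteq> 0"
  shows "lo (L j) \<le> lo (K i) + ereal \<epsilon>" "hi (L j) \<le> hi (K i) + ereal \<epsilon>"
proof -
  obtain t where t: "entry_at t j i \<noteq> 0" using assms unfolding entry_def by metis
  note tK = entry_at_nonzero[OF t]
  have "lo (L j) - ereal \<epsilon> \<le> lo (K i)"
  proof (rule Inf_greatest)
    fix x assume "x \<in> ereal ` K i"
    then obtain s where s: "s \<in> K i" "x = ereal s" by blast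
    have "lo (L j) \<le> ereal (s + \<epsilon>)"
    proof (cases "s \<le> t")
      case True
      then have "entry_at s j i \<noteq> 0" using entry_at_later[OF s(1) True] t by metis
      then show ?thesis using entry_at_nonzero(2) lo_le by blast
    next
      case False
      then show ?thesis using lo_le[OF tK(2)] by (auto elim: order_trans)
    qed
    then show "lo (L j) - ereal \<epsilon> \<le> x" using s by (cases "lo (L j)") auto
  qed
  then show "lo (L j) \<le> lo (K i) + ereal \<epsilon>" by (cases "lo (L j)"; cases "lo (K i)") auto
  show "hi (L j) \<le> hi (K i) + ereal \<epsilon>"
  proof (rule Sup_least)
    fix x assume "x \<in> ereal ` L j"
    then obtain y where y: "y \<in> L j" "x = ereal y" by blast
    have "ereal (y - \<epsilon>) \<le> hi (K i)"
    proof (cases "t \<le> y - \<epsilon>")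
      case True
      then have "entry_at (y - \<epsilon>) j i \<noteq> 0" using entry_at_later[OF tK(1) True] t y by simp
      then show ?thesis using entry_at_nonzero(1) hi_ge by blast
    next
      case False
      then show ?thesis using hi_ge[OF tK(1)] by (auto elim: order_trans[rotated])
    qed
    then show "x \<le> hi (K i) + ereal \<epsilon>" using y by (cases "hi (K i)") auto
  qed
qed

end

context
begin

interpretation sw: interleaved V J L f U I K e \<epsilon> \<psi> \<phi>
  by (rule swap)

text \<open>This is \<open>psi_phi\<close> at \<open>e i t\<close>, read at coordinate
  \<open>i'\<close>, which the structure map preserves because \<open>t + 2 * \<epsilon>\<close>
  lies in \<open>K i'\<close>.\<close>

lemma entries_composite:
  assumes i: "i \<in> I" "i' \<in> I" and t: "t \<in> K i" "t + 2 * \<epsilon> \<in> K i'"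
  shows "(\<Sum>j\<in>V.active (t + \<epsilon>). sw.entry i' j * entry j i) = (if i' = i then 1 else 0)"
proof -
  have tt: "t + \<epsilon> + \<epsilon> = t + 2 * \<epsilon>" by simp
  let ?y = "\<phi> t (e i t)"
  have y: "?y \<in> vspace V (t + \<epsilon>)" using phi_in U.e_in i by blast
  have psi: "\<psi> (t + \<epsilon>) ?y = (\<Sum>j\<in>V.active (t + \<epsilon>). vscale U (entry_at t j i) (\<psi> (t + \<epsilon>) (f j (t + \<epsilon>))))"
    using V.linear_on_basis[OF psi_linear y] by (simp add: entry_at_def)
  have coord_sum: "U.coord (t + 2 * \<epsilon>) (\<Sum>j\<in>S. vscale U (c j) (z j)) i'
      = (\<Sum>j\<in>S. c j * U.coord (t + 2 * \<epsilon>) (z j) i')"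
    if "finite S" "\<And>j. j \<in> S \<Longrightarrow> z j \<in> vspace U (t + 2 * \<epsilon>)" for S c and z :: "'j \<Rightarrow> 'u"
    using that
  proof (induction S rule: finite_induct)
    case (insert j S)
    then have "vscale U (c j) (z j) \<in> vspace U (t + 2 * \<epsilon>)"
      "(\<Sum>j\<in>S. vscale U (c j) (z j)) \<in> vspace U (t + 2 * \<epsilon>)"
      by (auto intro: U.vspace_closed U.vspace_sum)
    then show ?case using insert by (simp add: U.coord_add U.coord_scale)
  qed (simp add: U.coord_zero)
  have "U.coord (t + 2 * \<epsilon>) (\<psi> (t + \<epsilon>) ?y) i'
      = (\<Sum>j\<in>V.active (t + \<epsilon>). entry_at t j i * sw.entry_at (t + \<epsilon>) i' j)"
    unfolding psi using sw.phi_in[OF V.e_in, of _ "t + \<epsilon>"] V.finite_active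
    by (subst coord_sum) (auto simp: sw.entry_at_def tt)
  also have "\<dots> = (\<Sum>j\<in>V.active (t + \<epsilon>). sw.entry i' j * entry j i)"
    using i t by (intro sum.cong) (auto simp: entry_at_eq sw.entry_at_eq tt)
  finally have "(\<Sum>j\<in>V.active (t + \<epsilon>). sw.entry i' j * entry j i)
      = U.coord (t + 2 * \<epsilon>) (vmap U t (t + 2 * \<epsilon>) (e i t)) i'"
    using psi_phi[OF U.e_in[OF i(1)]] by simp
  also have "\<dots> = U.coord t (e i t) i'"
    using U.coord_vmap[of t "t + 2 * \<epsilon>" "e i t"] U.e_in[OF i(1)] t eps by simp
  also have "\<dots> = (if i' = i then 1 else 0)"
    using U.coord_e[of i t] i t by simp
  finally show ?thesis .
qed

definition close_to :: "'i \<Rightarrow> 'j set" where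
  "close_to i = {j \<in> J. close_bars \<epsilon> (K i) (L j)}"

lemma finite_close_to:
  assumes i: "i \<in> I" and long: "long_bar \<epsilon> (K i)"
  shows "finite (close_to i)"
proof (cases "close_to i = {}")
  case False
  then obtain j0 where "close_bars \<epsilon> (K i) (L j0)" by (auto simp: close_to_def)
  then obtain t where t: "lo (K i) + ereal \<epsilon> < ereal t" "ereal t + ereal \<epsilon> < hi (K i)"
    using close_long_bar(1)[OF eps _ long] by blast
  have "t \<in> L j" if "j \<in> close_to i" for j
  proof (rule between_lo_hi)
    have j: "j \<in> J" "lo (L j) \<le> lo (K i) + ereal \<epsilon>" "hi (K i) \<le> hi (L j) + ereal \<epsilon>"
      using that by (auto simp: close_to_def close_bars_iff[OF eps])
    show "is_interval (L j)" using V.interval j by blast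
    show "lo (L j) < ereal t" using j t by (auto intro: le_less_trans)
    have "ereal t + ereal \<epsilon> < hi (L j) + ereal \<epsilon>" using j t by (auto intro: less_le_trans)
    then show "ereal t < hi (L j)" by (cases "hi (L j)") auto
  qed
  then have "close_to i \<subseteq> V.active t" by (auto simp: close_to_def)
  then show ?thesis by (rule finite_subset[OF _ V.finite_active])
qed simp

text \<open>\<open>N\<close> is any finite set containing the neighbours of both bars, so that one
  \<open>N\<close> serves all pairs from a finite set of bars. The sum over it and the sum in
  \<open>entries_composite\<close> both reduce to the middle bars with a nonzero
  contribution.\<close>

lemma entries_triangular:
  assumes i: "i \<in> I" "i' \<in> I" and long: "long_bar \<epsilon> (K i)" "long_bar \<epsilon> (K i')"
    and le: "\<not> bar_less (K i') (K i)"
    and N: "finite N" "close_to i \<subseteq> N" "close_to i' \<subseteq> N" "N \<subseteq> J"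
  shows "(\<Sum>j\<in>N. sw.entry i' j * entry j i) = (if i' = i then 1 else 0)"
proof -
  let ?Z = "{j \<in> J. sw.entry i' j \<noteq> 0 \<and> entry j i \<noteq> 0}"
  have Z: "lo (L j) \<le> lo (K i) + ereal \<epsilon>" "hi (L j) \<le> hi (K i) + ereal \<epsilon>"
    "lo (K i') \<le> lo (L j) + ereal \<epsilon>" "hi (K i') \<le> hi (L j) + ereal \<epsilon>" if "j \<in> ?Z" for j
    using that i entry_nonzero[of i j] sw.entry_nonzero[of j i'] by auto
  \<comment> \<open>A middle bar close to neither end would satisfy
    \<open>bar_less (K i') (L j)\<close> and \<open>bar_less (L j) (K i)\<close>, against
    \<open>le\<close>.\<close>
  have ZN: "?Z \<subseteq> N"
  proof
    fix j assume j: "j \<in> ?Z"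
    note ne = U.nonempty[OF i(1)] U.nonempty[OF i(2)] V.nonempty[of j]
    have "close_bars \<epsilon> (K i) (L j) \<or> bar_less (L j) (K i)"
      using Z[OF j] ne j by (intro close_or_bar_less[OF eps]) auto
    moreover have "close_bars \<epsilon> (L j) (K i') \<or> bar_less (K i') (L j)"
      using Z[OF j] ne j by (intro close_or_bar_less[OF eps]) auto
    ultimately have "close_bars \<epsilon> (K i) (L j) \<or> close_bars \<epsilon> (K i') (L j)"
      using le bar_less_trans close_bars_sym[OF eps] by blast
    then show "j \<in> N" using N j by (auto simp: close_to_def)
  qed
  have sumN: "(\<Sum>j\<in>N. sw.entry i' j * entry j i) = (\<Sum>j\<in>?Z. sw.entry i' j * entry j i)"
    using N ZN by (intro sum.mono_neutral_right) auto
  \<comment> \<open>Either some \<open>t\<close> in \<open>K i\<close> has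
    \<open>t + 2 * \<epsilon>\<close> in \<open>K i'\<close>, and the coordinate of the structure
    map there is the value sought, or no middle bar contributes at all.\<close>
  show ?thesis
  proof (cases "lo (K i') \<le> lo (K i) + ereal (2 * \<epsilon>) \<and> hi (K i') \<le> hi (K i) + ereal (2 * \<epsilon>)")
    case True
    have "lo (K i) + ereal (2 * \<epsilon>) < hi (K i')"
      using bar_overlap[OF long le eps] U.nonempty i True by blast
    then obtain x where x: "lo (K i) + ereal (2 * \<epsilon>) < ereal x" "ereal x < hi (K i')"
      using ereal_dense2 by blast
    define t where "t = x - 2 * \<epsilon>"
    have "lo (K i) < ereal t" using x(1) by (cases "lo (K i)") (auto simp: t_def)
    moreover have "ereal x < hi (K i) + ereal (2 * \<epsilon>)" using x True by (auto intro: less_le_trans)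
    then have "ereal t < hi (K i)" by (cases "hi (K i)") (auto simp: t_def)
    ultimately have tK: "t \<in> K i" using U.interval[OF i(1)] between_lo_hi by blast
    have "lo (K i') < ereal x" using x True by (auto intro: le_less_trans)
    then have tK': "t + 2 * \<epsilon> \<in> K i'" using x U.interval[OF i(2)] between_lo_hi by (simp add: t_def)
    have "?Z \<subseteq> V.active (t + \<epsilon>)"
    proof
      fix j assume j: "j \<in> ?Z"
      have "lo (L j) < ereal (t + \<epsilon>)"
        using Z(1)[OF j] x(1) by (cases "lo (L j)"; cases "lo (K i)") (auto simp: t_def)
      moreover have "ereal (t + \<epsilon>) < hi (L j)"
        using Z(4)[OF j] x(2) by (cases "hi (L j)"; cases "hi (K i')") (auto simp: t_def)
      ultimately show "j \<in> V.active (t + \<epsilon>)" using j V.interval between_lo_hi by blast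
    qed
    then have "(\<Sum>j\<in>V.active (t + \<epsilon>). sw.entry i' j * entry j i) = (\<Sum>j\<in>?Z. sw.entry i' j * entry j i)"
      using V.finite_active by (intro sum.mono_neutral_right) auto
    then show ?thesis using entries_composite[OF i tK tK'] sumN by simp
  next
    case False
    have "?Z = {}"
    proof (rule ccontr)
      assume "?Z \<noteq> {}"
      then obtain j where j: "j \<in> ?Z" by blast
      have "lo (K i') \<le> lo (K i) + ereal (2 * \<epsilon>)"
        using Z(1,3)[OF j] by (cases "lo (K i)"; cases "lo (L j)"; cases "lo (K i')") auto
      moreover have "hi (K i') \<le> hi (K i) + ereal (2 * \<epsilon>)"
        using Z(2,4)[OF j] by (cases "hi (K i)"; cases "hi (L j)"; cases "hi (K i')") auto
      ultimately show False using False by blast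
    qed
    moreover have "i' \<noteq> i"
    proof
      assume "i' = i"
      then show False using False eps by (cases "lo (K i)"; cases "hi (K i)") auto
    qed
    ultimately show ?thesis using sumN by (simp only: sum.empty if_False)
  qed
qed

text \<open>A relation between the columns of the bars in \<open>A\<close> over a too small set of neighbours is killed
  by \<open>sw.entry m\<close>, where \<open>m\<close> is a maximal bar occurring in it; by triangularity only the
  coefficient of \<open>m\<close> itself survives.\<close>

lemma hall_injection:
  "\<exists>h. inj_on h {i \<in> I. long_bar \<epsilon> (K i)} \<and> (\<forall>i\<in>{i \<in> I. long_bar \<epsilon> (K i)}. h i \<in> close_to i)"
proof (rule marriage)
  show "finite (close_to i)" if "i \<in> {i \<in> I. long_bar \<epsilon> (K i)}" for i
    using finite_close_to that by blast
  fix A assume A: "finite A" "A \<subseteq> {i \<in> I. long_bar \<epsilon> (K i)}"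
  let ?N = "\<Union>i\<in>A. close_to i"
  have N: "finite ?N" "?N \<subseteq> J"
    using A finite_close_to by (auto simp: close_to_def)
  show "card A \<le> card ?N"
  proof (rule ccontr)
    assume "\<not> card A \<le> card ?N"
    then obtain x where x: "\<exists>i\<in>A. x i \<noteq> 0" "\<forall>j\<in>?N. (\<Sum>i\<in>A. x i * entry j i) = 0"
      using homogeneous_system_nontrivial[OF N(1) A(1), of "\<lambda>i j. entry j i"] by auto
    let ?S = "{i \<in> A. x i \<noteq> 0}"
    have "\<exists>m\<in>?S. \<forall>i\<in>?S. \<not> bar_less (K m) (K i)"
      using A x by (intro bar_less_maximal) auto
    then obtain m where m: "m \<in> ?S" "\<And>i. i \<in> ?S \<Longrightarrow> \<not> bar_less (K m) (K i)" by blast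
    have tri: "(\<Sum>j\<in>?N. sw.entry m j * entry j i) = (if m = i then 1 else 0)" if "i \<in> ?S" for i
      using that m A N by (intro entries_triangular) auto
    have "0 = (\<Sum>j\<in>?N. sw.entry m j * (\<Sum>i\<in>A. x i * entry j i))"
      using x(2) by (intro sum.neutral[symmetric] ballI) auto
    also have "\<dots> = (\<Sum>j\<in>?N. sw.entry m j * (\<Sum>i\<in>?S. x i * entry j i))"
      using A by (intro sum.cong refl arg_cong[where f = "(*) _"] sum.mono_neutral_right) auto
    also have "\<dots> = (\<Sum>j\<in>?N. \<Sum>i\<in>?S. x i * (sw.entry m j * entry j i))"
      by (simp add: sum_distrib_left mult.left_commute)
    also have "\<dots> = (\<Sum>i\<in>?S. x i * (\<Sum>j\<in>?N. sw.entry m j * entry j i))"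
      by (subst sum.swap) (simp add: sum_distrib_left)
    also have "\<dots> = (\<Sum>i\<in>?S. if m = i then x i else 0)"
      using tri by (intro sum.cong) auto
    also have "\<dots> = x m" using A m by (simp add: sum.delta)
    finally show False using m by simp
  qed
qed

end

text \<open>Hall's injections from the two sides are merged. Each resulting pair has a long member,
  so that even a short partner is nondegenerate and gives a point of the diagram.\<close>

theorem induces_matching:
  "\<exists>M. M \<subseteq> I \<times> J \<and>
    (\<forall>i j j'. (i, j) \<in> M \<longrightarrow> (i, j') \<in> M \<longrightarrow> j = j') \<and>
    (\<forall>i i' j. (i, j) \<in> M \<longrightarrow> (i', j) \<in> M \<longrightarrow> i = i') \<and>
    {i \<in> I. long_bar \<epsilon> (K i)} \<subseteq> Domain M \<and> {j \<in> J. long_bar \<epsilon> (L j)} \<subseteq> Range M \<and>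
    (\<forall>(i, j)\<in>M. close_bars \<epsilon> (K i) (L j) \<and> lo (K i) < hi (K i) \<and> lo (L j) < hi (L j))"
proof -
  interpret sw: interleaved V J L f U I K e \<epsilon> \<psi> \<phi> by (rule swap)
  let ?A = "{i \<in> I. long_bar \<epsilon> (K i)}" and ?B = "{j \<in> J. long_bar \<epsilon> (L j)}"
  obtain h where h: "inj_on h ?A" "\<forall>i\<in>?A. h i \<in> close_to i" using hall_injection by blast
  obtain k where k: "inj_on k ?B" "\<forall>j\<in>?B. k j \<in> sw.close_to j" using sw.hall_injection by blast
  obtain M where M: "M \<subseteq> {(i, h i) |i. i \<in> ?A} \<union> {(k j, j) |j. j \<in> ?B}"
    "\<forall>i j j'. (i, j) \<in> M \<longrightarrow> (i, j') \<in> M \<longrightarrow> j = j'"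
    "\<forall>i i' j. (i, j) \<in> M \<longrightarrow> (i', j) \<in> M \<longrightarrow> i = i'" "?A \<subseteq> Domain M" "?B \<subseteq> Range M"
    using combine_matchings[OF h(1) k(1)] by (elim exE conjE) (rule that)
  have *: "i \<in> I \<and> j \<in> J \<and> close_bars \<epsilon> (K i) (L j) \<and> lo (K i) < hi (K i) \<and> lo (L j) < hi (L j)"
    if "(i, j) \<in> M" for i j
  proof -
    have "(i \<in> ?A \<and> j \<in> close_to i) \<or> (j \<in> ?B \<and> i \<in> sw.close_to j)" using that M(1) h(2) k(2) by blast
    then show ?thesis
    proof
      assume "i \<in> ?A \<and> j \<in> close_to i"
      then show ?thesis
        using close_long_bar(2)[OF eps, of "K i" "L j"] long_bar_nondegenerate[OF eps, of "K i"]
        by (auto simp: close_to_def)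
    next
      assume "j \<in> ?B \<and> i \<in> sw.close_to j"
      then show ?thesis
        using close_long_bar(2)[OF eps, of "L j" "K i"] long_bar_nondegenerate[OF eps, of "L j"]
        by (auto simp: sw.close_to_def close_bars_sym[OF eps, of "K i"])
    qed
  qed
  then have "M \<subseteq> I \<times> J" by auto
  moreover have "\<forall>(i, j)\<in>M. close_bars \<epsilon> (K i) (L j) \<and> lo (K i) < hi (K i) \<and> lo (L j) < hi (L j)"
    using * by blast
  ultimately show ?thesis using M(2-5) by (intro exI[of _ M] conjI)
qed

end

section \<open>Smoothings\<close>

lemma vspace_smoothing: "vspace (smoothing \<delta> V) t = vmap V (t - \<delta>) (t + \<delta>) ` vspace V (t - \<delta>)"
  by (simp add: smoothing_def)

lemma vmap_smoothing: "vmap (smoothing \<delta> V) s t = vmap V (s + \<delta>) (t + \<delta>)"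
  by (simp add: smoothing_def)

lemma vscale_smoothing [simp]: "vscale (smoothing \<delta> V) = vscale V"
  by (simp add: smoothing_def)

context pmod
begin

lemma vspace_smoothing_im: "vspace (smoothing \<delta> V) t = im (t - \<delta>) (t + \<delta>)"
  by (simp add: vspace_smoothing im_def)

lemma smoothing_in: "0 \<le> \<delta> \<Longrightarrow> x \<in> vspace (smoothing \<delta> V) t \<Longrightarrow> x \<in> vspace V (t + \<delta>)"
  unfolding vspace_smoothing_im using im_subset[of "t - \<delta>" "t + \<delta>"] by auto

lemma persistence_module_smoothing:
  assumes "0 \<le> \<delta>"
  shows "persistence_module (smoothing \<delta> V)"
  unfolding persistence_module_def vscale_smoothing linear_between_def
proof (intro conjI allI impI ballI)
  show "subspace (vspace (smoothing \<delta> V) t)" for t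
    using subspace_im assms by (simp add: vspace_smoothing_im)
  show "vmap (smoothing \<delta> V) s t ` vspace (smoothing \<delta> V) s \<subseteq> vspace (smoothing \<delta> V) t" if "s \<le> t" for s t
  proof
    fix y assume "y \<in> vmap (smoothing \<delta> V) s t ` vspace (smoothing \<delta> V) s"
    then obtain x where x: "x \<in> im (s - \<delta>) (s + \<delta>)" "y = vmap V (s + \<delta>) (t + \<delta>) x"
      unfolding vspace_smoothing_im vmap_smoothing by blast
    then have "y \<in> im (s - \<delta>) (t + \<delta>)" using im_map[of "s - \<delta>" "s + \<delta>" "t + \<delta>" x] that assms by simp
    then show "y \<in> vspace (smoothing \<delta> V) t"
      using im_mono[of "s - \<delta>" "t - \<delta>" "t + \<delta>"] that assms unfolding vspace_smoothing_im by auto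
  qed
  show "vmap (smoothing \<delta> V) t t x = x" if "x \<in> vspace (smoothing \<delta> V) t" for t x
    using smoothing_in[OF assms that] vmap_id by (simp add: vmap_smoothing)
qed (auto simp: vmap_smoothing vector_space_axioms smoothing_in[OF assms] intro: vmap_add vmap_scale vmap_comp)

lemma pfd_smoothing:
  assumes "q_tame V" "0 < \<delta>"
  shows "pfd_pmod (smoothing \<delta> V)"
proof (intro pfd_pmod.intro pmod.intro pfd_pmod_axioms.intro)
  show "persistence_module (smoothing \<delta> V)" using persistence_module_smoothing assms by simp
  fix t
  have "t - \<delta> < t + \<delta>" using assms by simp
  then obtain B where "finite B" "vspace (smoothing \<delta> V) t = span B"
    using assms(1) unfolding q_tame_def vspace_smoothing by blast
  then show "\<exists>B. finite B \<and> vspace (smoothing \<delta> V) t \<subseteq> module.span (vscale (smoothing \<delta> V)) B" by auto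
qed

lemma smoothing_smoothing:
  assumes "0 \<le> \<delta>" "0 \<le> \<eta>"
  shows "smoothing \<eta> (smoothing \<delta> V) = smoothing (\<delta> + \<eta>) V"
proof -
  have "vmap V (t - \<eta> + \<delta>) (t + \<eta> + \<delta>) ` im (t - \<eta> - \<delta>) (t - \<eta> + \<delta>) = im (t - (\<delta> + \<eta>)) (t + (\<delta> + \<eta>))" for t
    unfolding im_def image_image
    by (intro image_cong) (auto simp: algebra_simps assms intro!: trans[OF vmap_comp])
  then show ?thesis
    by (auto simp: smoothing_def im_def fun_eq_iff algebra_simps)
qed

text \<open>The space of the smoothing at \<open>t\<close> is a subspace of
  \<open>vspace V (t + \<delta>)\<close>, so the backward morphism is the inclusion.\<close>

lemma smoothing_interleaving:
  assumes "0 \<le> \<delta>"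
  shows "interleaving \<delta> V (smoothing \<delta> V) (\<lambda>t. vmap V t (t + 2 * \<delta>)) (\<lambda>t x. x)"
proof -
  have [simp]: "t + \<delta> + \<delta> = t + 2 * \<delta>" "t + 2 * \<delta> + \<delta> = t + \<delta> + 2 * \<delta>" for t by simp_all
  have 1: "morphism V (shift \<delta> (smoothing \<delta> V)) (\<lambda>t. vmap V t (t + 2 * \<delta>))"
    unfolding morphism_def linear_between_def
    using assms by (auto simp: shift_def vspace_smoothing vmap_smoothing vmap_add vmap_scale vmap_comp)
  have 2: "morphism (smoothing \<delta> V) (shift \<delta> V) (\<lambda>t x. x)"
    unfolding morphism_def linear_between_def
    using smoothing_in[OF assms] by (auto simp: shift_def vmap_smoothing)
  show ?thesis
    unfolding interleaving_def using 1 2 by (simp add: vmap_smoothing)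
qed

end

section \<open>Composition of interleavings\<close>

lemma interleaving_sym: "interleaving \<epsilon> U V \<phi> \<psi> \<Longrightarrow> interleaving \<epsilon> V U \<psi> \<phi>"
  by (simp add: interleaving_def)

lemma interleaving_composite:
  assumes U: "pmod U" and a: "0 \<le> a" and b: "0 \<le> b"
    and UV: "interleaving a U V \<phi> \<psi>" and VW: "interleaving b V W \<phi>' \<psi>'" and x: "x \<in> vspace U t"
  shows "\<psi> (t + (a + b) + b) (\<psi>' (t + (a + b)) (\<phi>' (t + a) (\<phi> t x))) = vmap U t (t + 2 * (a + b)) x"
proof -
  interpret U: pmod U by fact
  have y: "\<phi> t x \<in> vspace V (t + a)"
    using UV x unfolding interleaving_def morphism_def linear_between_def by (simp add: shift_def image_subset_iff)
  have "\<psi>' (t + (a + b)) (\<phi>' (t + a) (\<phi> t x)) = vmap V (t + a) (t + a + 2 * b) (\<phi> t x)"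
    using VW y unfolding interleaving_def by (metis add.assoc)
  also have "\<psi> (t + a + 2 * b) \<dots> = vmap U (t + a + a) (t + a + 2 * b + a) (\<psi> (t + a) (\<phi> t x))"
    using UV y b unfolding interleaving_def morphism_def by (simp add: shift_def)
  also have "\<psi> (t + a) (\<phi> t x) = vmap U t (t + 2 * a) x"
    using UV x unfolding interleaving_def by blast
  also have "vmap U (t + a + a) (t + a + 2 * b + a) \<dots> = vmap U t (t + 2 * (a + b)) x"
    using U.vmap_comp[of t "t + 2 * a" "t + 2 * (a + b)" x] a b x by (simp add: algebra_simps)
  finally show ?thesis by (simp add: algebra_simps)
qed

lemma morphism_composite:
  assumes f: "morphism U (shift a V) \<phi>" and g: "morphism V (shift b W) \<phi>'"
  shows "morphism U (shift (a + b) W) (\<lambda>t x. \<phi>' (t + a) (\<phi> t x))"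
proof -
  have [simp]: "t + (a + b) = t + a + b" for t by simp
  show ?thesis
    using f g unfolding morphism_def linear_between_def
    by (auto simp: shift_def image_subset_iff)
qed

lemma interleaving_trans:
  assumes "pmod U" "pmod W" "0 \<le> a" "0 \<le> b"
    and "interleaving a U V \<phi> \<psi>" "interleaving b V W \<phi>' \<psi>'"
  shows "interleaving (a + b) U W (\<lambda>t x. \<phi>' (t + a) (\<phi> t x)) (\<lambda>t x. \<psi> (t + b) (\<psi>' t x))"
  unfolding interleaving_def
proof (intro conjI allI ballI)
  show "morphism U (shift (a + b) W) (\<lambda>t x. \<phi>' (t + a) (\<phi> t x))"
    using assms(5,6) unfolding interleaving_def by (blast intro: morphism_composite)
  have "morphism W (shift (b + a) U) (\<lambda>t x. \<psi> (t + b) (\<psi>' t x))"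
    using assms(5,6) unfolding interleaving_def by (blast intro: morphism_composite)
  then show "morphism W (shift (a + b) U) (\<lambda>t x. \<psi> (t + b) (\<psi>' t x))" by (simp add: add.commute)
  show "\<psi> (t + (a + b) + b) (\<psi>' (t + (a + b)) (\<phi>' (t + a) (\<phi> t x))) = vmap U t (t + 2 * (a + b)) x"
    if "x \<in> vspace U t" for t x
    using interleaving_composite assms that by blast
  show "\<phi>' (t + (a + b) + a) (\<phi> (t + (a + b)) (\<psi> (t + b) (\<psi>' t y))) = vmap W t (t + 2 * (a + b)) y"
    if "y \<in> vspace W t" for t y
    using interleaving_composite[OF assms(2,4,3) interleaving_sym[OF assms(6)] interleaving_sym[OF assms(5)] that]
    by (simp add: add.commute[of b a])
qed

text \<open>For an interval \<open>S\<close>, the support of the \<eta>-smoothing of its interval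
  module: the map from \<open>t - \<eta>\<close> to \<open>t + \<eta>\<close> is nonzero exactly for
  these \<open>t\<close>.\<close>

definition shrink :: "real \<Rightarrow> real set \<Rightarrow> real set" where
  "shrink \<eta> S = {t. t - \<eta> \<in> S \<and> t + \<eta> \<in> S}"

lemma interval_shrink: "is_interval S \<Longrightarrow> is_interval (shrink \<eta> S)"
  unfolding shrink_def is_interval_1 by (auto; metis add_le_cancel_right diff_right_mono)

lemma
  assumes S: "is_interval S" and ne: "shrink \<eta> S \<noteq> {}" and \<eta>: "0 \<le> \<eta>"
  shows lo_shrink: "lo (shrink \<eta> S) = lo S + ereal \<eta>" and hi_shrink: "hi (shrink \<eta> S) = hi S - ereal \<eta>"
proof -
  obtain t where t: "t - \<eta> \<in> S" "t + \<eta> \<in> S" using ne by (auto simp: shrink_def)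
  show "lo (shrink \<eta> S) = lo S + ereal \<eta>"
  proof (rule antisym)
    have "lo (shrink \<eta> S) - ereal \<eta> \<le> lo S"
    proof (rule Inf_greatest)
      fix x assume "x \<in> ereal ` S"
      then obtain a where a: "a \<in> S" "x = ereal a" by blast
      \<comment> \<open>If \<open>t\<close> is not such a point, then \<open>a + 2 * \<eta>\<close>
        lies between \<open>a\<close> and \<open>t + \<eta>\<close>, so \<open>a + \<eta>\<close> is
        one.\<close>
      have "\<exists>s\<in>shrink \<eta> S. s \<le> a + \<eta>"
      proof (cases "t \<le> a + \<eta>")
        case False
        then have "a + 2 * \<eta> \<in> S" using mem_is_interval_1_I[OF S a(1) t(2), of "a + 2 * \<eta>"] \<eta> by simp
        then have "a + \<eta> \<in> shrink \<eta> S" using a by (simp add: shrink_def add.assoc)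
        then show ?thesis by blast
      qed (use t in \<open>auto simp: shrink_def\<close>)
      then obtain s where s: "s \<in> shrink \<eta> S" "s \<le> a + \<eta>" by blast
      have "lo (shrink \<eta> S) \<le> ereal (a + \<eta>)" using order_trans[OF lo_le[OF s(1)], of "ereal (a + \<eta>)"] s(2) by simp
      then show "lo (shrink \<eta> S) - ereal \<eta> \<le> x" using a by (cases "lo (shrink \<eta> S)") auto
    qed
    then show "lo (shrink \<eta> S) \<le> lo S + ereal \<eta>" by (cases "lo (shrink \<eta> S)"; cases "lo S") auto
    show "lo S + ereal \<eta> \<le> lo (shrink \<eta> S)"
    proof (rule Inf_greatest)
      fix x assume "x \<in> ereal ` shrink \<eta> S"
      then obtain a where "a - \<eta> \<in> S" "x = ereal a" by (auto simp: shrink_def)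
      then show "lo S + ereal \<eta> \<le> x" using lo_le[of "a - \<eta>" S] by (cases "lo S") auto
    qed
  qed
  show "hi (shrink \<eta> S) = hi S - ereal \<eta>"
  proof (rule antisym)
    have "hi S \<le> hi (shrink \<eta> S) + ereal \<eta>"
    proof (rule Sup_least)
      fix x assume "x \<in> ereal ` S"
      then obtain a where a: "a \<in> S" "x = ereal a" by blast
      have "\<exists>s\<in>shrink \<eta> S. a - \<eta> \<le> s"
      proof (cases "a - \<eta> \<le> t")
        case False
        then have "a - 2 * \<eta> \<in> S" using mem_is_interval_1_I[OF S t(1) a(1), of "a - 2 * \<eta>"] \<eta> by simp
        then have "a - \<eta> \<in> shrink \<eta> S" using a by (simp add: shrink_def diff_diff_eq)
        then show ?thesis by blast
      qed (use t in \<open>auto simp: shrink_def\<close>)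
      then obtain s where s: "s \<in> shrink \<eta> S" "a - \<eta> \<le> s" by blast
      have "ereal (a - \<eta>) \<le> hi (shrink \<eta> S)" using order_trans[OF _ hi_ge[OF s(1)], of "ereal (a - \<eta>)"] s(2) by simp
      then show "x \<le> hi (shrink \<eta> S) + ereal \<eta>" using a by (cases "hi (shrink \<eta> S)") auto
    qed
    then show "hi S - ereal \<eta> \<le> hi (shrink \<eta> S)" by (cases "hi (shrink \<eta> S)"; cases "hi S") auto
    show "hi (shrink \<eta> S) \<le> hi S - ereal \<eta>"
    proof (rule Sup_least)
      fix x assume "x \<in> ereal ` shrink \<eta> S"
      then obtain a where "a + \<eta> \<in> S" "x = ereal a" by (auto simp: shrink_def)
      then show "x \<le> hi S - ereal \<eta>" using hi_ge[of "a + \<eta>" S] by (cases "hi S") auto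
    qed
  qed
qed

lemma shrink_nonempty:
  assumes S: "is_interval S" and \<eta>: "0 \<le> \<eta>" and lt: "lo S + ereal \<eta> < hi S - ereal \<eta>"
  shows "shrink \<eta> S \<noteq> {}"
proof -
  obtain t where t: "lo S + ereal \<eta> < ereal t" "ereal t < hi S - ereal \<eta>" using lt ereal_dense2 by blast
  have "lo S < ereal (t - \<eta>)" "lo S < ereal (t + \<eta>)" using t(1) \<eta> by (cases "lo S"; auto)+
  moreover have "ereal (t - \<eta>) < hi S" "ereal (t + \<eta>) < hi S" using t(2) \<eta> by (cases "hi S"; auto)+
  ultimately have "t \<in> shrink \<eta> S" using between_lo_hi[OF S] by (auto simp: shrink_def)
  then show ?thesis by blast
qed

text \<open>The image of the map from \<open>t - \<eta>\<close> to \<open>t + \<eta>\<close> is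
  spanned by the vectors of the bars alive at both ends. The others must be cut off explicitly, as
  \<open>e i (t + \<eta>)\<close> can be nonzero for a bar that starts after
  \<open>t - \<eta>\<close>.\<close>

lemma (in ibasis) ibasis_smoothing:
  assumes \<eta>: "0 \<le> \<eta>"
  shows "ibasis (smoothing \<eta> V) {i \<in> I. shrink \<eta> (K i) \<noteq> {}} (\<lambda>i. shrink \<eta> (K i))
    (\<lambda>i t. if t \<in> shrink \<eta> (K i) then e i (t + \<eta>) else 0)"
proof -
  let ?I = "{i \<in> I. shrink \<eta> (K i) \<noteq> {}}" and ?K = "\<lambda>i. shrink \<eta> (K i)"
  let ?e = "\<lambda>i t. if t \<in> ?K i then e i (t + \<eta>) else 0"
  let ?act = "\<lambda>t. {i \<in> ?I. t \<in> ?K i}"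
  have act: "?act t = active (t - \<eta>) \<inter> active (t + \<eta>)" for t by (auto simp: shrink_def)
  interpret W: pmod "smoothing \<eta> V" by unfold_locales (rule persistence_module_smoothing[OF \<eta>])
  have sum: "(\<Sum>i\<in>?act t. vscale V (a i) (?e i t)) = (\<Sum>i\<in>?act t. vscale V (a i) (e i (t + \<eta>)))" for a t
    by (intro sum.cong) auto
  show ?thesis
  proof (unfold_locales, unfold vscale_smoothing)
    show "finite (?act t)" for t unfolding act using finite_active by simp
    show "?e i t \<in> vspace (smoothing \<eta> V) t" if "i \<in> ?I" for i t
    proof (cases "t \<in> ?K i")
      case True
      then have "e i (t + \<eta>) = vmap V (t - \<eta>) (t + \<eta>) (e i (t - \<eta>))"
        using e_map[of i "t - \<eta>" "t + \<eta>"] that \<eta> by (simp add: shrink_def)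
      then show ?thesis using True e_in[of i "t - \<eta>"] that unfolding vspace_smoothing by auto
    qed (use W.vspace_closed(1) in auto)
    show "vmap (smoothing \<eta> V) s t (?e i s) = ?e i t" if i: "i \<in> ?I" "s \<in> ?K i" "s \<le> t" for i s t
    proof -
      have s: "s - \<eta> \<in> K i" "s + \<eta> \<in> K i" using i by (auto simp: shrink_def)
      have "e i (t + \<eta>) = 0" if "t \<notin> ?K i"
      proof -
        have "t + \<eta> \<notin> K i"
        proof
          assume t: "t + \<eta> \<in> K i"
          then have "t - \<eta> \<in> K i"
            using mem_is_interval_1_I[OF interval s(1) t, of "t - \<eta>"] i \<eta> by auto
          then show False using t that by (simp add: shrink_def)
        qed
        then show ?thesis using e_out i by blast
      qed
      then show ?thesis using i e_map[OF _ s(2), of "t + \<eta>"] by (simp add: vmap_smoothing)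
    qed
    fix t
    have ext: "(\<Sum>i\<in>?act t. vscale V (a i) (e i (t + \<eta>)))
        = (\<Sum>i\<in>active (t + \<eta>). vscale V (if i \<in> ?act t then a i else 0) (e i (t + \<eta>)))" for a
      unfolding act using finite_active by (intro sum.mono_neutral_cong_left) auto
    show "\<exists>a. x = (\<Sum>i\<in>?act t. vscale V (a i) (?e i t))" if x: "x \<in> vspace (smoothing \<eta> V) t" for x
    proof -
      obtain y where y: "y \<in> vspace V (t - \<eta>)" "x = vmap V (t - \<eta>) (t + \<eta>) y"
        using x unfolding vspace_smoothing by blast
      have "x \<in> vspace V (t + \<eta>)" using smoothing_in[OF \<eta> x] .
      \<comment> \<open>\<open>x\<close> comes from \<open>t - \<eta>\<close>, so its coordinates at
        bars not alive there vanish.\<close>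
      from coord_sum[OF this]
      have "x = (\<Sum>i\<in>active (t + \<eta>). vscale V (if i \<in> ?act t then coord (t + \<eta>) x i else 0) (e i (t + \<eta>)))"
      proof (rule trans, intro sum.cong refl)
        fix i assume i: "i \<in> active (t + \<eta>)"
        have "coord (t + \<eta>) x i = coord (t - \<eta>) y i"
          using coord_vmap[OF _ y(1), of "t + \<eta>"] y(2) i \<eta> by simp
        then have "coord (t + \<eta>) x i = 0" if "i \<notin> ?act t"
          using that i coord_out[of i "t - \<eta>" y] unfolding act by auto
        then show "vscale V (coord (t + \<eta>) x i) (e i (t + \<eta>))
            = vscale V (if i \<in> ?act t then coord (t + \<eta>) x i else 0) (e i (t + \<eta>))" by auto
      qed
      then show ?thesis unfolding sum ext by (rule exI[of _ "coord (t + \<eta>) x"])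
    qed
    show "a i = 0" if "(\<Sum>i\<in>?act t. vscale V (a i) (?e i t)) = 0" "i \<in> ?I" "t \<in> ?K i" for a i
      using that indep[where t = "t + \<eta>" and i = i and a = "\<lambda>i. if i \<in> ?act t then a i else 0"]
      unfolding sum ext by (auto simp: shrink_def)
  qed (use interval interval_shrink in auto)
qed

section \<open>Interleavings from matchings\<close>

text \<open>The interleaving parameter \<eta> exceeds the matching bound \<epsilon> because
  \<open>close_bars\<close> does not see whether endpoints belong to the bars; with the excess,
  points that close bars force to lie beyond an endpoint do so strictly.\<close>

locale matched = U: ibasis U I K e + V: ibasis V J L f
  for U :: "('f::field, 'u::ab_group_add) pmodule" and I :: "'i set" and K e
    and V :: "('f, 'v::ab_group_add) pmodule" and J :: "'j set" and L f +
  fixes M :: "('i \<times> 'j) set" and \<epsilon> \<eta> :: real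
  assumes eps: "0 \<le> \<epsilon>" and eta: "\<epsilon> < \<eta>"
    and M_sub: "M \<subseteq> I \<times> J"
    and M_left: "(i, j) \<in> M \<Longrightarrow> (i, j') \<in> M \<Longrightarrow> j = j'"
    and M_right: "(i, j) \<in> M \<Longrightarrow> (i', j) \<in> M \<Longrightarrow> i = i'"
    and M_close: "(i, j) \<in> M \<Longrightarrow> close_bars \<epsilon> (K i) (L j)"
    and unmatched_left: "i \<in> I \<Longrightarrow> long_bar \<epsilon> (K i) \<Longrightarrow> i \<in> Domain M"
    and unmatched_right: "j \<in> J \<Longrightarrow> long_bar \<epsilon> (L j) \<Longrightarrow> j \<in> Range M"
begin

lemma swap: "matched V J L f U I K e (M\<inverse>) \<epsilon> \<eta>"
  using eps eta M_sub M_left M_right M_close unmatched_left unmatched_right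
  by unfold_locales (auto simp: close_bars_sym[OF eps])

text \<open>The partner begins at most \<epsilon> after \<open>K i\<close>, hence strictly before
  \<open>t + \<eta>\<close>; a point missing from it there can only lie past its end.\<close>

lemma matched_below:
  assumes ij: "(i, j) \<in> M" and s: "s \<in> K i" and t: "s \<le> t" "t + \<eta> \<notin> L j"
  shows "hi (L j) \<le> ereal (t + \<eta>)"
proof (rule ccontr)
  assume "\<not> ?thesis"
  then have "ereal (t + \<eta>) < hi (L j)" by simp
  moreover have "lo (L j) \<le> lo (K i) + ereal \<epsilon>" using M_close[OF ij] by (simp add: close_bars_iff[OF eps])
  then have "lo (L j) < ereal (t + \<eta>)"
    using lo_le[OF s] t(1) eta by (cases "lo (L j)"; cases "lo (K i)") auto
  ultimately show False using t(2) between_lo_hi[OF V.interval] ij M_sub by blast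
qed

text \<open>The partner ends at most \<epsilon> after \<open>K i\<close>, so it is over at
  \<open>t + \<eta>\<close> once \<open>K i\<close> is over at \<open>t\<close>. With
  \<open>matched_below\<close>, this gives naturality on generators.\<close>

lemma matched_above:
  assumes ij: "(i, j) \<in> M" and s: "s \<in> K i" and t: "s \<le> t" "t \<notin> K i"
  shows "t + \<eta> \<notin> L j"
proof
  assume tL: "t + \<eta> \<in> L j"
  have "hi (K i) \<le> ereal t"
  proof (rule ccontr)
    assume "\<not> ?thesis"
    then have "ereal t < hi (K i)" by simp
    then obtain b where "b \<in> K i" "t < b" by (auto simp: less_Sup_iff)
    moreover have "is_interval (K i)" using U.interval ij M_sub by blast
    ultimately show False using mem_is_interval_1_I[of "K i" s b t] s t by simp
  qed
  moreover have "hi (L j) \<le> hi (K i) + ereal \<epsilon>" using M_close[OF ij] by (simp add: close_bars_iff[OF eps])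
  ultimately show False using hi_ge[OF tL] eta by (cases "hi (L j)"; cases "hi (K i)") auto
qed

definition partner_vector :: "'i \<Rightarrow> real \<Rightarrow> 'v" where
  "partner_vector i t = (if i \<in> Domain M then f (THE j. (i, j) \<in> M) (t + \<eta>) else 0)"

lemma partner_vector_eq: "(i, j) \<in> M \<Longrightarrow> partner_vector i t = f j (t + \<eta>)"
proof -
  assume ij: "(i, j) \<in> M"
  then have "(THE j. (i, j) \<in> M) = j" using M_left by blast
  then show ?thesis using ij unfolding partner_vector_def by auto
qed

lemma partner_vector_in: "i \<in> I \<Longrightarrow> partner_vector i t \<in> vspace V (t + \<eta>)"
proof (cases "i \<in> Domain M")
  case True
  then obtain j where "(i, j) \<in> M" by blast
  then have "partner_vector i t = f j (t + \<eta>)" "j \<in> J" using partner_vector_eq M_sub by blast+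
  then show ?thesis using V.e_in by simp
qed (simp add: partner_vector_def V.vspace_closed)

lemma vmap_partner_vector:
  assumes s: "s \<in> K i" and t: "s \<le> t"
  shows "vmap V (s + \<eta>) (t + \<eta>) (partner_vector i s) = (if t \<in> K i then partner_vector i t else 0)"
proof (cases "i \<in> Domain M")
  case True
  then obtain j where ij: "(i, j) \<in> M" by blast
  then have j: "j \<in> J" using M_sub by blast
  show ?thesis
  proof (cases "s + \<eta> \<in> L j")
    case True
    then have "vmap V (s + \<eta>) (t + \<eta>) (f j (s + \<eta>)) = f j (t + \<eta>)" using V.e_map[OF j] t by simp
    then show ?thesis using matched_above[OF ij s t] V.e_out[OF j] by (simp add: partner_vector_eq[OF ij])
  next
    case False
    have "hi (L j) \<le> ereal (s + \<eta>)" using matched_below[OF ij s order_refl False] .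
    have "t + \<eta> \<notin> L j"
    proof
      assume tL: "t + \<eta> \<in> L j"
      then have "ereal (t + \<eta>) \<le> ereal (s + \<eta>)"
        using order_trans[OF hi_ge[OF tL]] \<open>hi (L j) \<le> ereal (s + \<eta>)\<close> by blast
      then have "t = s" using t by simp
      then show False using tL False by simp
    qed
    then show ?thesis using False V.e_out[OF j] V.vmap_0 t by (simp add: partner_vector_eq[OF ij])
  qed
next
  case False
  then show ?thesis using V.vmap_0 t by (simp add: partner_vector_def)
qed

definition transfer :: "real \<Rightarrow> 'u \<Rightarrow> 'v" where
  "transfer t x = (\<Sum>i\<in>U.active t. vscale V (U.coord t x i) (partner_vector i t))"

lemma transfer_linear: "linear_between (vscale U) (vspace U t) (vscale V) (vspace V (t + \<eta>)) (transfer t)"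
  unfolding linear_between_def image_subset_iff
proof (intro conjI ballI allI)
  show "transfer t x \<in> vspace V (t + \<eta>)" for x
    unfolding transfer_def by (rule V.vspace_sum) (simp add: partner_vector_in)
  show "transfer t (x + y) = transfer t x + transfer t y" if "x \<in> vspace U t" "y \<in> vspace U t" for x y
    by (simp add: transfer_def U.coord_add[OF that] V.scale_left_distrib sum.distrib)
  show "transfer t (vscale U c x) = vscale V c (transfer t x)" if "x \<in> vspace U t" for c x
    by (simp add: transfer_def U.coord_scale[OF that] V.scale_sum_right)
qed

lemma transfer_e:
  assumes "i \<in> U.active t"
  shows "transfer t (e i t) = partner_vector i t"
proof -
  have "transfer t (e i t) = (\<Sum>k\<in>U.active t. if k = i then partner_vector k t else 0)"
    unfolding transfer_def U.coord_e[OF assms] by (intro sum.cong) auto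
  also have "\<dots> = partner_vector i t" using assms U.finite_active[of t] by (simp only: sum.delta if_True)
  finally show ?thesis .
qed

lemma transfer_morphism: "morphism U (shift \<eta> V) transfer"
  unfolding morphism_def
proof (intro conjI allI impI ballI)
  show "linear_between (vscale U) (vspace U t) (vscale (shift \<eta> V)) (vspace (shift \<eta> V) t) (transfer t)" for t
    using transfer_linear by (simp add: shift_def)
  fix s t x assume st: "s \<le> t" and x: "x \<in> vspace U s"
  have "transfer t (vmap U s t x) = vmap V (s + \<eta>) (t + \<eta>) (transfer s x)"
  proof (rule U.linear_eq_on_basis[OF _ _ _ x])
    show "linear_between (vscale U) (vspace U s) (vscale V) (vspace V (t + \<eta>)) (\<lambda>x. transfer t (vmap U s t x))"
      using linear_between_comp[OF U.vmap_linear[OF st] transfer_linear] .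
    show "linear_between (vscale U) (vspace U s) (vscale V) (vspace V (t + \<eta>))
        (\<lambda>x. vmap V (s + \<eta>) (t + \<eta>) (transfer s x))"
      using linear_between_comp[OF transfer_linear V.vmap_linear] st by simp
    fix i assume i: "i \<in> U.active s"
    have "transfer t (e i t) = (if t \<in> K i then partner_vector i t else 0)"
      using transfer_e[of i t] i U.e_out[of i t] linear_between_zero[OF transfer_linear U.vspace_closed(1)] by auto
    then show "transfer t (vmap U s t (e i s)) = vmap V (s + \<eta>) (t + \<eta>) (transfer s (e i s))"
      using i transfer_e[OF i] vmap_partner_vector[of s i t] U.e_map[of i s t] st by simp
  qed
  then show "transfer t (vmap U s t x) = vmap (shift \<eta> V) s t (transfer s x)"
    by (simp add: shift_def)
qed

context
begin

interpretation sw: matched V J L f U I K e "M\<inverse>" \<epsilon> \<eta>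
  by (rule swap)

lemma transfer_transfer:
  assumes x: "x \<in> vspace U t"
  shows "sw.transfer (t + \<eta>) (transfer t x) = vmap U t (t + 2 * \<eta>) x"
proof (rule U.linear_eq_on_basis[OF _ _ _ x])
  have \<eta>: "0 \<le> \<eta>" using eps eta by simp
  have tt: "t + \<eta> + \<eta> = t + 2 * \<eta>" by simp
  show "linear_between (vscale U) (vspace U t) (vscale U) (vspace U (t + 2 * \<eta>)) (\<lambda>x. sw.transfer (t + \<eta>) (transfer t x))"
    using linear_between_comp[OF transfer_linear sw.transfer_linear, of t] unfolding tt .
  show "linear_between (vscale U) (vspace U t) (vscale U) (vspace U (t + 2 * \<eta>)) (vmap U t (t + 2 * \<eta>))"
    using \<eta> by (intro U.vmap_linear) simp
  fix i assume i: "i \<in> U.active t"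
  have e2: "vmap U t (t + 2 * \<eta>) (e i t) = e i (t + 2 * \<eta>)" using i U.e_map \<eta> by simp
  have zero: "sw.transfer (t + \<eta>) 0 = 0"
    using linear_between_zero[OF sw.transfer_linear V.vspace_closed(1)] .
  show "sw.transfer (t + \<eta>) (transfer t (e i t)) = vmap U t (t + 2 * \<eta>) (e i t)"
  proof (cases "i \<in> Domain M")
    case True
    then obtain j where ij: "(i, j) \<in> M" by blast
    then have j: "j \<in> J" using M_sub by blast
    show ?thesis
    proof (cases "t + \<eta> \<in> L j")
      case True
      then have "sw.transfer (t + \<eta>) (f j (t + \<eta>)) = e i (t + 2 * \<eta>)"
        using sw.transfer_e[of j "t + \<eta>"] j sw.partner_vector_eq[of j i] ij tt by simp
      then show ?thesis using e2 transfer_e[OF i] partner_vector_eq[OF ij] by simp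
    next
      case False
      then have le: "hi (L j) \<le> ereal (t + \<eta>)" using matched_below[OF ij, of t t] i by simp
      \<comment> \<open>The partner has ended by \<open>t + \<eta>\<close>, hence bar
        \<open>i\<close> by \<open>t + \<eta> + \<epsilon>\<close>, which is less than
        \<open>t + 2 * \<eta>\<close>.\<close>
      have "t + 2 * \<eta> \<notin> K i"
      proof
        assume "t + 2 * \<eta> \<in> K i"
        then have "ereal (t + 2 * \<eta>) \<le> hi (K i)" by (rule hi_ge)
        moreover have "hi (K i) \<le> hi (L j) + ereal \<epsilon>" using M_close[OF ij] by (simp add: close_bars_iff[OF eps])
        ultimately show False using le eta by (cases "hi (L j)"; cases "hi (K i)") auto
      qed
      then have "e i (t + 2 * \<eta>) = 0" using U.e_out i by simp
      then show ?thesis using e2 transfer_e[OF i] partner_vector_eq[OF ij] V.e_out[OF j False] zero by simp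
    qed
  next
    case False
    \<comment> \<open>Two points at distance \<open>2 * \<eta>\<close> would make the unmatched bar
      long.\<close>
    have "t + 2 * \<eta> \<notin> K i"
    proof
      assume t2: "t + 2 * \<eta> \<in> K i"
      have "long_bar \<epsilon> (K i)"
        using lo_le[of t "K i"] hi_ge[OF t2] i eta unfolding long_bar_def
        by (cases "lo (K i)"; cases "hi (K i)") auto
      then show False using unmatched_left False i by blast
    qed
    then have "e i (t + 2 * \<eta>) = 0" using U.e_out i by simp
    then show ?thesis using e2 transfer_e[OF i] False zero by (simp add: partner_vector_def)
  qed
qed

lemma matched_interleaving: "interleaving \<eta> U V transfer sw.transfer"
proof -
  have "transfer (t + \<eta>) (sw.transfer t y) = vmap V t (t + 2 * \<eta>) y" if "y \<in> vspace V t" for t y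
    using matched.transfer_transfer[OF swap that] by simp
  then show ?thesis
    unfolding interleaving_def using transfer_morphism matched.transfer_morphism[OF swap] transfer_transfer by simp
qed

end

end

section \<open>Diagrams and the isometry theorem\<close>

definition bars_at :: "'i set \<Rightarrow> ('i \<Rightarrow> real set) \<Rightarrow> real \<Rightarrow> ereal \<times> ereal \<Rightarrow> 'i set" where
  "bars_at I K \<delta> p = {i \<in> I. lo (K i) < hi (K i) \<and> p = (lo (K i) - ereal \<delta>, hi (K i) + ereal \<delta>)}"

lemma (in ibasis) finite_bars_at: "finite (bars_at I K \<delta> p)"
proof (cases "bars_at I K \<delta> p = {}")
  case True
  then show ?thesis by (simp only: finite.emptyI)
next
  case False
  then obtain i where i: "i \<in> bars_at I K \<delta> p" by blast
  then obtain t where t: "lo (K i) < ereal t" "ereal t < hi (K i)"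
    using ereal_dense2 unfolding bars_at_def by blast
  have "k \<in> active t" if k: "k \<in> bars_at I K \<delta> p" for k
  proof -
    have "lo (K k) = lo (K i)" "hi (K k) = hi (K i)"
      using i k unfolding bars_at_def
      by (cases "lo (K k)"; cases "lo (K i)"; cases "hi (K k)"; cases "hi (K i)"; simp)+
    then show ?thesis using k t interval between_lo_hi by (simp add: bars_at_def)
  qed
  then show ?thesis by (intro finite_subset[OF _ finite_active[of t]]) blast
qed

text \<open>The stability theorem for the identity, as a \<open>0\<close>-interleaving, gives the uniqueness of the barcode
  up to the type of the endpoints.\<close>

lemma card_bars_at_unique:
  assumes "ibasis W I K e" "ibasis W J L f"
  shows "card (bars_at I K \<delta> p) = card (bars_at J L \<delta> p)"
proof -
  interpret U: ibasis W I K e by fact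
  interpret V: ibasis W J L f by fact
  have "morphism W (shift 0 W) (\<lambda>t x. x)"
    unfolding morphism_def linear_between_def by (auto simp: shift_def)
  then have "interleaving 0 W W (\<lambda>t x. x) (\<lambda>t x. x)"
    using U.vmap_id by (simp add: interleaving_def)
  then interpret W: interleaved W I K e W J L f 0 "\<lambda>t x. x" "\<lambda>t x. x"
    by unfold_locales auto
  obtain M where M: "M \<subseteq> I \<times> J"
    "\<forall>i j j'. (i, j) \<in> M \<longrightarrow> (i, j') \<in> M \<longrightarrow> j = j'"
    "\<forall>i i' j. (i, j) \<in> M \<longrightarrow> (i', j) \<in> M \<longrightarrow> i = i'"
    "{i \<in> I. long_bar 0 (K i)} \<subseteq> Domain M" "{j \<in> J. long_bar 0 (L j)} \<subseteq> Range M"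
    "\<forall>(i, j)\<in>M. close_bars 0 (K i) (L j) \<and> lo (K i) < hi (K i) \<and> lo (L j) < hi (L j)"
    using W.induces_matching by (elim exE conjE) (rule that)
  \<comment> \<open>At distance \<open>0\<close>, close bars have equal endpoints and every
    nondegenerate bar is long.\<close>
  have eq: "lo (K i) = lo (L j) \<and> hi (K i) = hi (L j)" if "(i, j) \<in> M" for i j
    using M(6) that by (auto simp: close_bars_iff zero_ereal_def[symmetric] intro: antisym)
  have "\<forall>i\<in>bars_at I K \<delta> p. \<exists>j. (i, j) \<in> M"
    using M(4) by (auto simp: bars_at_def long_bar_def zero_ereal_def[symmetric])
  from bchoice[OF this] obtain h where h: "\<And>i. i \<in> bars_at I K \<delta> p \<Longrightarrow> (i, h i) \<in> M" by blast
  have "bij_betw h (bars_at I K \<delta> p) (bars_at J L \<delta> p)"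
  proof (rule bij_betw_imageI)
    show "inj_on h (bars_at I K \<delta> p)"
    proof (rule inj_onI)
      fix i i' assume i: "i \<in> bars_at I K \<delta> p" "i' \<in> bars_at I K \<delta> p" "h i = h i'"
      then show "i = i'" using M(3) h[OF i(1)] h[OF i(2)] by metis
    qed
    show "h ` bars_at I K \<delta> p = bars_at J L \<delta> p"
    proof (intro subset_antisym subsetI)
      fix j assume "j \<in> h ` bars_at I K \<delta> p"
      then obtain i where i: "i \<in> bars_at I K \<delta> p" "j = h i" by blast
      have "j \<in> J" using h[OF i(1)] i(2) M(1) by blast
      then show "j \<in> bars_at J L \<delta> p" using i eq[OF h[OF i(1)]] by (simp add: bars_at_def)
    next
      fix j assume j: "j \<in> bars_at J L \<delta> p"
      then obtain i where i: "(i, j) \<in> M"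
        using M(5) by (auto simp: bars_at_def long_bar_def zero_ereal_def[symmetric])
      have "i \<in> I" using i M(1) by blast
      then have ib: "i \<in> bars_at I K \<delta> p" using j eq[OF i] by (simp add: bars_at_def)
      then have "h i = j" using h[OF ib] i M(2) by blast
      then show "j \<in> h ` bars_at I K \<delta> p" using ib by blast
    qed
  qed
  then show ?thesis by (rule bij_betw_same_card)
qed

lemma dgm_eps_eq: "dgm_eps \<delta> W p = enat (card (bars_at (copies (barcode W)) fst \<delta> p))"
  by (simp add: dgm_eps_def bars_at_def Let_def)

section \<open>The diagram of a q-tame module\<close>

locale q_tame_pmod = pmod V for V :: "('f::field, 'v::ab_group_add) pmodule" +
  assumes tame: "q_tame V"
begin

definition bars :: "real \<Rightarrow> (real set \<times> nat) set" where
  "bars \<delta> = copies (barcode (smoothing \<delta> V))"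

lemma bars_basis: "0 < \<delta> \<Longrightarrow> \<exists>e. ibasis (smoothing \<delta> V) (bars \<delta>) fst e"
  unfolding bars_def by (rule pfd_pmod.barcode_basis_exists) (rule pfd_smoothing[OF tame])

lemma dgm_eps_smoothing: "dgm_eps \<delta> (smoothing \<delta> V) p = enat (card (bars_at (bars \<delta>) fst \<delta> p))"
  by (simp add: dgm_eps_eq bars_def)

lemma bars_at_long:
  assumes "i \<in> bars_at (bars \<delta>) fst \<delta> p" "0 < \<delta>"
  shows "fst p + ereal (2 * \<delta>) < snd p" "fst p \<noteq> \<infinity>" "snd p \<noteq> -\<infinity>"
  using assms unfolding bars_at_def by (cases "lo (fst i)"; cases "hi (fst i)"; auto)+

text \<open>Smoothing further by \<open>\<epsilon> - \<delta>\<close> shrinks each bar by what the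
  larger shift in \<open>dgm_eps\<close> restores, so points either keep their position or
  disappear. The two barcodes are chosen independently, so their multiplicities are compared through
  \<open>card_bars_at_unique\<close>.\<close>

lemma dgm_eps_later:
  assumes \<delta>: "0 < \<delta>" "\<delta> \<le> \<epsilon>"
  shows "dgm_eps \<epsilon> (smoothing \<epsilon> V) p
    = (if fst p + ereal (2 * \<epsilon>) < snd p then dgm_eps \<delta> (smoothing \<delta> V) p else 0)"
proof -
  define \<eta> where "\<eta> = \<epsilon> - \<delta>"
  have \<eta>: "0 \<le> \<eta>" "\<epsilon> = \<delta> + \<eta>" using \<delta> by (auto simp: \<eta>_def)
  obtain e where "ibasis (smoothing \<delta> V) (bars \<delta>) fst e" using bars_basis[OF \<delta>(1)] by blast
  then interpret B: ibasis "smoothing \<delta> V" "bars \<delta>" fst e .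
  obtain f where f: "ibasis (smoothing \<epsilon> V) (bars \<epsilon>) fst f" using bars_basis[of \<epsilon>] \<delta> by auto
  let ?I = "{i \<in> bars \<delta>. shrink \<eta> (fst i) \<noteq> {}}"
  let ?A = "bars_at ?I (\<lambda>i. shrink \<eta> (fst i)) \<epsilon> p"
  have "smoothing \<eta> (smoothing \<delta> V) = smoothing \<epsilon> V"
    using smoothing_smoothing[of \<delta> \<eta>] \<delta> \<eta> by simp
  then have "card (bars_at (bars \<epsilon>) fst \<epsilon> p) = card ?A"
    using card_bars_at_unique[OF f] B.ibasis_smoothing[OF \<eta>(1)] by simp
  moreover have "?A = (if fst p + ereal (2 * \<epsilon>) < snd p then bars_at (bars \<delta>) fst \<delta> p else {})"
  proof -
    have "i \<in> ?A \<longleftrightarrow> fst p + ereal (2 * \<epsilon>) < snd p \<and> i \<in> bars_at (bars \<delta>) fst \<delta> p" for i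
    proof (cases "i \<in> bars \<delta>")
      case True
      note int = B.interval[OF True]
      have *: "lo (fst i) + ereal \<eta> < hi (fst i) - ereal \<eta> \<and>
          p = (lo (fst i) + ereal \<eta> - ereal \<epsilon>, hi (fst i) - ereal \<eta> + ereal \<epsilon>) \<longleftrightarrow>
          fst p + ereal (2 * \<epsilon>) < snd p \<and> lo (fst i) < hi (fst i) \<and>
          p = (lo (fst i) - ereal \<delta>, hi (fst i) + ereal \<delta>)"
        using \<eta> \<delta> by (cases "lo (fst i)"; cases "hi (fst i)") auto
      show ?thesis
      proof (cases "shrink \<eta> (fst i) = {}")
        case True
        then have "\<not> (lo (fst i) + ereal \<eta> < hi (fst i) - ereal \<eta>)" using shrink_nonempty[OF int \<eta>(1)] by blast
        then show ?thesis using True * unfolding bars_at_def by blast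
      next
        case False
        then show ?thesis
          using * True unfolding bars_at_def by (simp add: lo_shrink[OF int False \<eta>(1)] hi_shrink[OF int False \<eta>(1)])
      qed
    qed (simp add: bars_at_def)
    then show ?thesis by auto
  qed
  ultimately show ?thesis by (simp add: dgm_eps_smoothing zero_enat_def)
qed

text \<open>By \<open>dgm_eps_later\<close> the multiplicity of \<open>p\<close> is constant as long
  as the smoothing parameter is below half the persistence of \<open>p\<close>, and \<open>0\<close>
  afterwards; the supremum is therefore attained at \<delta>.\<close>

lemma dgm_eq:
  assumes \<delta>: "0 < \<delta>" and p: "fst p + ereal (2 * \<delta>) < snd p"
  shows "dgm V p = enat (card (bars_at (bars \<delta>) fst \<delta> p))"
proof -
  have "dgm V p = dgm_eps \<delta> (smoothing \<delta> V) p"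
    unfolding dgm_def
  proof (rule antisym)
    show "(SUP \<epsilon>\<in>{0<..}. dgm_eps \<epsilon> (smoothing \<epsilon> V) p) \<le> dgm_eps \<delta> (smoothing \<delta> V) p"
    proof (rule SUP_least)
      fix \<epsilon> :: real assume "\<epsilon> \<in> {0<..}"
      then show "dgm_eps \<epsilon> (smoothing \<epsilon> V) p \<le> dgm_eps \<delta> (smoothing \<delta> V) p"
        using dgm_eps_later[of \<epsilon> \<delta> p] dgm_eps_later[of \<delta> \<epsilon> p] \<delta> p by (cases "\<epsilon> \<le> \<delta>") auto
    qed
    show "dgm_eps \<delta> (smoothing \<delta> V) p \<le> (SUP \<epsilon>\<in>{0<..}. dgm_eps \<epsilon> (smoothing \<epsilon> V) p)"
      using \<delta> by (intro SUP_upper) simp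
  qed
  then show ?thesis by (simp add: dgm_eps_smoothing)
qed

text \<open>These are the values at which subtraction on \<open>ereal\<close> would break the
  equivalence in \<open>gap_iff\<close>.\<close>

lemma dgm_nonzero:
  assumes "dgm V p \<noteq> 0"
  shows "fst p \<noteq> \<infinity>" "snd p \<noteq> -\<infinity>"
proof -
  have "\<exists>\<delta>>0. dgm_eps \<delta> (smoothing \<delta> V) p \<noteq> 0"
  proof (rule ccontr)
    assume "\<not> ?thesis"
    then have "dgm V p \<le> 0" unfolding dgm_def by (intro SUP_least) auto
    then show False using assms by simp
  qed
  then obtain \<delta> where \<delta>: "\<delta> > 0" "card (bars_at (bars \<delta>) fst \<delta> p) \<noteq> 0"
    by (auto simp: dgm_eps_smoothing zero_enat_def)
  then obtain i where "i \<in> bars_at (bars \<delta>) fst \<delta> p" by (auto simp: card_eq_0_iff)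
  then show "fst p \<noteq> \<infinity>" "snd p \<noteq> -\<infinity>" using bars_at_long \<delta>(1) by blast+
qed

lemma dgm_bij:
  assumes \<delta>: "0 < \<delta>"
  shows "\<exists>h. bij_betw h {i \<in> bars \<delta>. lo (fst i) < hi (fst i)}
      {x \<in> copies (dgm V). fst (fst x) + ereal (2 * \<delta>) < snd (fst x)} \<and>
    (\<forall>i\<in>bars \<delta>. lo (fst i) < hi (fst i) \<longrightarrow> fst (h i) = (lo (fst i) - ereal \<delta>, hi (fst i) + ereal \<delta>))"
proof -
  obtain e where "ibasis (smoothing \<delta> V) (bars \<delta>) fst e" using bars_basis[OF \<delta>] by blast
  then interpret B: ibasis "smoothing \<delta> V" "bars \<delta>" fst e .
  let ?A = "{i \<in> bars \<delta>. lo (fst i) < hi (fst i)}"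
  let ?f = "\<lambda>i. (lo (fst i) - ereal \<delta>, hi (fst i) + ereal \<delta>)"
  let ?Q = "{p. fst p + ereal (2 * \<delta>) < snd p}"
  have at: "{i \<in> ?A. ?f i = p} = bars_at (bars \<delta>) fst \<delta> p" for p by (auto simp: bars_at_def)
  have fib: "finite {i \<in> ?A. ?f i = p} \<and> dgm V p = enat (card {i \<in> ?A. ?f i = p})" if "p \<in> ?Q" for p
    unfolding at using B.finite_bars_at dgm_eq[OF \<delta>] that by simp
  have "\<exists>h. bij_betw h {i \<in> ?A. ?f i \<in> ?Q} {x \<in> copies (dgm V). fst x \<in> ?Q} \<and>
      (\<forall>i\<in>?A. ?f i \<in> ?Q \<longrightarrow> fst (h i) = ?f i)"
    by (rule copies_bij) (rule fib)
  then obtain h where h: "bij_betw h {i \<in> ?A. ?f i \<in> ?Q} {x \<in> copies (dgm V). fst x \<in> ?Q}"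
    "\<forall>i\<in>?A. ?f i \<in> ?Q \<longrightarrow> fst (h i) = ?f i" by (elim exE conjE) (rule that)
  have Q: "?f i \<in> ?Q" if "i \<in> ?A" for i
    using that \<delta> by (cases "lo (fst i)"; cases "hi (fst i)") auto
  then have "{i \<in> ?A. ?f i \<in> ?Q} = ?A" by blast
  then show ?thesis using h Q by (intro exI[of _ h]) auto
qed

end

section \<open>Both inequalities for q-tame modules\<close>

lemma morphism_smoothing:
  assumes "pmod U" and \<delta>: "0 \<le> \<delta>" and f: "morphism U (shift \<epsilon> V) \<phi>"
  shows "morphism (smoothing \<delta> U) (shift \<epsilon> (smoothing \<delta> V)) (\<lambda>t. \<phi> (t + \<delta>))"
proof -
  interpret U: pmod U by fact
  have add: "\<phi> t (x + y) = \<phi> t x + \<phi> t y" if "x \<in> vspace U t" "y \<in> vspace U t" for t x y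
    using f that unfolding morphism_def linear_between_def by blast
  have lin: "\<phi> t (vscale U c x) = vscale V c (\<phi> t x)" "\<phi> t x \<in> vspace V (t + \<epsilon>)"
    if "x \<in> vspace U t" for t x c
    using f that unfolding morphism_def linear_between_def image_subset_iff by (simp_all add: shift_def)
  have nat: "\<phi> t (vmap U s t x) = vmap V (s + \<epsilon>) (t + \<epsilon>) (\<phi> s x)" if "s \<le> t" "x \<in> vspace U s" for s t x
    using f that unfolding morphism_def by (simp add: shift_def)
  have [simp]: "t + \<epsilon> + \<delta> = t + \<delta> + \<epsilon>" "t + \<epsilon> - \<delta> = t - \<delta> + \<epsilon>" for t by simp_all
  show ?thesis
    unfolding morphism_def linear_between_def
  proof (intro conjI allI ballI impI)
    show "\<phi> (t + \<delta>) ` vspace (smoothing \<delta> U) t \<subseteq> vspace (shift \<epsilon> (smoothing \<delta> V)) t" for t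
    proof
      fix y assume "y \<in> \<phi> (t + \<delta>) ` vspace (smoothing \<delta> U) t"
      then obtain x where x: "x \<in> vspace U (t - \<delta>)" "y = \<phi> (t + \<delta>) (vmap U (t - \<delta>) (t + \<delta>) x)"
        unfolding vspace_smoothing by blast
      have "y = vmap V (t - \<delta> + \<epsilon>) (t + \<delta> + \<epsilon>) (\<phi> (t - \<delta>) x)" using nat[of "t - \<delta>" "t + \<delta>" x] x \<delta> by simp
      then show "y \<in> vspace (shift \<epsilon> (smoothing \<delta> V)) t"
        using lin(2)[OF x(1)] by (simp add: shift_def vspace_smoothing)
    qed
  qed (use add lin U.smoothing_in[OF \<delta>] in \<open>auto simp: shift_def vmap_smoothing nat\<close>)
qed

text \<open>Naturality carries images of structure maps into images, so both morphisms restrict to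
  the smoothings without any loss in \<epsilon>.\<close>

lemma interleaving_smoothing:
  assumes U: "pmod U" and V: "pmod V" and \<delta>: "0 \<le> \<delta>" and UV: "interleaving \<epsilon> U V \<phi> \<psi>"
  shows "interleaving \<epsilon> (smoothing \<delta> U) (smoothing \<delta> V) (\<lambda>t. \<phi> (t + \<delta>)) (\<lambda>t. \<psi> (t + \<delta>))"
proof -
  interpret U: pmod U by fact
  interpret V: pmod V by fact
  have [simp]: "t + \<epsilon> + \<delta> = t + \<delta> + \<epsilon>" "t + 2 * \<epsilon> + \<delta> = t + \<delta> + 2 * \<epsilon>" for t by simp_all
  show ?thesis
    using UV morphism_smoothing[OF U \<delta>, of \<epsilon> V \<phi>] morphism_smoothing[OF V \<delta>, of \<epsilon> U \<psi>]
      U.smoothing_in[OF \<delta>] V.smoothing_in[OF \<delta>]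
    unfolding interleaving_def by (auto simp: vmap_smoothing)
qed

lemma ediff_shift:
  "ediff (x - ereal \<delta>) (y - ereal \<delta>) = ediff x y" "ediff (x + ereal \<delta>) (y + ereal \<delta>) = ediff x y"
  by (cases x; cases y; simp add: ediff_def)+

lemma gap_iff:
  assumes "b \<noteq> \<infinity>" "d \<noteq> -\<infinity>"
  shows "d - b > ereal c \<longleftrightarrow> b + ereal c < d"
  using assms by (cases b; cases d) auto

lemma eps_matching_iff:
  "eps_matching \<epsilon> D E M \<longleftrightarrow> matching D E M \<and>
    (\<forall>x\<in>copies D. snd (fst x) - fst (fst x) > ereal (2 * \<epsilon>) \<longrightarrow> x \<in> Domain M) \<and>
    (\<forall>y\<in>copies E. snd (fst y) - fst (fst y) > ereal (2 * \<epsilon>) \<longrightarrow> y \<in> Range M) \<and>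
    (\<forall>(x, y)\<in>M. ediff (fst (fst x)) (fst (fst y)) \<le> ereal \<epsilon> \<and>
      ediff (snd (fst x)) (snd (fst y)) \<le> ereal \<epsilon>)"
  by (simp add: eps_matching_def case_prod_beta)

text \<open>The smoothings are matched with bound \<epsilon>, and the shifts by \<delta> cancel in
  the differences of endpoints. The additional \<delta> is needed for the threshold: points of
  persistence at most 2\<delta> are invisible in the smoothings.\<close>

theorem matching_of_interleaving:
  fixes U :: "('f::field, 'u::ab_group_add) pmodule" and V :: "('f, 'v::ab_group_add) pmodule"
  assumes "q_tame_pmod U" "q_tame_pmod V" and \<epsilon>: "0 \<le> \<epsilon>" and \<delta>: "0 < \<delta>"
    and UV: "interleaving \<epsilon> U V \<phi> \<psi>"
  shows "\<exists>M. eps_matching (\<epsilon> + \<delta>) (dgm U) (dgm V) M"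
proof -
  interpret U: q_tame_pmod U by fact
  interpret V: q_tame_pmod V by fact
  obtain e where e: "ibasis (smoothing \<delta> U) (U.bars \<delta>) fst e" using U.bars_basis[OF \<delta>] by blast
  obtain f where f: "ibasis (smoothing \<delta> V) (V.bars \<delta>) fst f" using V.bars_basis[OF \<delta>] by blast
  have "interleaving \<epsilon> (smoothing \<delta> U) (smoothing \<delta> V) (\<lambda>t. \<phi> (t + \<delta>)) (\<lambda>t. \<psi> (t + \<delta>))"
    using interleaving_smoothing[OF U.pmod_axioms V.pmod_axioms _ UV] \<delta> by simp
  then have "interleaved (smoothing \<delta> U) (U.bars \<delta>) fst e (smoothing \<delta> V) (V.bars \<delta>) fst f \<epsilon>
      (\<lambda>t. \<phi> (t + \<delta>)) (\<lambda>t. \<psi> (t + \<delta>))"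
    using e f \<epsilon> by (intro interleaved.intro interleaved_axioms.intro)
  from interleaved.induces_matching[OF this]
  obtain M where M: "M \<subseteq> U.bars \<delta> \<times> V.bars \<delta>"
    "\<forall>i j j'. (i, j) \<in> M \<longrightarrow> (i, j') \<in> M \<longrightarrow> j = j'"
    "\<forall>i i' j. (i, j) \<in> M \<longrightarrow> (i', j) \<in> M \<longrightarrow> i = i'"
    "{i \<in> U.bars \<delta>. long_bar \<epsilon> (fst i)} \<subseteq> Domain M" "{j \<in> V.bars \<delta>. long_bar \<epsilon> (fst j)} \<subseteq> Range M"
    "\<forall>(i, j)\<in>M. close_bars \<epsilon> (fst i) (fst j) \<and> lo (fst i) < hi (fst i) \<and> lo (fst j) < hi (fst j)"
    by (elim exE conjE) (rule that)
  from U.dgm_bij[OF \<delta>] obtain h where h: "bij_betw h {i \<in> U.bars \<delta>. lo (fst i) < hi (fst i)}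
      {x \<in> copies (dgm U). fst (fst x) + ereal (2 * \<delta>) < snd (fst x)}"
    "\<forall>i\<in>U.bars \<delta>. lo (fst i) < hi (fst i) \<longrightarrow> fst (h i) = (lo (fst i) - ereal \<delta>, hi (fst i) + ereal \<delta>)" by (elim exE conjE) (rule that)
  from V.dgm_bij[OF \<delta>] obtain k where k: "bij_betw k {j \<in> V.bars \<delta>. lo (fst j) < hi (fst j)}
      {x \<in> copies (dgm V). fst (fst x) + ereal (2 * \<delta>) < snd (fst x)}"
    "\<forall>j\<in>V.bars \<delta>. lo (fst j) < hi (fst j) \<longrightarrow> fst (k j) = (lo (fst j) - ereal \<delta>, hi (fst j) + ereal \<delta>)" by (elim exE conjE) (rule that)
  let ?A = "{i \<in> U.bars \<delta>. lo (fst i) < hi (fst i)}" and ?B = "{j \<in> V.bars \<delta>. lo (fst j) < hi (fst j)}"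
  have MAB: "i \<in> ?A \<and> j \<in> ?B \<and> close_bars \<epsilon> (fst i) (fst j)" if "(i, j) \<in> M" for i j
    using M(1,6) that by auto
  define N where "N = (\<lambda>(i, j). (h i, k j)) ` M"
  have N: "(h i, k j) \<in> N" if "(i, j) \<in> M" for i j using that unfolding N_def by force
  \<comment> \<open>Bars are shorter than their diagram points by \<delta> at each end, so
    persistence above 2(\<epsilon> + \<delta>) means length above 2\<epsilon>.\<close>
  have long: "long_bar \<epsilon> (fst i)" "lo (fst i) < hi (fst i)"
    if "fst (fst x) + ereal (2 * (\<epsilon> + \<delta>)) < snd (fst x)" "fst x = (lo (fst i) - ereal \<delta>, hi (fst i) + ereal \<delta>)"
    for x :: "(ereal \<times> ereal) \<times> nat" and i :: "real set \<times> nat"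
    using that \<epsilon> \<delta> unfolding long_bar_def by (cases "lo (fst i)"; cases "hi (fst i)"; auto)+
  have "N \<subseteq> copies (dgm U) \<times> copies (dgm V)"
  proof
    fix z assume "z \<in> N"
    then obtain i j where z: "z = (h i, k j)" "(i, j) \<in> M" by (auto simp: N_def)
    then have "h i \<in> h ` ?A" "k j \<in> k ` ?B" using MAB by blast+
    then show "z \<in> copies (dgm U) \<times> copies (dgm V)"
      using z(1) unfolding bij_betw_imp_surj_on[OF h(1)] bij_betw_imp_surj_on[OF k(1)] by simp
  qed
  moreover have "y = y'" if xy: "(x, y) \<in> N" "(x, y') \<in> N" for x y y'
  proof -
    obtain i j i' j' where *: "(i, j) \<in> M" "x = h i" "y = k j" "(i', j') \<in> M" "x = h i'" "y' = k j'"
      using xy by (auto simp: N_def)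
    have "h i = h i'" "i \<in> ?A" "i' \<in> ?A" using * MAB[OF *(1)] MAB[OF *(4)] by simp_all
    then have "i = i'" by (rule inj_onD[OF bij_betw_imp_inj_on[OF h(1)]])
    then show ?thesis using * M(2) by blast
  qed
  moreover have "x = x'" if xy: "(x, y) \<in> N" "(x', y) \<in> N" for x x' y
  proof -
    obtain i j i' j' where *: "(i, j) \<in> M" "x = h i" "y = k j" "(i', j') \<in> M" "x' = h i'" "y = k j'"
      using xy by (auto simp: N_def)
    have "k j = k j'" "j \<in> ?B" "j' \<in> ?B" using * MAB[OF *(1)] MAB[OF *(4)] by simp_all
    then have "j = j'" by (rule inj_onD[OF bij_betw_imp_inj_on[OF k(1)]])
    then show ?thesis using * M(3) by blast
  qed
  moreover have "x \<in> Domain N"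
    if x: "x \<in> copies (dgm U)" "snd (fst x) - fst (fst x) > ereal (2 * (\<epsilon> + \<delta>))" for x
  proof -
    have "dgm U (fst x) \<noteq> 0" using x(1) by (auto simp: copies_def)
    then have gap: "fst (fst x) + ereal (2 * (\<epsilon> + \<delta>)) < snd (fst x)"
      using x(2) gap_iff U.dgm_nonzero by blast
    moreover have "fst (fst x) + ereal (2 * \<delta>) \<le> fst (fst x) + ereal (2 * (\<epsilon> + \<delta>))"
      using \<epsilon> by (intro add_left_mono) simp
    ultimately have "x \<in> h ` ?A" unfolding bij_betw_imp_surj_on[OF h(1)] using x(1) by auto
    then obtain i where i: "i \<in> ?A" "x = h i" by blast
    then have "long_bar \<epsilon> (fst i)" using long(1)[OF gap] h(2) by blast
    then show ?thesis using M(4) i N by blast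
  qed
  moreover have "y \<in> Range N"
    if y: "y \<in> copies (dgm V)" "snd (fst y) - fst (fst y) > ereal (2 * (\<epsilon> + \<delta>))" for y
  proof -
    have "dgm V (fst y) \<noteq> 0" using y(1) by (auto simp: copies_def)
    then have gap: "fst (fst y) + ereal (2 * (\<epsilon> + \<delta>)) < snd (fst y)"
      using y(2) gap_iff V.dgm_nonzero by blast
    moreover have "fst (fst y) + ereal (2 * \<delta>) \<le> fst (fst y) + ereal (2 * (\<epsilon> + \<delta>))"
      using \<epsilon> by (intro add_left_mono) simp
    ultimately have "y \<in> k ` ?B" unfolding bij_betw_imp_surj_on[OF k(1)] using y(1) by auto
    then obtain j where j: "j \<in> ?B" "y = k j" by blast
    then have "long_bar \<epsilon> (fst j)" using long(1)[OF gap] k(2) by blast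
    then show ?thesis using M(5) j N by blast
  qed
  moreover have "ediff (fst (fst x)) (fst (fst y)) \<le> ereal (\<epsilon> + \<delta>) \<and> ediff (snd (fst x)) (snd (fst y)) \<le> ereal (\<epsilon> + \<delta>)"
    if xy: "(x, y) \<in> N" for x y
  proof -
    obtain i j where ij: "(i, j) \<in> M" "x = h i" "y = k j" using xy by (auto simp: N_def)
    have "fst x = (lo (fst i) - ereal \<delta>, hi (fst i) + ereal \<delta>)" "fst y = (lo (fst j) - ereal \<delta>, hi (fst j) + ereal \<delta>)"
      using MAB[OF ij(1)] ij h(2) k(2) by simp_all
    moreover have "ereal \<epsilon> \<le> ereal (\<epsilon> + \<delta>)" using \<delta> by simp
    ultimately show ?thesis
      using MAB[OF ij(1)] unfolding close_bars_def by (auto simp: ediff_shift intro: order_trans)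
  qed
  ultimately have "eps_matching (\<epsilon> + \<delta>) (dgm U) (dgm V) N"
    unfolding eps_matching_iff matching_def by (intro conjI ballI allI impI) auto
  then show ?thesis by blast
qed

text \<open>The parameter is the sum of \<delta> from \<open>U\<close> to its smoothing, \<epsilon>
  + \<delta> between the smoothings, and \<delta> back to \<open>V\<close>.\<close>

theorem interleaving_of_matching:
  fixes U :: "('f::field, 'u::ab_group_add) pmodule" and V :: "('f, 'v::ab_group_add) pmodule"
  assumes "q_tame_pmod U" "q_tame_pmod V" and \<epsilon>: "0 \<le> \<epsilon>" and \<delta>: "0 < \<delta>"
    and N: "eps_matching \<epsilon> (dgm U) (dgm V) N"
  shows "\<exists>\<phi> \<psi>. interleaving (\<epsilon> + 3 * \<delta>) U V \<phi> \<psi>"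
proof -
  interpret U: q_tame_pmod U by fact
  interpret V: q_tame_pmod V by fact
  obtain e where e: "ibasis (smoothing \<delta> U) (U.bars \<delta>) fst e" using U.bars_basis[OF \<delta>] by blast
  obtain f where f: "ibasis (smoothing \<delta> V) (V.bars \<delta>) fst f" using V.bars_basis[OF \<delta>] by blast
  interpret Us: ibasis "smoothing \<delta> U" "U.bars \<delta>" fst e by fact
  interpret Vs: ibasis "smoothing \<delta> V" "V.bars \<delta>" fst f by fact
  from U.dgm_bij[OF \<delta>] obtain h where h: "bij_betw h {i \<in> U.bars \<delta>. lo (fst i) < hi (fst i)}
      {x \<in> copies (dgm U). fst (fst x) + ereal (2 * \<delta>) < snd (fst x)}"
    "\<forall>i\<in>U.bars \<delta>. lo (fst i) < hi (fst i) \<longrightarrow> fst (h i) = (lo (fst i) - ereal \<delta>, hi (fst i) + ereal \<delta>)" by (elim exE conjE) (rule that)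
  from V.dgm_bij[OF \<delta>] obtain k where k: "bij_betw k {j \<in> V.bars \<delta>. lo (fst j) < hi (fst j)}
      {x \<in> copies (dgm V). fst (fst x) + ereal (2 * \<delta>) < snd (fst x)}"
    "\<forall>j\<in>V.bars \<delta>. lo (fst j) < hi (fst j) \<longrightarrow> fst (k j) = (lo (fst j) - ereal \<delta>, hi (fst j) + ereal \<delta>)" by (elim exE conjE) (rule that)
  let ?A = "{i \<in> U.bars \<delta>. lo (fst i) < hi (fst i)}" and ?B = "{j \<in> V.bars \<delta>. lo (fst j) < hi (fst j)}"
  note N' = N[unfolded eps_matching_iff matching_def]
  note N_sub = conjunct1[OF conjunct1[OF N']]
  note N_left = conjunct1[OF conjunct2[OF conjunct1[OF N']], rule_format]
  note N_right = conjunct2[OF conjunct2[OF conjunct1[OF N']], rule_format]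
  note N_dom = conjunct1[OF conjunct2[OF N'], rule_format]
  note N_ran = conjunct1[OF conjunct2[OF conjunct2[OF N']], rule_format]
  note N_diff = bspec[OF conjunct2[OF conjunct2[OF conjunct2[OF N']]], unfolded case_prod_conv]
  \<comment> \<open>\<open>N\<close> is restricted to the points visible in both smoothings, those
    of persistence more than 2\<delta>.\<close>
  define M where "M = {(i, j). i \<in> ?A \<and> j \<in> ?B \<and> (h i, k j) \<in> N}"
  \<comment> \<open>A bar longer than 2\<epsilon> gives a point of persistence more than 2\<epsilon>
    + 2\<delta>. Each endpoint of its partner under \<open>N\<close> differs by at most \<epsilon>,
    which leaves more than 2\<delta>, so the restriction to visible points does not lose the
    partner.\<close>
  have long: "b' + ereal (2 * \<delta>) < d'"
    if "long_bar \<epsilon> S" "S \<noteq> {}" "ediff (lo S - ereal \<delta>) b' \<le> ereal \<epsilon>" "ediff (hi S + ereal \<delta>) d' \<le> ereal \<epsilon>"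
    for S b' d'
    using that \<delta> lo_neq_infinity[OF that(2)] hi_neq_minus_infinity[OF that(2)]
    unfolding ediff_le_iff[OF \<epsilon>] long_bar_def
    by (cases "lo S"; cases "hi S"; cases b'; cases d') auto
  have gap: "(hi S + ereal \<delta>) - (lo S - ereal \<delta>) > ereal (2 * \<epsilon>)" if "long_bar \<epsilon> S" for S
    using that \<delta> unfolding long_bar_def by (cases "lo S"; cases "hi S") auto
  have ediff_commute: "ediff x y = ediff y x" for x y
    by (cases x; cases y) (auto simp: ediff_def)
  have "matched (smoothing \<delta> U) (U.bars \<delta>) fst e (smoothing \<delta> V) (V.bars \<delta>) fst f M \<epsilon> (\<epsilon> + \<delta>)"
  proof unfold_locales
    show "0 \<le> \<epsilon>" "\<epsilon> < \<epsilon> + \<delta>" using \<epsilon> \<delta> by simp_all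
    show "M \<subseteq> U.bars \<delta> \<times> V.bars \<delta>" by (auto simp: M_def)
    show "j = j'" if "(i, j) \<in> M" "(i, j') \<in> M" for i j j'
    proof -
      have "j \<in> ?B" "j' \<in> ?B" using that by (auto simp: M_def)
      moreover have "k j = k j'" using that by (intro N_left[of "h i"]) (auto simp: M_def)
      ultimately show ?thesis using inj_onD[OF bij_betw_imp_inj_on[OF k(1)]] by blast
    qed
    show "i = i'" if "(i, j) \<in> M" "(i', j) \<in> M" for i i' j
    proof -
      have "i \<in> ?A" "i' \<in> ?A" using that by (auto simp: M_def)
      moreover have "h i = h i'" using that by (intro N_right[of _ "k j"]) (auto simp: M_def)
      ultimately show ?thesis using inj_onD[OF bij_betw_imp_inj_on[OF h(1)]] by blast
    qed
    show "close_bars \<epsilon> (fst i) (fst j)" if "(i, j) \<in> M" for i j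
    proof -
      have ij: "i \<in> ?A" "j \<in> ?B" "(h i, k j) \<in> N" using that by (auto simp: M_def)
      then show ?thesis using N_diff[OF ij(3)] h(2) k(2) by (simp add: ediff_shift close_bars_def)
    qed
    show "i \<in> Domain M" if i: "i \<in> U.bars \<delta>" "long_bar \<epsilon> (fst i)" for i
    proof -
      have iA: "i \<in> ?A" using long_bar_nondegenerate[OF \<epsilon>] i by simp
      then have fh: "fst (h i) = (lo (fst i) - ereal \<delta>, hi (fst i) + ereal \<delta>)" using h(2) by simp
      have "h i \<in> h ` ?A" using iA by blast
      then have "h i \<in> copies (dgm U)" unfolding bij_betw_imp_surj_on[OF h(1)] by simp
      then obtain y where y: "(h i, y) \<in> N" using N_dom[of "h i"] gap[OF i(2)] fh by auto
      have "fst (fst y) + ereal (2 * \<delta>) < snd (fst y)"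
        using long[OF i(2) Us.nonempty[OF i(1)]] N_diff[OF y] fh by simp
      then have "y \<in> k ` ?B" unfolding bij_betw_imp_surj_on[OF k(1)] using y N_sub by auto
      then obtain j where "j \<in> ?B" "y = k j" by blast
      then have "(i, j) \<in> M" using iA y by (simp add: M_def)
      then show ?thesis by blast
    qed
    show "j \<in> Range M" if j: "j \<in> V.bars \<delta>" "long_bar \<epsilon> (fst j)" for j
    proof -
      have jB: "j \<in> ?B" using long_bar_nondegenerate[OF \<epsilon>] j by simp
      then have fk: "fst (k j) = (lo (fst j) - ereal \<delta>, hi (fst j) + ereal \<delta>)" using k(2) by simp
      have "k j \<in> k ` ?B" using jB by blast
      then have "k j \<in> copies (dgm V)" unfolding bij_betw_imp_surj_on[OF k(1)] by simp
      then obtain x where x: "(x, k j) \<in> N" using N_ran[of "k j"] gap[OF j(2)] fk by auto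
      have "fst (fst x) + ereal (2 * \<delta>) < snd (fst x)"
        using long[OF j(2) Vs.nonempty[OF j(1)]] N_diff[OF x] fk ediff_commute by simp
      then have "x \<in> h ` ?A" unfolding bij_betw_imp_surj_on[OF h(1)] using x N_sub by auto
      then obtain i where "i \<in> ?A" "x = h i" by blast
      then have "(i, j) \<in> M" using jB x by (simp add: M_def)
      then show ?thesis by blast
    qed
  qed
  from matched.matched_interleaving[OF this]
  obtain \<phi> \<psi> where s: "interleaving (\<epsilon> + \<delta>) (smoothing \<delta> U) (smoothing \<delta> V) \<phi> \<psi>" by blast
  have \<delta>': "0 \<le> \<delta>" "0 \<le> \<epsilon> + \<delta>" using \<delta> \<epsilon> by simp_all
  note U1 = U.smoothing_interleaving[OF \<delta>'(1)] and V1 = interleaving_sym[OF V.smoothing_interleaving[OF \<delta>'(1)]]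
  note 1 = interleaving_trans[OF U.pmod_axioms Vs.pmod_axioms \<delta>' U1 s]
  have "0 \<le> \<delta> + (\<epsilon> + \<delta>)" using \<delta>' by simp
  note 2 = interleaving_trans[OF U.pmod_axioms V.pmod_axioms this \<delta>'(1) 1 V1]
  have "\<delta> + (\<epsilon> + \<delta>) + \<delta> = \<epsilon> + 3 * \<delta>" by simp
  then show ?thesis using 2 by metis
qed

theorem theorem7p2:
  fixes U :: "('f::field, 'u::ab_group_add) pmodule"
    and V :: "('f, 'v::ab_group_add) pmodule"
  assumes "persistence_module U" and "q_tame U"
    and "persistence_module V" and "q_tame V"
  shows "d_I U V = d_B (dgm U) (dgm V)"
proof -
  have q: "q_tame_pmod U" "q_tame_pmod V"
    using assms by (auto intro!: q_tame_pmod.intro pmod.intro q_tame_pmod_axioms.intro)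
  show ?thesis
  proof (rule antisym)
    show "d_I U V \<le> d_B (dgm U) (dgm V)"
      unfolding d_B_def
    proof (rule Inf_greatest, clarify)
      fix \<epsilon> N assume N: "0 < \<epsilon>" "eps_matching \<epsilon> (dgm U) (dgm V) N"
      show "d_I U V \<le> ereal \<epsilon>"
      proof (rule ereal_le_epsilon2)
        fix r :: real assume r: "0 < r"
        then have "\<exists>\<phi> \<psi>. interleaving (\<epsilon> + 3 * (r / 3)) U V \<phi> \<psi>"
          using N by (intro interleaving_of_matching[OF q]) auto
        then have "d_I U V \<le> ereal (\<epsilon> + r)"
          unfolding d_I_def using N r by (intro Inf_lower) auto
        then show "d_I U V \<le> ereal \<epsilon> + ereal r" by simp
      qed
    qed
    show "d_B (dgm U) (dgm V) \<le> d_I U V"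
      unfolding d_I_def
    proof (rule Inf_greatest, clarify)
      fix \<epsilon> \<phi> \<psi> assume i: "0 < \<epsilon>" "interleaving \<epsilon> U V \<phi> \<psi>"
      show "d_B (dgm U) (dgm V) \<le> ereal \<epsilon>"
      proof (rule ereal_le_epsilon2)
        fix r :: real assume r: "0 < r"
        then have "\<exists>M. eps_matching (\<epsilon> + r) (dgm U) (dgm V) M"
          using i by (intro matching_of_interleaving[OF q]) auto
        then have "d_B (dgm U) (dgm V) \<le> ereal (\<epsilon> + r)"
          unfolding d_B_def using i r by (intro Inf_lower) auto
        then show "d_B (dgm U) (dgm V) \<le> ereal \<epsilon> + ereal r" by simp
      qed
    qed
  qed
qed

end
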